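(* Let $(x_0,\xi_0)\in\mathbb{R}^d\times(\mathbb{R}^d\setminus\{0\})$ and set $(x(t),\xi(t))=\exp(tH_k)(x_0,\xi_0)$. Then the limits \[ x_\pm=\lim_{t\to\pm\infty}\bigl(x(t)-\nabla_\xi\Psi(t,\xi(t))\bigr),\qquad \xi_\pm=\lim_{t\to\pm\infty}\xi(t) \] exist (for each choice of sign). Moreover, writing $W^{cl}_\pm:(x_\pm,\xi_\pm)\mapsto(x_0,\xi_0)$, the maps $W^{cl}_+$ and $W^{cl}_-$ are diffeomorphisms in $\mathbb{R}^d\times(\mathbb{R}^d\setminus\{0\})$.
   Context: Let $d\ge1$ and $\langle x\rangle=(1+|x|^2)^{1/2}$. Let $a_{mn}\in C^\infty(\mathbb{R}^d;\mathbb{R})$ ($1\le m,n\le d$) and $V\in C^\infty(\mathbb{R}^d;\mathbb{R})$, with $(a_{mn}(x))_{m,n}$ a positive (definite) symmetric matrix for each $x$. Standing assumptions: (1) There is $\mu>1/2$ such that for every multi-index $\alpha\in\mathbb{Z}_+^d$ there is $C_\alpha>0$ with $|\partial_x^\alpha(a_{mn}(x)-\delta_{mn})|\le C_\alpha\langle x\rangle^{-\mu-|\alpha|}$ and $|\partial_x^\alpha V(x)|\le C_\alpha\langle x\rangle^{2-\mu-|\alpha|}$ for all $x\in\mathbb{R}^d$. (2) $V=V^{(L)}+V^{(S)}$ with $V^{(L)},V^{(S)}\in C^\infty(\mathbb{R}^d;\mathbb{R})$, where for all $\alpha$, $|\partial_x^\alpha V^{(L)}(x)|\le C_\alpha\langle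 x\rangle^{2-\mu-|\alpha|}$ and $|\partial_x^\alpha V^{(S)}(x)|\le C_\alpha\langle x\rangle^{2-\nu-|\alpha|}$ with some $\nu>1$. Let $k(x,\xi)=\frac12\sum_{m,n=1}^d a_{mn}(x)\xi_m\xi_n$, and let $\exp(tH_k)$ be its Hamilton flow: $\exp(tH_k)(x_0,\xi_0)=(x(t),\xi(t))$ where $x'(t)=\frac{\partial k}{\partial\xi}(x(t),\xi(t))$, $\xi'(t)=-\frac{\partial k}{\partial x}(x(t),\xi(t))$, $x(0)=x_0$, $\xi(0)=\xi_0$ (it exists for all $t\in\mathbb{R}$). (3) (Nontrapping) For every $(x_0,\xi_0)$ with $\xi_0\ne0$, the trajectory $(x(t),\xi(t))=\exp(tH_k)(x_0,\xi_0)$ satisfies $|x(t)|\to\infty$ as $t\to\pm\infty$. Define $\Psi(t,\xi)=\int_0^t k(s\xi,\xi)\,ds$. *)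

theory Defs
  imports "HOL-Analysis.Analysis"
begin

text \<open>The \<open>C\<^sup>k\<close> functions on an open set \<open>S\<close>: in finite dimension, continuity of all directional
  derivatives of order \<open>k\<close> is continuity of the \<open>k\<close>-th derivative. Only used for open \<open>S\<close>.\<close>

primrec Ck_on :: "nat \<Rightarrow> ('a::euclidean_space \<Rightarrow> 'b::real_normed_vector) \<Rightarrow> 'a set \<Rightarrow> bool" where
  "Ck_on 0 f S \<longleftrightarrow> continuous_on S f"
| "Ck_on (Suc k) f S \<longleftrightarrow>
     (\<forall>x\<in>S. f differentiable (at x)) \<and> (\<forall>v. Ck_on k (\<lambda>x. frechet_derivative f (at x) v) S)"

definition smooth_on :: "('a::euclidean_space \<Rightarrow> 'b::real_normed_vector) \<Rightarrow> 'a set \<Rightarrow> bool" where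
  "smooth_on f S \<longleftrightarrow> (\<forall>k. Ck_on k f S)"

definition diffeomorphism_on ::
  "('a::euclidean_space \<Rightarrow> 'b::euclidean_space) \<Rightarrow> 'a set \<Rightarrow> 'b set \<Rightarrow> bool" where
  "diffeomorphism_on f S T \<longleftrightarrow> bij_betw f S T \<and> smooth_on f S \<and> smooth_on (inv_into S f) T"

definition partial_deriv :: "'n \<Rightarrow> (real^'n \<Rightarrow> real) \<Rightarrow> real^'n \<Rightarrow> real" where
  "partial_deriv i f x = frechet_derivative f (at x) (axis i 1)"

definition grad :: "(real^'n \<Rightarrow> real) \<Rightarrow> real^'n \<Rightarrow> real^'n" where
  "grad f x = (\<chi> i. partial_deriv i f x)"

text \<open>For a multi-index \<open>\<alpha>\<close>, each index \<open>i\<close> is differentiated \<open>\<alpha> i\<close> times. The order of differentiation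
  is left to the choice operator; it is irrelevant for the smooth functions considered, whose
  partial derivatives commute.\<close>

definition multi_deriv :: "('n \<Rightarrow> nat) \<Rightarrow> (real^'n \<Rightarrow> real) \<Rightarrow> real^'n \<Rightarrow> real" where
  "multi_deriv \<alpha> f = foldr partial_deriv (SOME is. \<forall>i. count_list is i = \<alpha> i) f"

lemma ex_list_of_multi_index: "\<exists>is. \<forall>i. count_list is i = \<alpha> i" for \<alpha> :: "'n::finite \<Rightarrow> nat"
proof -
  obtain js where js: "set js = (UNIV :: 'n set)" "distinct js"
    using finite_distinct_list[OF finite_class.finite_UNIV] by blast
  have rep: "count_list (replicate n j) i = (if i = j then n else 0)" for n and j i :: 'n
    by (induction n) auto
  have "count_list (concat (map (\<lambda>j. replicate (\<alpha> j) j) ks)) i = (if i \<in> set ks then \<alpha> i else 0)"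
    if "distinct ks" for ks i
    using that by (induction ks) (auto simp: rep)
  from this[OF js(2)] js(1) show ?thesis by auto
qed

definition mi_order :: "('n::finite \<Rightarrow> nat) \<Rightarrow> nat" where
  "mi_order \<alpha> = (\<Sum>i\<in>UNIV. \<alpha> i)"

definition jbracket :: "real^'n \<Rightarrow> real" where
  "jbracket x = sqrt (1 + (norm x)\<^sup>2)"

definition kinetic :: "(real^'n \<Rightarrow> real^'n^'n) \<Rightarrow> real^'n \<Rightarrow> real^'n \<Rightarrow> real" where
  "kinetic a x \<xi> = 1/2 * (\<Sum>m\<in>UNIV. \<Sum>n\<in>UNIV. a x $ m $ n * \<xi> $ m * \<xi> $ n)"

definition hamilton_trajectory ::
  "(real^'n \<Rightarrow> real^'n \<Rightarrow> real) \<Rightarrow> (real^'n) \<times> (real^'n) \<Rightarrow> (real \<Rightarrow> (real^'n) \<times> (real^'n)) \<Rightarrow> bool" where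
  "hamilton_trajectory k p \<gamma> \<longleftrightarrow>
     \<gamma> 0 = p \<and>
     (\<forall>t. ((\<lambda>s. fst (\<gamma> s)) has_vector_derivative grad (\<lambda>\<xi>. k (fst (\<gamma> t)) \<xi>) (snd (\<gamma> t))) (at t) \<and>
          ((\<lambda>s. snd (\<gamma> s)) has_vector_derivative - grad (\<lambda>x. k x (snd (\<gamma> t))) (fst (\<gamma> t))) (at t))"

text \<open>The flow \<open>exp (t H\<^sub>k)\<close>. The global trajectory through each point exists and is unique when \<open>k\<close>
  is the kinetic energy of a smooth, uniformly elliptic metric (energy conservation bounds the momentum).\<close>

definition hamilton_flow ::
  "(real^'n \<Rightarrow> real^'n \<Rightarrow> real) \<Rightarrow> real \<Rightarrow> (real^'n) \<times> (real^'n) \<Rightarrow> (real^'n) \<times> (real^'n)" where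
  "hamilton_flow k t p = (THE \<gamma>. hamilton_trajectory k p \<gamma>) t"

text \<open>The interval integral is oriented, as needed for negative \<open>t\<close>.\<close>

definition Psi :: "(real^'n \<Rightarrow> real^'n \<Rightarrow> real) \<Rightarrow> real \<Rightarrow> real^'n \<Rightarrow> real" where
  "Psi k t \<xi> = (LBINT s=ereal 0..ereal t. k (s *\<^sub>R \<xi>) \<xi>)"

definition modified_position ::
  "(real^'n \<Rightarrow> real^'n \<Rightarrow> real) \<Rightarrow> (real^'n) \<times> (real^'n) \<Rightarrow> real \<Rightarrow> real^'n" where
  "modified_position k p t =
     fst (hamilton_flow k t p) - grad (Psi k t) (snd (hamilton_flow k t p))"

definition momentum ::
  "(real^'n \<Rightarrow> real^'n \<Rightarrow> real) \<Rightarrow> (real^'n) \<times> (real^'n) \<Rightarrow> real \<Rightarrow> real^'n" where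
  "momentum k p t = snd (hamilton_flow k t p)"

definition phase_space :: "((real^'n) \<times> (real^'n)) set" where
  "phase_space = UNIV \<times> (UNIV - {0})"

text \<open>The map \<open>(x\<^sub>0, \<xi>\<^sub>0) \<mapsto> (x\<^sub>\<plusminus>, \<xi>\<^sub>\<plusminus>)\<close>, with \<open>F\<close> being \<open>at_top\<close> for the sign \<open>+\<close> and \<open>at_bot\<close> for \<open>-\<close>;
  the classical wave map is its inverse (well defined once this map is known to be a bijection of
  the phase space).\<close>

definition asymptotic_data ::
  "(real^'n \<Rightarrow> real^'n \<Rightarrow> real) \<Rightarrow> real filter \<Rightarrow> (real^'n) \<times> (real^'n) \<Rightarrow> (real^'n) \<times> (real^'n)" where
  "asymptotic_data k F p = (Lim F (modified_position k p), Lim F (momentum k p))"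

definition classical_wave_map ::
  "(real^'n \<Rightarrow> real^'n \<Rightarrow> real) \<Rightarrow> real filter \<Rightarrow> (real^'n) \<times> (real^'n) \<Rightarrow> (real^'n) \<times> (real^'n)" where
  "classical_wave_map k F = inv_into phase_space (asymptotic_data k F)"

end

theory Submission
  imports Defs
begin

text \<open>
  Hamilton's equations for the free energy \<open>k\<close> are rewritten in the coordinates
  \<open>z = (x - \<nabla>\<^sub>\<xi> \<Psi>(t, \<xi>), \<xi>)\<close>, which coincide with \<open>(x, \<xi>)\<close> at \<open>t = 0\<close>. The resulting equation
  \<open>z' = X(t, z)\<close> has a right-hand side that decays, together with all its \<open>z\<close>-derivatives, like
  \<open>t powr (- 2 \<mu>)\<close>, because \<open>x - t \<xi> = O(t powr (1 - \<mu>))\<close> and the position part of \<open>X\<close> consists of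
  differences of derivatives of \<open>k\<close> between \<open>x\<close> and \<open>t \<xi>\<close> and of the product of
  \<open>\<nabla>\<^sub>\<xi>\<^sup>2 \<Psi> - t = O(t powr (1 - \<mu>))\<close> with \<open>\<nabla>\<^sub>x k = O(t powr (- 1 - \<mu>))\<close>; one may assume \<open>\<mu> < 1\<close>. As \<open>2 \<mu> > 1\<close>, a change of time
  compactifies \<open>[0, \<infinity>]\<close> to \<open>[0, 1]\<close> and turns the equation into one whose right-hand side is continuous
  up to the end point, with all its \<open>z\<close>-derivatives. The map \<open>(x\<^sub>0, \<xi>\<^sub>0) \<mapsto> (x\<^sub>+, \<xi>\<^sub>+)\<close> is then the flow of an
  ordinary differential equation over a compact time interval, so that existence, uniqueness and
  smooth dependence on the data, used from both end points, make it a diffeomorphism. The nontrapping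
  assumption and the virial \<open>x \<bullet> \<xi>\<close> ensure that the trajectories do not leave the regions on which \<open>X\<close> is small.
\<close>

section \<open>Families of differentiable functions with weights\<close>

text \<open>The obstacle is infinite time: convergence of the modified data by itself gives neither
  differentiability nor invertibility of the limit map, and a direct argument would need bounds on
  every derivative of the flow, uniform in time. With infinity as an ordinary end point, only the
  vector field has to be estimated together with its derivatives. The final-value problem at
  infinity becomes an initial-value problem at time 1. Its solution is needed only close to 1, since
  the complete Hamilton flow continues it from there back to 0.

  Two features make the estimates close. A derivative of a coefficient at a position of size
  \<open>t\<close> gains \<open>1 / t\<close>, while the position has derivatives of size at most
  \<open>t\<close>, so all orders share one weight. And \<open>\<Psi>\<close> removes the error
  along the free ray, leaving differences over a displacement of order
  \<open>t powr (1 - \<mu>)\<close>; this improves \<open>t powr (- \<mu>)\<close>, which is not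
  integrable for \<open>\<mu> < 1\<close>, to \<open>t powr (- 2 * \<mu>)\<close>, which is. Of the
  compactified field only continuity in time is kept, so regularity is tracked in the phase-space
  variable alone.\<close>

text \<open>The bound by a multiple of \<open>w\<close> is required on each region of the family \<open>\<K>\<close>; with \<open>\<K> = {}\<close> the weight
  is irrelevant and only joint continuity of the derivatives in the second argument remains.\<close>

definition weight_bounded :: "(real \<times> 'a::euclidean_space) set set \<Rightarrow> real set \<Rightarrow> 'a set \<Rightarrow> (real \<Rightarrow> real) \<Rightarrow>
    (real \<Rightarrow> 'a \<Rightarrow> 'b::real_normed_vector) \<Rightarrow> bool" where
  "weight_bounded \<K> T S w f \<longleftrightarrow> continuous_on (T \<times> S) (\<lambda>(t, x). f t x) \<and>
     (\<forall>K\<in>\<K>. \<exists>C. \<forall>t\<in>T. \<forall>x\<in>S. (t, x) \<in> K \<longrightarrow> norm (f t x) \<le> C * w t)"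

text \<open>Directional derivatives take values in the type of \<open>f\<close> again, so the order
  can serve as recursion variable. The weight is the same at every order.\<close>

primrec Ck_family :: "nat \<Rightarrow> (real \<times> 'a::euclidean_space) set set \<Rightarrow> real set \<Rightarrow> 'a set \<Rightarrow> (real \<Rightarrow> real) \<Rightarrow>
    (real \<Rightarrow> 'a \<Rightarrow> 'b::real_normed_vector) \<Rightarrow> bool" where
  "Ck_family 0 \<K> T S w f \<longleftrightarrow> weight_bounded \<K> T S w f"
| "Ck_family (Suc k) \<K> T S w f \<longleftrightarrow> weight_bounded \<K> T S w f \<and>
     (\<forall>t\<in>T. \<forall>x\<in>S. f t differentiable (at x)) \<and>
     (\<forall>v. Ck_family k \<K> T S w (\<lambda>t x. frechet_derivative (f t) (at x) v))"

section \<open>Closure properties of weighted families\<close>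

lemma weight_bounded_cong:
  assumes "\<And>t x. t \<in> T \<Longrightarrow> x \<in> S \<Longrightarrow> f t x = g t x"
  shows "weight_bounded \<K> T S w f \<longleftrightarrow> weight_bounded \<K> T S w g"
proof -
  have "continuous_on (T \<times> S) (\<lambda>(t, x). f t x) \<longleftrightarrow> continuous_on (T \<times> S) (\<lambda>(t, x). g t x)"
    by (rule continuous_on_cong) (auto simp: assms)
  then show ?thesis
    unfolding weight_bounded_def using assms by simp
qed

lemma Ck_family_cong:
  assumes "open S" "\<And>t x. t \<in> T \<Longrightarrow> x \<in> S \<Longrightarrow> f t x = g t x"
  shows "Ck_family k \<K> T S w f \<longleftrightarrow> Ck_family k \<K> T S w g"
  using assms(2)
proof (induction k arbitrary: f g)
  case 0
  then show ?case using weight_bounded_cong[of T S f g] by simp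
next
  case (Suc k)
  have *: "frechet_derivative (f t) (at x) = frechet_derivative (g t) (at x)"
      "f t differentiable (at x) \<longleftrightarrow> g t differentiable (at x)" if "t \<in> T" "x \<in> S" for t x
  proof -
    show d: "f t differentiable (at x) \<longleftrightarrow> g t differentiable (at x)"
      unfolding differentiable_def
      using has_derivative_transform_within_open[OF _ assms(1) that(2), of "f t" _ UNIV "g t"]
        has_derivative_transform_within_open[OF _ assms(1) that(2), of "g t" _ UNIV "f t"] Suc.prems[OF that(1)]
      by metis
    show "frechet_derivative (f t) (at x) = frechet_derivative (g t) (at x)"
    proof (cases "f t differentiable (at x)")
      case True
      then show ?thesis
        using frechet_derivative_transform_within_open[OF True assms(1) that(2)] Suc.prems[OF that(1)] by auto
    next
      \<comment> \<open>Where neither function is differentiable, both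
        \<open>frechet_derivative\<close>s are choices from the same empty predicate, hence
        equal.\<close>
      case False
      then have "\<not> (f t has_derivative A) (at x)" "\<not> (g t has_derivative A) (at x)" for A
        using d by (auto simp: differentiable_def)
      then show ?thesis unfolding frechet_derivative_def by auto
    qed
  qed
  have "weight_bounded \<K> T S w f \<longleftrightarrow> weight_bounded \<K> T S w g"
    using weight_bounded_cong[of T S f g] Suc.prems by simp
  moreover have "Ck_family k \<K> T S w (\<lambda>t x. frechet_derivative (f t) (at x) v) \<longleftrightarrow>
       Ck_family k \<K> T S w (\<lambda>t x. frechet_derivative (g t) (at x) v)" for v
    by (rule Suc.IH) (simp add: *)
  ultimately show ?case using *(2) by auto
qed

text \<open>Lets the derivative be given by a formula: on the open set \<open>S\<close> it agrees
  with \<open>frechet_derivative\<close>, and the congruence lemma transfers the family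
  property.\<close>

lemma Ck_family_SucI:
  assumes "open S" "weight_bounded \<K> T S w f"
    and der: "\<And>t x. t \<in> T \<Longrightarrow> x \<in> S \<Longrightarrow> (f t has_derivative f' t x) (at x)"
    and "\<And>v. Ck_family k \<K> T S w (\<lambda>t x. f' t x v)"
  shows "Ck_family (Suc k) \<K> T S w f"
proof -
  have "Ck_family k \<K> T S w (\<lambda>t x. frechet_derivative (f t) (at x) v)" for v
    using assms(4)[of v] Ck_family_cong[OF assms(1), of T "\<lambda>t x. f' t x v" "\<lambda>t x. frechet_derivative (f t) (at x) v"]
      frechet_derivative_at[OF der] by simp
  then show ?thesis using assms(2) der by (auto simp: differentiable_def)
qed

lemma Ck_family_SucD:
  assumes "Ck_family (Suc k) \<K> T S w f"
  shows "\<And>t x. t \<in> T \<Longrightarrow> x \<in> S \<Longrightarrow> (f t has_derivative frechet_derivative (f t) (at x)) (at x)"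
    "\<And>v. Ck_family k \<K> T S w (\<lambda>t x. frechet_derivative (f t) (at x) v)"
  using assms frechet_derivative_works by auto

lemma Ck_family_weight_bounded: "Ck_family k \<K> T S w f \<Longrightarrow> weight_bounded \<K> T S w f"
  by (cases k) auto

lemma Ck_family_cont: "Ck_family k \<K> T S w f \<Longrightarrow> continuous_on (T \<times> S) (\<lambda>(t, x). f t x)"
  using Ck_family_weight_bounded weight_bounded_def by metis

lemma Ck_family_Suc_imp: "Ck_family (Suc k) \<K> T S w f \<Longrightarrow> Ck_family k \<K> T S w f"
  by (induction k arbitrary: f) auto

lemma Ck_family_le: "Ck_family k \<K> T S w f \<Longrightarrow> j \<le> k \<Longrightarrow> Ck_family j \<K> T S w f"
proof (induction k)
  case (Suc k)
  then show ?case using Ck_family_Suc_imp[OF Suc.prems(1)] by (cases "j = Suc k") (auto simp del: Ck_family.simps)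
qed simp

lemma Ck_family_add:
  assumes "open S"
  shows "Ck_family k \<K> T S w f \<Longrightarrow> Ck_family k \<K> T S w g \<Longrightarrow> Ck_family k \<K> T S w (\<lambda>t x. f t x + g t x)"
proof -
  have wb: "weight_bounded \<K> T S w (\<lambda>t x. f t x + g t x)"
    if f: "weight_bounded \<K> T S w f" and g: "weight_bounded \<K> T S w g" for f g :: "real \<Rightarrow> 'a \<Rightarrow> 'b"
    unfolding weight_bounded_def
  proof (intro conjI ballI)
    show "continuous_on (T \<times> S) (\<lambda>(t, x). f t x + g t x)"
      using f g unfolding weight_bounded_def split_beta by (auto intro: continuous_on_add)
    fix K assume "K \<in> \<K>"
    then obtain C D where "\<forall>t\<in>T. \<forall>x\<in>S. (t, x) \<in> K \<longrightarrow> norm (f t x) \<le> C * w t"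
       "\<forall>t\<in>T. \<forall>x\<in>S. (t, x) \<in> K \<longrightarrow> norm (g t x) \<le> D * w t"
      using f g unfolding weight_bounded_def by metis
    then have "\<forall>t\<in>T. \<forall>x\<in>S. (t, x) \<in> K \<longrightarrow> norm (f t x + g t x) \<le> (C + D) * w t"
      by (auto simp: algebra_simps intro!: norm_triangle_mono)
    then show "\<exists>C. \<forall>t\<in>T. \<forall>x\<in>S. (t, x) \<in> K \<longrightarrow> norm (f t x + g t x) \<le> C * w t" by blast
  qed
  show "Ck_family k \<K> T S w f \<Longrightarrow> Ck_family k \<K> T S w g \<Longrightarrow> Ck_family k \<K> T S w (\<lambda>t x. f t x + g t x)"
  proof (induction k arbitrary: f g)
    case (Suc k)
    note f = Ck_family_SucD[OF Suc.prems(1)] and g = Ck_family_SucD[OF Suc.prems(2)]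
    show ?case
      by (rule Ck_family_SucI[OF assms(1) wb has_derivative_add[OF f(1) g(1)] Suc.IH[OF f(2) g(2)]])
        (use Suc.prems in auto)
  qed (auto simp: wb)
qed

text \<open>Each term of the product rule again has one factor of either weight, so the product of
  the weights serves at all orders.\<close>

lemma Ck_family_bilinear:
  fixes f :: "real \<Rightarrow> 'a::euclidean_space \<Rightarrow> 'b::real_normed_vector" and g :: "real \<Rightarrow> 'a \<Rightarrow> 'c::real_normed_vector"
    and prod :: "'b \<Rightarrow> 'c \<Rightarrow> 'd::real_normed_vector"
  assumes "open S" and bl: "bounded_bilinear prod"
  shows "Ck_family k \<K> T S w f \<Longrightarrow> Ck_family k \<K> T S u g \<Longrightarrow>
    Ck_family k \<K> T S (\<lambda>t. w t * u t) (\<lambda>t x. prod (f t x) (g t x))"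
proof -
  interpret bounded_bilinear prod by fact
  have wb: "weight_bounded \<K> T S (\<lambda>t. w t * u t) (\<lambda>t x. prod (f t x) (g t x))"
    if f: "weight_bounded \<K> T S w f" and g: "weight_bounded \<K> T S u g" for f g
    unfolding weight_bounded_def
  proof (intro conjI ballI)
    show "continuous_on (T \<times> S) (\<lambda>(t, x). prod (f t x) (g t x))"
      using f g unfolding weight_bounded_def split_beta by (auto intro: continuous_on)
    fix K assume "K \<in> \<K>"
    then obtain C D where CD: "\<forall>t\<in>T. \<forall>x\<in>S. (t, x) \<in> K \<longrightarrow> norm (f t x) \<le> C * w t"
       "\<forall>t\<in>T. \<forall>x\<in>S. (t, x) \<in> K \<longrightarrow> norm (g t x) \<le> D * u t"
      using f g unfolding weight_bounded_def by metis
    obtain B where B: "B \<ge> 0" "\<And>a b. norm (prod a b) \<le> norm a * norm b * B" using nonneg_bounded by auto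
    have "norm (prod (f t x) (g t x)) \<le> (C * D * B) * (w t * u t)" if "t \<in> T" "x \<in> S" "(t, x) \<in> K" for t x
    proof -
      have "norm (prod (f t x) (g t x)) \<le> norm (f t x) * norm (g t x) * B" by (rule B)
      \<comment> \<open>No signs are assumed for \<open>C\<close>, \<open>D\<close>,
        \<open>w\<close> and \<open>u\<close>: the two factors are nonnegative because they bound
        norms.\<close>
      also have "\<dots> \<le> (C * w t) * (D * u t) * B"
        using CD that B(1) by (intro mult_right_mono mult_mono) (auto intro: order_trans[OF norm_ge_zero])
      finally show ?thesis by (simp add: algebra_simps)
    qed
    then show "\<exists>C. \<forall>t\<in>T. \<forall>x\<in>S. (t, x) \<in> K \<longrightarrow> norm (prod (f t x) (g t x)) \<le> C * (w t * u t)" by blast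
  qed
  show "Ck_family k \<K> T S w f \<Longrightarrow> Ck_family k \<K> T S u g \<Longrightarrow>
    Ck_family k \<K> T S (\<lambda>t. w t * u t) (\<lambda>t x. prod (f t x) (g t x))"
  proof (induction k arbitrary: f g)
    case (Suc k)
    note f = Ck_family_SucD[OF Suc.prems(1)] and g = Ck_family_SucD[OF Suc.prems(2)]
    show ?case
      by (rule Ck_family_SucI[OF assms(1) wb FDERIV[OF f(1) g(1)]
            Ck_family_add[OF assms(1) Suc.IH[OF Ck_family_Suc_imp g(2)] Suc.IH[OF f(2) Ck_family_Suc_imp]]])
        (use Suc.prems in auto)
  qed (auto simp: wb)
qed

lemma Ck_family_const_time:
  fixes h :: "real \<Rightarrow> 'b::real_normed_vector"
  assumes "open S" "continuous_on T h" "\<And>t. t \<in> T \<Longrightarrow> norm (h t) \<le> C * w t"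
  shows "Ck_family k \<K> T S w (\<lambda>t x. h t)"
proof -
  have "weight_bounded \<K> T S w (\<lambda>t x. h t)" 
    unfolding weight_bounded_def split_beta using assms(3)
    by (auto intro!: continuous_intros continuous_on_compose2[OF assms(2)])
  moreover have "Ck_family j \<K> T S w (\<lambda>t x. 0::'b)" for j
  proof (induction j)
    case (Suc j)
    then show ?case
      by (intro Ck_family_SucI[OF assms(1), where f' = "\<lambda>_ _ _. 0"])
         (auto simp: weight_bounded_def split_beta intro!: exI[of _ 0])
  qed (auto simp: weight_bounded_def split_beta intro!: exI[of _ 0])
  ultimately show ?thesis
    by (cases k) auto
qed

lemma Ck_family_zero: "open S \<Longrightarrow> Ck_family k \<K> T S w (\<lambda>t x. 0)"
  by (rule Ck_family_const_time[where C = 0]) auto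

lemma Ck_family_mono_weight:
  assumes "Ck_family k \<K> T S w f" "\<And>t. t \<in> T \<Longrightarrow> 0 \<le> w t" "\<And>t. t \<in> T \<Longrightarrow> w t \<le> c * u t"
  shows "Ck_family k \<K> T S u f"
proof -
  have wb: "weight_bounded \<K> T S u f" if f: "weight_bounded \<K> T S w f" for f :: "real \<Rightarrow> 'a \<Rightarrow> 'b"
    unfolding weight_bounded_def
  proof (intro conjI ballI)
    show "continuous_on (T \<times> S) (\<lambda>(t, x). f t x)" using f unfolding weight_bounded_def by auto
    fix K assume "K \<in> \<K>"
    then obtain C where C: "\<forall>t\<in>T. \<forall>x\<in>S. (t, x) \<in> K \<longrightarrow> norm (f t x) \<le> C * w t"
      using f unfolding weight_bounded_def by metis
    have "norm (f t x) \<le> (\<bar>C\<bar> * c) * u t" if "t \<in> T" "x \<in> S" "(t, x) \<in> K" for t x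
    proof -
      have "norm (f t x) \<le> \<bar>C\<bar> * w t"
        using C that assms(2)[OF that(1)] by (meson abs_ge_self mult_right_mono order_trans)
      also have "\<dots> \<le> \<bar>C\<bar> * (c * u t)" using assms(3) that by (intro mult_left_mono) auto
      finally show ?thesis by (simp add: algebra_simps)
    qed
    then show "\<exists>C. \<forall>t\<in>T. \<forall>x\<in>S. (t, x) \<in> K \<longrightarrow> norm (f t x) \<le> C * u t" by blast
  qed
  show ?thesis using assms(1)
    by (induction k arbitrary: f) (use wb in auto)
qed

lemma Ck_family_linear:
  fixes f :: "real \<Rightarrow> 'a::euclidean_space \<Rightarrow> 'b::real_normed_vector"
    and L :: "'b \<Rightarrow> 'c::real_normed_vector"
  assumes "open S" "bounded_linear L" "Ck_family k \<K> T S w f"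
  shows "Ck_family k \<K> T S w (\<lambda>t x. L (f t x))"
proof -
  have bl: "bounded_bilinear (\<lambda>(r::real) y. r *\<^sub>R L y)"
    using bounded_bilinear.comp[OF bounded_bilinear_scaleR bounded_linear_ident assms(2)] .
  have 1: "Ck_family k \<K> T S (\<lambda>t. 1) (\<lambda>t x. 1 :: real)"
    by (rule Ck_family_const_time[OF assms(1), where C = 1]) auto
  from Ck_family_bilinear[OF assms(1) bl 1 assms(3)] show ?thesis by simp
qed

lemma Ck_family_minus:
  "open S \<Longrightarrow> Ck_family k \<K> T S w f \<Longrightarrow> Ck_family k \<K> T S w (\<lambda>t x. - f t x)"
  by (rule Ck_family_linear[OF _ bounded_linear_minus[OF bounded_linear_ident]])

lemma Ck_family_diff:
  assumes "open S" "Ck_family k \<K> T S w f" "Ck_family k \<K> T S w g"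
  shows "Ck_family k \<K> T S w (\<lambda>t x. f t x - g t x)"
  using Ck_family_add[OF assms(1,2) Ck_family_minus[OF assms(1,3)]] by simp

lemma Ck_family_sum:
  assumes "open S" "\<And>i. i \<in> I \<Longrightarrow> Ck_family k \<K> T S w (f i)"
  shows "Ck_family k \<K> T S w (\<lambda>t x. \<Sum>i\<in>I. f i t x)"
proof (cases "finite I")
  case True
  then show ?thesis using assms(2)
    by (induction I) (auto intro!: Ck_family_zero Ck_family_add assms(1))
qed (auto intro: Ck_family_zero assms(1))

lemma linear_Basis_sum:
  fixes A :: "'c::euclidean_space \<Rightarrow> 'b::real_vector"
  assumes "linear A"
  shows "A u = (\<Sum>b\<in>Basis. (u \<bullet> b) *\<^sub>R A b)"
proof -
  have "A u = A (\<Sum>b\<in>Basis. (u \<bullet> b) *\<^sub>R b)" by (simp add: euclidean_representation)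
  also have "\<dots> = (\<Sum>b\<in>Basis. (u \<bullet> b) *\<^sub>R A b)" by (simp add: linear_sum[OF assms] linear_scale[OF assms])
  finally show ?thesis .
qed

lemma Ck_family_ignore: "Ck_family k \<K> T S w f \<Longrightarrow> Ck_family k {} T S u f"
  by (induction k arbitrary: f) (auto simp: weight_bounded_def)

text \<open>In the chain rule the derivative of \<open>f\<close> is applied to a direction that
  depends on \<open>x\<close>, while the induction hypothesis covers fixed directions. The expansion
  in \<open>Basis\<close> separates the two, and the bilinear rule recombines them.\<close>

lemma Ck_family_compose:
  fixes f :: "real \<Rightarrow> 'c::euclidean_space \<Rightarrow> 'b::real_normed_vector" and g :: "real \<Rightarrow> 'a::euclidean_space \<Rightarrow> 'c"
  assumes "open S" "\<And>t x. t \<in> T \<Longrightarrow> x \<in> S \<Longrightarrow> g t x \<in> U"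
  shows "Ck_family k {} T U w f \<Longrightarrow> Ck_family k {} T S u g \<Longrightarrow> Ck_family k {} T S v (\<lambda>t x. f t (g t x))"
proof (induction k arbitrary: f)
  have wb: "weight_bounded {} T S v (\<lambda>t x. f t (g t x))"
    if "weight_bounded {} T U w f" "weight_bounded {} T S u g" for f :: "real \<Rightarrow> 'c \<Rightarrow> 'b"
  proof -
    have "continuous_on (T \<times> S) (\<lambda>p. (fst p, g (fst p) (snd p)))"
      using that(2) by (auto simp: weight_bounded_def split_beta intro!: continuous_intros)
    moreover have "continuous_on (T \<times> U) (\<lambda>p. f (fst p) (snd p))"
      using that(1) by (auto simp: weight_bounded_def split_beta)
    ultimately have "continuous_on (T \<times> S) (\<lambda>p. f (fst p) (g (fst p) (snd p)))"
      using continuous_on_compose2[where f = "\<lambda>p. (fst p, g (fst p) (snd p))" and s="T\<times>S"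
          and g = "\<lambda>p. f (fst p) (snd p)" and t = "T \<times> U"] assms(2) by fastforce
    then show ?thesis by (auto simp: weight_bounded_def split_beta)
  qed
  {
    case 0 then show ?case using wb by auto
  next
    case (Suc k)
    note f = Ck_family_SucD[OF Suc.prems(1)] and g = Ck_family_SucD[OF Suc.prems(2)]
    note rep = linear_Basis_sum[OF has_derivative_linear[OF f(1)]]
    have "Ck_family k {} T S v (\<lambda>t x. \<Sum>b\<in>Basis. (frechet_derivative (g t) (at x) d \<bullet> b) *\<^sub>R
        frechet_derivative (f t) (at (g t x)) b)" for d
    proof (rule Ck_family_sum[OF assms(1)])
      fix b :: 'c
      have "Ck_family k {} T S u (\<lambda>t x. frechet_derivative (g t) (at x) d \<bullet> b)"
        by (rule Ck_family_linear[OF assms(1) bounded_linear_inner_left g(2)])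
      from Ck_family_bilinear[OF assms(1) bounded_bilinear_scaleR this Suc.IH[OF f(2) Ck_family_Suc_imp[OF Suc.prems(2)]], of b]
      show "Ck_family k {} T S v (\<lambda>t x. (frechet_derivative (g t) (at x) d \<bullet> b) *\<^sub>R frechet_derivative (f t) (at (g t x)) b)"
        by (rule Ck_family_ignore)
    qed
    then have "Ck_family k {} T S v (\<lambda>t x. frechet_derivative (f t) (at (g t x)) (frechet_derivative (g t) (at x) d))" for d
      by (subst Ck_family_cong[OF assms(1) rep]) (use assms(2) in auto)
    moreover have "((\<lambda>x. f t (g t x)) has_derivative
        (\<lambda>d. frechet_derivative (f t) (at (g t x)) (frechet_derivative (g t) (at x) d))) (at x)"
      if "t \<in> T" "x \<in> S" for t x
      using diff_chain_at[OF g(1)[OF that] f(1)] assms(2) that by (auto simp: o_def)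
    ultimately show ?case
      using Suc.prems by (intro Ck_family_SucI[OF assms(1) wb]) auto
  }
qed

lemma Ck_family_subset: "Ck_family k \<K> T S w f \<Longrightarrow> T' \<subseteq> T \<Longrightarrow> S' \<subseteq> S \<Longrightarrow> Ck_family k \<K> T' S' w f"
proof (induction k arbitrary: f)
  have wb: "weight_bounded \<K> T S w f \<Longrightarrow> T' \<subseteq> T \<Longrightarrow> S' \<subseteq> S \<Longrightarrow> weight_bounded \<K> T' S' w f" for f :: "real \<Rightarrow> 'a \<Rightarrow> 'b"
    unfolding weight_bounded_def by (meson Sigma_mono continuous_on_subset subset_iff)
  {
    case 0 then show ?case using wb by simp
  next
    case (Suc k) then show ?case using wb by (simp add: subset_iff)
  }
qed

text \<open>The derivative of a linear map is constant in time, hence the lower bound on the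
  weight.\<close>

lemma Ck_family_bounded_linear:
  assumes "open S" "bounded_linear L" "weight_bounded \<K> T S w (\<lambda>t. L)" "\<And>t. t \<in> T \<Longrightarrow> 1 \<le> c * w t"
  shows "Ck_family k \<K> T S w (\<lambda>t. L)"
proof (cases k)
  case (Suc j)
  have "Ck_family j \<K> T S w (\<lambda>t x. L v)" for v
  proof (rule Ck_family_const_time[OF assms(1)])
    fix t assume "t \<in> T"
    show "norm (L v) \<le> (norm (L v) * c) * w t"
      using mult_left_mono[OF assms(4)[OF \<open>t \<in> T\<close>] norm_ge_zero[of "L v"]] by (simp add: algebra_simps)
  qed auto
  then show ?thesis unfolding Suc
    by (intro Ck_family_SucI[OF assms(1,3), where f' = "\<lambda>_ _. L"])
      (auto intro: bounded_linear_imp_has_derivative assms)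
qed (use assms in auto)

lemma Ck_family_Ck_on:
  assumes "Ck_family k \<K> T S w f" "t \<in> T"
  shows "Ck_on k (f t) S"
  using assms(1)
proof (induction k arbitrary: f)
  case 0
  then have "continuous_on (T \<times> S) (\<lambda>p. f (fst p) (snd p))" by (simp add: weight_bounded_def split_beta)
  then have "continuous_on S (\<lambda>x. f (fst (t, x)) (snd (t, x)))"
    by (rule continuous_on_compose2) (use assms(2) in \<open>auto intro!: continuous_intros\<close>)
  then show ?case by simp
next
  case (Suc k)
  then show ?case using assms(2) by auto
qed

lemma Ck_on_Ck_family:
  assumes "Ck_on k f S" "open S"
  shows "Ck_family k {} T S w (\<lambda>t. f)"
proof -
  have c: "continuous_on S f" if "Ck_on k f S" for k and f :: "'a \<Rightarrow> 'b"
    using that by (cases k) (auto intro!: differentiable_imp_continuous_on differentiable_at_imp_differentiable_on)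
  have wb: "weight_bounded {} T S w (\<lambda>t. f)" if "Ck_on k f S" for k and f :: "'a \<Rightarrow> 'b"
    unfolding weight_bounded_def split_beta
    by (auto intro!: continuous_on_compose2[OF c[OF that]] continuous_intros)
  show ?thesis using assms(1)
    by (induction k arbitrary: f) (use wb[of 0] wb[of "Suc k" for k] in auto)
qed

section \<open>Ordinary differential equations\<close>

text \<open>The norm is not differentiable at 0. It is therefore compared with the integral
  \<open>u\<close> of the majorant \<open>g\<close> of the derivative, and the monotonicity argument
  is carried out for \<open>v\<close>, which is built from \<open>u\<close>.\<close>

lemma gronwall_forward:
  fixes e :: "real \<Rightarrow> 'b::euclidean_space"
  assumes "a \<le> b" "L > 0" "\<epsilon> \<ge> 0"
    and der: "\<And>t. t \<in> {a..b} \<Longrightarrow> (e has_vector_derivative e' t) (at t within {a..b})"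
    and bd: "\<And>t. t \<in> {a..b} \<Longrightarrow> norm (e' t) \<le> L * norm (e t) + \<epsilon>"
  shows "norm (e b) \<le> (norm (e a) + \<epsilon> / L) * exp (L * (b - a))"
proof (cases "a = b")
  case True
  then show ?thesis using assms by simp
next
  case False
  then have "a < b" using assms by auto
  have ce: "continuous_on {a..b} e"
    using der by (rule continuous_on_vector_derivative)
  define g where "g t = L * norm (e t) + \<epsilon>" for t
  define u where "u t = integral {a..t} g" for t
  have cg: "continuous_on {a..b} g" unfolding g_def by (intro continuous_intros ce)
  have du: "(u has_vector_derivative g t) (at t within {a..b})" if "t \<in> {a..b}" for t
    unfolding u_def by (rule integral_has_vector_derivative[OF cg that])
  have cu: "continuous_on {a..b} u"
    using du by (rule continuous_on_vector_derivative)
  have u0: "u a = 0" by (simp add: u_def)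
  have nb: "norm (e t - e a) \<le> u t" if t: "t \<in> {a..b}" for t
  proof (cases "t = a")
    case False
    then have "a < t" using t by auto
    have "norm (e t - e a) \<le> u t - u a"
    proof (rule differentiable_bound_general[OF \<open>a < t\<close>, where f' = e' and \<phi>' = g])
      show "continuous_on {a..t} e" "continuous_on {a..t} u" using ce cu continuous_on_subset t by (auto simp: continuous_on_subset)
      fix x assume x: "a < x" "x < t"
      then have i: "x \<in> {a..b}" "x \<in> interior {a..b}" using t by auto
      show "(e has_vector_derivative e' x) (at x)" "(u has_vector_derivative g x) (at x)"
        using der[OF i(1)] du[OF i(1)] at_within_interior[OF i(2)] by auto
      show "norm (e' x) \<le> g x" using bd[OF i(1)] by (simp add: g_def)
    qed
    then show ?thesis by (simp add: u0)
  qed (simp add: u0)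
  define v where "v t = (norm (e a) + \<epsilon> / L + u t) * exp (- L * (t - a))" for t
  have "v b \<le> v a"
  proof (rule DERIV_nonpos_imp_decreasing_open[OF assms(1)])
    show "continuous_on {a..b} v" unfolding v_def by (intro continuous_intros cu)
    fix x assume x: "a < x" "x < b"
    then have i: "x \<in> {a..b}" "x \<in> interior {a..b}" by auto
    have d: "(u has_real_derivative g x) (at x)"
      using du[OF i(1)] at_within_interior[OF i(2)] by (simp add: has_real_derivative_iff_has_vector_derivative)
    have "(v has_real_derivative (L * (norm (e x) - norm (e a) - u x)) * exp (- L * (x - a))) (at x)"
      unfolding v_def
      by (rule derivative_eq_intros d refl | simp)+ (use assms(2) in \<open>simp add: g_def algebra_simps\<close>)
    moreover have "(L * (norm (e x) - norm (e a) - u x)) * exp (- L * (x - a)) \<le> 0"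
    proof -
      have "norm (e x) - norm (e a) - u x \<le> 0" using nb[OF i(1)] norm_triangle_ineq2[of "e x" "e a"] by linarith
      then show ?thesis using assms(2) by (simp add: mult_le_0_iff)
    qed
    ultimately show "\<exists>y. (v has_real_derivative y) (at x) \<and> y \<le> 0" by blast
  qed
  then have "norm (e a) + \<epsilon> / L + u b \<le> (norm (e a) + \<epsilon> / L) * exp (L * (b - a))"
    by (simp add: v_def u0 exp_minus pos_divide_le_eq divide_inverse[symmetric])
  moreover have "norm (e b) \<le> norm (e a) + u b" using nb[of b] assms(1) norm_triangle_ineq2[of "e b" "e a"] by simp
  moreover have "\<epsilon> / L \<ge> 0" using assms by simp
  ultimately show ?thesis by linarith
qed

lemma has_vector_derivative_reflect:
  assumes "(f has_vector_derivative f') (at (-t) within uminus ` S)"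
  shows "((\<lambda>s. f (- s)) has_vector_derivative - f') (at t within S)"
  using vector_diff_chain_within[of uminus "-1" t S f f'] assms
  by (auto simp: o_def has_vector_derivative_def intro!: derivative_eq_intros)

lemma closed_segment_in_interval:
  fixes a b s t \<tau> :: real
  shows "s \<in> closed_segment \<tau> t \<Longrightarrow> \<tau> \<in> {a..b} \<Longrightarrow> t \<in> {a..b} \<Longrightarrow> s \<in> {a..b}"
  by (auto simp: closed_segment_eq_real_ivl split: if_splits)

text \<open>The differential inequality is required only between \<open>\<tau>\<close> and
  \<open>t\<close>, because this is what a bootstrap argument can supply. Times before
  \<open>\<tau>\<close> are treated by reflection.\<close>

lemma gronwall:
  fixes e :: "real \<Rightarrow> 'b::euclidean_space"
  assumes "L > 0" "\<epsilon> \<ge> 0" "\<tau> \<in> {a..b}" "t \<in> {a..b}"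
    and der: "\<And>t. t \<in> {a..b} \<Longrightarrow> (e has_vector_derivative e' t) (at t within {a..b})"
    and bd: "\<And>s. s \<in> closed_segment \<tau> t \<Longrightarrow> norm (e' s) \<le> L * norm (e s) + \<epsilon>"
  shows "norm (e t) \<le> (norm (e \<tau>) + \<epsilon> / L) * exp (L * \<bar>t - \<tau>\<bar>)"
proof (cases "\<tau> \<le> t")
  case True
  have "norm (e t) \<le> (norm (e \<tau>) + \<epsilon> / L) * exp (L * (t - \<tau>))"
    by (rule gronwall_forward[OF True assms(1,2), where e' = e'])
      (use True assms in \<open>auto simp: closed_segment_eq_real_ivl intro: has_vector_derivative_within_subset[OF der]\<close>)
  then show ?thesis using True by simp
next
  case False
  have "norm (e (- (-t))) \<le> (norm (e (- (- \<tau>))) + \<epsilon> / L) * exp (L * (- t - (-\<tau>)))"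
  proof (rule gronwall_forward[where e = "\<lambda>s. e (- s)" and e' = "\<lambda>s. - e' (-s)"])
    fix s assume s: "s \<in> {-\<tau>..-t}"
    show "((\<lambda>s. e (- s)) has_vector_derivative - e' (- s)) (at s within {- \<tau>..- t})"
      by (rule has_vector_derivative_reflect, rule has_vector_derivative_within_subset[OF der])
        (use s assms in auto)
    show "norm (- e' (- s)) \<le> L * norm (e (- s)) + \<epsilon>"
      using bd[of "-s"] s False by (auto simp: closed_segment_eq_real_ivl)
  qed (use False assms in auto)
  then show ?thesis using False by simp
qed

section \<open>Global Picard iteration\<close>

text \<open>Integrating an exponential of rate \<open>c\<close> gains the factor
  \<open>1 / c\<close>. A rate that is large compared with the Lipschitz constant thus turns
  integration into a contraction.\<close>

lemma exp_growth_bound: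
  fixes G :: "real \<Rightarrow> 'b::euclidean_space"
  assumes "c > 0" "A \<ge> 0" and der: "\<And>t. (G has_vector_derivative G' t) (at t)"
    and bd: "\<And>t. norm (G' t) \<le> A * exp (c * \<bar>t\<bar>)"
  shows "norm (G t - G 0) \<le> A / c * exp (c * \<bar>t\<bar>)"
proof -
  have pos: "norm (H t - H 0) \<le> A / c * exp (c * \<bar>t\<bar>)" if "t \<ge> 0"
    "\<And>t. (H has_vector_derivative H' t) (at t)" "\<And>t. norm (H' t) \<le> A * exp (c * \<bar>t\<bar>)" for H H' :: "real \<Rightarrow> 'b" and t
  proof (cases "t = 0")
    case False
    have cont: "continuous_on X H" for X
      by (rule continuous_on_vector_derivative[OF has_vector_derivative_at_within[OF that(2)]])
    have "norm (H t - H 0) \<le> A / c * exp (c * t) - A / c * exp (c * 0)"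
    proof (rule differentiable_bound_general[where a = 0 and b = t and f = H and f' = H'
          and \<phi> = "\<lambda>t. A / c * exp (c * t)" and \<phi>' = "\<lambda>t. A * exp (c * t)"])
      show "0 < t" using that(1) False by simp
      show "continuous_on {0..t} H" by (rule cont)
      show "continuous_on {0..t} (\<lambda>t. A / c * exp (c * t))" by (intro continuous_intros)
      fix x assume x: "0 < x" "x < t"
      show "(H has_vector_derivative H' x) (at x)" by (rule that(2))
      have "((\<lambda>t. A / c * exp (c * t)) has_real_derivative A * exp (c * x)) (at x)"
        using assms(1) by (auto intro!: derivative_eq_intros)
      then show "((\<lambda>t. A / c * exp (c * t)) has_vector_derivative A * exp (c * x)) (at x)"
        by (simp add: has_real_derivative_iff_has_vector_derivative)
      show "norm (H' x) \<le> A * exp (c * x)" using that(3)[of x] x by simp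
    qed
    moreover have "A / c \<ge> 0" using assms by simp
    ultimately show ?thesis using that(1) by simp
  qed (use assms in auto)
  show ?thesis
  proof (cases "t \<ge> 0")
    case True
    show ?thesis using pos[OF True der bd] .
  next
    case False
    have "((\<lambda>s. G (- s)) has_vector_derivative - G' (- t)) (at t)" for t
      by (rule has_vector_derivative_reflect, rule has_vector_derivative_at_within, rule der)
    from pos[of "-t" "\<lambda>s. G (- s)" "\<lambda>s. - G' (- s)", OF _ this] bd[of "-t" for t] False show ?thesis by simp
  qed
qed

text \<open>The weight \<open>exp (- 2 L \<bar>t\<bar>)\<close> makes the Picard operator a contraction on the whole line at once.\<close>

lemma picard_global_0:
  fixes X :: "real \<Rightarrow> 'b::euclidean_space \<Rightarrow> 'b"
  assumes cont: "continuous_on UNIV (\<lambda>(t, z). X t z)" and "L > 0"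
    and lip: "\<And>t z z'. norm (X t z - X t z') \<le> L * norm (z - z')"
    and bd: "\<And>t. norm (X t 0) \<le> M"
  shows "\<exists>\<phi>. \<phi> 0 = z0 \<and> (\<forall>t. (\<phi> has_vector_derivative X t (\<phi> t)) (at t))"
proof -
  define E where "E t = exp (2 * L * \<bar>t\<bar>)" for t :: real
  have E: "E t > 0" "E t \<ge> 1" "E 0 = 1" for t using \<open>L > 0\<close> by (auto simp: E_def)
  have cE: "continuous_on S E" for S unfolding E_def by (intro continuous_intros)
  \<comment> \<open>The solution is sought as \<open>E s\<close> times \<open>u s\<close> with
    \<open>u\<close> bounded and continuous, so that the sup norm of \<open>u\<close> is the
    weighted norm of the solution.\<close>
  define h where "h u s = X s (E s *\<^sub>R apply_bcontfun u s)" for u :: "real \<Rightarrow>\<^sub>C 'b" and s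
  have ch: "continuous_on UNIV (h u)" for u
  proof -
    have "continuous_on UNIV (\<lambda>s. (s, E s *\<^sub>R apply_bcontfun u s))"
      by (intro continuous_intros cE continuous_on_apply_bcontfun)
    from continuous_on_compose2[OF cont this] show ?thesis by (simp add: h_def)
  qed
  have "\<exists>F. F 0 = 0 \<and> (\<forall>x. (F has_vector_derivative h u x) (at x))" for u
  proof -
    have "\<exists>F. \<forall>x. -\<infinity> < ereal x \<longrightarrow> ereal x < \<infinity> \<longrightarrow> (F has_vector_derivative h u x) (at x)"
      by (rule einterval_antiderivative) (use ch[of u] in \<open>auto simp: continuous_on_eq_continuous_at\<close>)
    then obtain F where F: "\<And>x. (F has_vector_derivative h u x) (at x)" by auto
    have "((\<lambda>x. F x - F 0) has_vector_derivative h u x) (at x)" for x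
      using has_vector_derivative_diff[OF F[of x] has_vector_derivative_const] by simp
    then show ?thesis by (intro exI[of _ "\<lambda>x. F x - F 0"]) auto
  qed
  then obtain J where J: "\<And>u. J u 0 = 0" "\<And>u x. (J u has_vector_derivative h u x) (at x)" by metis
  have nu: "norm (apply_bcontfun u s) \<le> B" if "B = dist u 0" for u :: "real \<Rightarrow>\<^sub>C 'b" and s B
    using dist_bounded[of u s 0] that by (simp add: zero_bcontfun.rep_eq)
  have Jbd: "norm (J u t) \<le> (M + L * dist u 0) / (2 * L) * E t" for u t
  proof -
    have "M \<ge> 0" using order_trans[OF norm_ge_zero bd[of 0]] .
    have "norm (J u t - J u 0) \<le> (M + L * dist u 0) / (2 * L) * exp ((2 * L) * \<bar>t\<bar>)"
    proof (rule exp_growth_bound[OF _ _ J(2)])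
      fix s
      have "norm (h u s) \<le> norm (X s 0) + norm (X s (E s *\<^sub>R apply_bcontfun u s) - X s 0)"
        unfolding h_def using norm_triangle_sub by blast
      also have "\<dots> \<le> M + L * (E s * dist u 0)"
        using bd[of s] lip[of s "E s *\<^sub>R apply_bcontfun u s" 0] nu[OF refl, of u s] \<open>L > 0\<close> E(1)[of s]
        by (intro add_mono) (auto intro!: order_trans[OF lip] mult_left_mono)
      also have "\<dots> \<le> M * E s + L * (E s * dist u 0)" using E(2)[of s] \<open>M \<ge> 0\<close>
        using mult_left_mono[of 1 "E s" M] by auto
      finally show "norm (h u s) \<le> (M + L * dist u 0) * exp ((2 * L) * \<bar>s\<bar>)" by (simp add: E_def algebra_simps)
    qed (use \<open>L > 0\<close> \<open>M \<ge> 0\<close> in auto)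
    then show ?thesis by (simp add: J E_def)
  qed
  have cJ: "continuous_on S (J u)" for S u
    by (rule continuous_on_vector_derivative[OF has_vector_derivative_at_within[OF J(2)]])
  define P where "P u = Bcontfun (\<lambda>t. (1 / E t) *\<^sub>R (z0 + J u t))" for u
  have P: "apply_bcontfun (P u) t = (1 / E t) *\<^sub>R (z0 + J u t)" for u t
  proof -
    have "(\<lambda>t. (1 / E t) *\<^sub>R (z0 + J u t)) \<in> bcontfun"
      unfolding bcontfun_def
    proof (safe)
      show "continuous_on UNIV (\<lambda>t. (1 / E t) *\<^sub>R (z0 + J u t))"
        using E(1) by (intro continuous_intros cE cJ) (auto simp: less_imp_neq[symmetric])
      have "norm ((1 / E t) *\<^sub>R (z0 + J u t)) \<le> norm z0 + (M + L * dist u 0) / (2 * L)" for t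
      proof -
        have "norm (z0 + J u t) \<le> norm z0 * E t + (M + L * dist u 0) / (2 * L) * E t"
          using Jbd[of u t] mult_left_mono[OF E(2)[of t] norm_ge_zero[of z0]] by (intro norm_triangle_mono) auto
        then have "norm (z0 + J u t) \<le> (norm z0 + (M + L * dist u 0) / (2 * L)) * E t" by (simp add: distrib_right)
        then have "norm (z0 + J u t) / E t \<le> norm z0 + (M + L * dist u 0) / (2 * L)"
          using E(1)[of t] by (simp only: pos_divide_le_eq)
        then show ?thesis using E(1)[of t] by simp
      qed
      then show "bounded (range (\<lambda>t. (1 / E t) *\<^sub>R (z0 + J u t)))" by (auto simp: bounded_iff)
    qed
    then show ?thesis unfolding P_def by (simp add: Bcontfun_inverse)
  qed
  \<comment> \<open>The factor 1/2 is the Lipschitz constant \<open>L\<close> divided by the rate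
    \<open>2 * L\<close> of the weight.\<close>
  have "dist (P u) (P v) \<le> 1/2 * dist u v" for u v
  proof (rule dist_bound)
    fix t
    have "norm ((J u t - J v t) - (J u 0 - J v 0)) \<le> (L * dist u v) / (2 * L) * exp ((2 * L) * \<bar>t\<bar>)"
    proof (rule exp_growth_bound[OF _ _ has_vector_derivative_diff[OF J(2) J(2)]])
      fix s
      have "norm (h u s - h v s) \<le> L * norm (E s *\<^sub>R (apply_bcontfun u s - apply_bcontfun v s))"
        unfolding h_def using lip by (simp add: scaleR_diff_right)
      also have "\<dots> \<le> L * (E s * dist u v)"
        using dist_bounded[of u s v] E(1)[of s] \<open>L > 0\<close> by (auto simp: dist_norm)
      finally show "norm (h u s - h v s) \<le> L * dist u v * exp (2 * L * \<bar>s\<bar>)" by (simp add: E_def algebra_simps)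
    qed (use \<open>L > 0\<close> in auto)
    then have "norm (J u t - J v t) \<le> 1/2 * dist u v * E t" using \<open>L > 0\<close> by (simp add: J E_def)
    moreover have "dist (P u t) (P v t) = (1 / E t) * norm (J u t - J v t)"
      using E(1)[of t] by (simp add: P dist_norm scaleR_diff_right[symmetric])
    ultimately have "E t * dist (P u t) (P v t) \<le> E t * (1/2 * dist u v)"
      using E(1)[of t] by (simp add: mult.commute)
    then show "dist (P u t) (P v t) \<le> 1/2 * dist u v" using E(1)[of t] by (simp only: mult_le_cancel_left_pos)
  qed
  then have "\<exists>!u. P u = u" by (intro banach_fix_type[of "1/2"]) auto
  then obtain u where u: "P u = u" by auto
  define \<phi> where "\<phi> t = z0 + J u t" for t
  have eq: "E t *\<^sub>R apply_bcontfun u t = \<phi> t" for t using P[of u t] E(1)[of t] by (simp add: u \<phi>_def)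
  have "(\<phi> has_vector_derivative X t (\<phi> t)) (at t)" for t
    using has_vector_derivative_add[OF has_vector_derivative_const J(2)[of u t], of z0] eq[of t] by (simp add: h_def \<phi>_def[abs_def])
  moreover have "\<phi> 0 = z0" by (simp add: \<phi>_def J)
  ultimately show ?thesis by blast
qed

lemma has_vector_derivative_shift:
  assumes "(f has_vector_derivative f') (at (t - \<tau>))"
  shows "((\<lambda>s. f (s - \<tau>)) has_vector_derivative f') (at t)"
proof -
  have "((\<lambda>s. s - \<tau>) has_vector_derivative 1) (at t)" by (auto intro!: derivative_eq_intros)
  from vector_diff_chain_at[OF this] assms show ?thesis by (simp add: o_def)
qed

lemma picard_global:
  fixes X :: "real \<Rightarrow> 'b::euclidean_space \<Rightarrow> 'b"
  assumes cont: "continuous_on UNIV (\<lambda>(t, z). X t z)" and "L > 0"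
    and lip: "\<And>t z z'. norm (X t z - X t z') \<le> L * norm (z - z')"
    and bd: "\<And>t. norm (X t 0) \<le> M"
  shows "\<exists>\<phi>. \<phi> \<tau> = z0 \<and> (\<forall>t. (\<phi> has_vector_derivative X t (\<phi> t)) (at t))"
proof -
  have "continuous_on UNIV (\<lambda>(t, z). X (t + \<tau>) z)"
    using continuous_on_compose2[OF cont, of UNIV "\<lambda>(t, z). (t + \<tau>, z)"]
    by (simp add: split_beta continuous_intros)
  from picard_global_0[OF this assms(2) lip bd, of z0] obtain \<phi> where
    \<phi>: "\<phi> 0 = z0" "\<And>t. (\<phi> has_vector_derivative X (t + \<tau>) (\<phi> t)) (at t)" by blast
  have "((\<lambda>s. \<phi> (s - \<tau>)) has_vector_derivative X t (\<phi> (t - \<tau>))) (at t)" for t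
    using has_vector_derivative_shift[OF \<phi>(2)[of "t - \<tau>"]] by simp
  then show ?thesis using \<phi>(1) by (intro exI[of _ "\<lambda>s. \<phi> (s - \<tau>)"]) auto
qed

lemma picard_interval:
  fixes X :: "real \<Rightarrow> 'b::euclidean_space \<Rightarrow> 'b"
  assumes "a \<le> b" and cont: "continuous_on ({a..b} \<times> UNIV) (\<lambda>(t, z). X t z)" and "L > 0"
    and lip: "\<And>t z z'. t \<in> {a..b} \<Longrightarrow> norm (X t z - X t z') \<le> L * norm (z - z')"
  shows "\<exists>\<phi>. \<phi> \<tau> = z0 \<and> (\<forall>t\<in>{a..b}. (\<phi> has_vector_derivative X t (\<phi> t)) (at t))"
proof -
  \<comment> \<open>Freezing the field outside the interval makes it global with the same Lipschitz
    constant. The solution then has two-sided derivatives at the end points too.\<close>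
  define c where "c t = max a (min b t)" for t
  have c: "c t \<in> {a..b}" "t \<in> {a..b} \<Longrightarrow> c t = t" for t using assms(1) by (auto simp: c_def)
  have cX: "continuous_on UNIV (\<lambda>(t, z). X (c t) z)"
  proof -
    have "continuous_on UNIV (\<lambda>p :: real \<times> 'b. (c (fst p), snd p))"
      unfolding c_def by (intro continuous_intros)
    from continuous_on_compose2[OF cont this] c(1) show ?thesis by (fastforce simp: split_beta)
  qed
  have "continuous_on {a..b} (\<lambda>t. X t 0)"
  proof -
    have "continuous_on {a..b} (\<lambda>t. (t, 0::'b))" by (intro continuous_intros)
    from continuous_on_compose2[OF cont this] show ?thesis by auto
  qed
  then have "bounded ((\<lambda>t. X t 0) ` {a..b})" by (intro compact_imp_bounded compact_continuous_image) auto
  then obtain M where "\<forall>x\<in>{a..b}. norm (X x 0) \<le> M" by (auto simp: bounded_iff)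
  then have "norm (X (c t) 0) \<le> M" for t using c(1) by auto
  from picard_global[OF cX assms(3) lip[OF c(1)] this, of \<tau> z0] obtain \<phi> where
    "\<phi> \<tau> = z0" "\<And>t. (\<phi> has_vector_derivative X (c t) (\<phi> t)) (at t)" by blast
  then have "\<phi> \<tau> = z0 \<and> (\<forall>t\<in>{a..b}. (\<phi> has_vector_derivative X t (\<phi> t)) (at t))"
    using c(2) by metis
  then show ?thesis by blast
qed

section \<open>Compact tubes around a curve\<close>

text \<open>The tube is the image of the compact product of the time interval and a ball under
  \<open>(t, v) \<mapsto> (t, \<psi> t + v)\<close>.\<close>

lemma tube_compact:
  fixes \<psi> :: "real \<Rightarrow> 'a::euclidean_space"
  assumes "open S" "continuous_on {a..b} \<psi>" "\<And>t. t \<in> {a..b} \<Longrightarrow> \<psi> t \<in> S"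
  shows "\<exists>r>0. (\<forall>t\<in>{a..b}. cball (\<psi> t) r \<subseteq> S) \<and> compact {(t, x). t \<in> {a..b} \<and> x \<in> cball (\<psi> t) r}"
proof -
  have "compact (\<psi> ` {a..b})" using assms(2) by (intro compact_continuous_image) auto
  then obtain r where r: "r > 0" "(\<Union>x\<in>\<psi> ` {a..b}. cball x r) \<subseteq> S"
    using compact_subset_open_imp_cball_epsilon_subset[of "\<psi> ` {a..b}" S] assms by blast
  have "continuous_on ({a..b} \<times> cball 0 r) (\<lambda>p. (fst p, \<psi> (fst p) + snd p))"
    by (intro continuous_intros continuous_on_compose2[OF assms(2)]) auto
  then have "compact ((\<lambda>p. (fst p, \<psi> (fst p) + snd p)) ` ({a..b} \<times> cball 0 r))"
    by (intro compact_continuous_image compact_Times) auto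
  also have "(\<lambda>p. (fst p, \<psi> (fst p) + snd p)) ` ({a..b} \<times> cball 0 r) = {(t, x). t \<in> {a..b} \<and> x \<in> cball (\<psi> t) r}"
  proof (safe; clarsimp)
    fix t x assume "a \<le> t" "t \<le> b" "dist (\<psi> t) x \<le> r"
    then show "(t, x) \<in> (\<lambda>p. (fst p, \<psi> (fst p) + snd p)) ` ({a..b} \<times> cball 0 r)"
      by (intro image_eqI[of _ _ "(t, x - \<psi> t)"]) (auto simp: dist_norm norm_minus_commute)
  qed (auto simp: dist_norm)
  finally show ?thesis using r by (intro exI[of _ r]) auto
qed

lemma tube_uniform_continuity:
  fixes \<psi> :: "real \<Rightarrow> 'a::euclidean_space" and h :: "real \<Rightarrow> 'a \<Rightarrow> 'b::real_normed_vector"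
  assumes "open S" "continuous_on {a..b} \<psi>" "\<And>t. t \<in> {a..b} \<Longrightarrow> \<psi> t \<in> S"
    and cont: "continuous_on ({a..b} \<times> S) (\<lambda>(t, x). h t x)" and "\<epsilon> > 0"
  shows "\<exists>\<delta>>0. \<forall>t\<in>{a..b}. cball (\<psi> t) \<delta> \<subseteq> S \<and> (\<forall>x\<in>cball (\<psi> t) \<delta>. norm (h t x - h t (\<psi> t)) \<le> \<epsilon>)"
proof -
  obtain r where r: "r > 0" "\<And>t. t\<in>{a..b} \<Longrightarrow> cball (\<psi> t) r \<subseteq> S"
      "compact {(t, x). t \<in> {a..b} \<and> x \<in> cball (\<psi> t) r}" (is "compact ?N")
    using tube_compact[OF assms(1-3)] by blast
  have "continuous_on ?N (\<lambda>(t, x). h t x)"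
    by (rule continuous_on_subset[OF cont]) (use r(2) in force)
  then have "uniformly_continuous_on ?N (\<lambda>(t, x). h t x)" using r(3) compact_uniformly_continuous by blast
  from this[unfolded uniformly_continuous_on_def, rule_format, OF \<open>\<epsilon> > 0\<close>]
  obtain d where d: "d > 0" "\<forall>p\<in>?N. \<forall>q\<in>?N. dist q p < d \<longrightarrow>
      dist ((\<lambda>(t, x). h t x) q) ((\<lambda>(t, x). h t x) p) < \<epsilon>" by blast
  show ?thesis
  proof (intro exI[of _ "min r (d/2)"] conjI ballI)
    fix t assume t: "t \<in> {a..b}"
    show "cball (\<psi> t) (min r (d/2)) \<subseteq> S" using r(2)[OF t] by auto
    fix x assume x: "x \<in> cball (\<psi> t) (min r (d/2))"
    have "dist (t, x) (t, \<psi> t) < d" using x d(1) by (auto simp: dist_Pair_Pair dist_commute)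
    with d(2)[rule_format, of "(t, \<psi> t)" "(t, x)"] t x r(1) show "norm (h t x - h t (\<psi> t)) \<le> \<epsilon>" by (auto simp: dist_norm)
  qed (use r d in auto)
qed

text \<open>Bounds on derivatives are available one direction at a time. In finite dimension the
  finitely many basis directions control the operator.\<close>

lemma norm_linear_le_Basis:
  fixes A :: "'c::euclidean_space \<Rightarrow> 'b::real_normed_vector"
  assumes "linear A" "\<And>b. b \<in> Basis \<Longrightarrow> norm (A b) \<le> B b"
  shows "norm (A u) \<le> (\<Sum>b\<in>Basis. B b) * norm u"
proof -
  have "norm (A u) \<le> (\<Sum>b\<in>Basis. norm ((u \<bullet> b) *\<^sub>R A b))"
    unfolding linear_Basis_sum[OF assms(1), of u] by (rule norm_sum)
  also have "\<dots> \<le> (\<Sum>b\<in>Basis. norm u * B b)"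
    by (intro sum_mono) (auto intro!: mult_mono assms(2) Basis_le_norm)
  finally show ?thesis by (simp add: sum_distrib_right mult.commute[of "norm u"])
qed

text \<open>Compactness of the tube bounds the derivatives by one constant. The mean value
  inequality is applied within each ball, since \<open>U\<close> need not be convex.\<close>

lemma tube_Lipschitz:
  fixes \<psi> :: "real \<Rightarrow> 'b::euclidean_space" and Y :: "real \<Rightarrow> 'b \<Rightarrow> 'c::real_normed_vector"
  assumes "open U" and Y: "Ck_family (Suc 0) {} {a..b} U w Y"
    and "continuous_on {a..b} \<psi>" "\<And>t. t \<in> {a..b} \<Longrightarrow> \<psi> t \<in> U"
  shows "\<exists>r>0. \<exists>L>0. \<forall>t\<in>{a..b}. cball (\<psi> t) r \<subseteq> U \<and>
     (\<forall>z\<in>cball (\<psi> t) r. \<forall>z'\<in>cball (\<psi> t) r. norm (Y t z - Y t z') \<le> L * norm (z - z')) \<and>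
     (\<forall>z\<in>cball (\<psi> t) r. \<forall>u. norm (frechet_derivative (Y t) (at z) u) \<le> L * norm u)"
proof -
  obtain r where r: "r > 0" "\<And>t. t\<in>{a..b} \<Longrightarrow> cball (\<psi> t) r \<subseteq> U"
      "compact {(t, x). t \<in> {a..b} \<and> x \<in> cball (\<psi> t) r}" (is "compact ?N")
    using tube_compact[OF assms(1,3,4)] by blast
  have "\<exists>B. \<forall>(t, z)\<in>?N. norm (frechet_derivative (Y t) (at z) e) \<le> B" for e
  proof -
    have "continuous_on ?N (\<lambda>(t, z). frechet_derivative (Y t) (at z) e)"
      by (rule continuous_on_subset[OF Ck_family_cont[OF Ck_family_SucD(2)[OF Y]]]) (use r(2) in force)
    then have "bounded ((\<lambda>(t, z). frechet_derivative (Y t) (at z) e) ` ?N)"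
      using r(3) by (intro compact_imp_bounded compact_continuous_image)
    then show ?thesis by (auto simp: bounded_iff)
  qed
  then obtain B where B: "\<And>e t z. t \<in> {a..b} \<Longrightarrow> z \<in> cball (\<psi> t) r \<Longrightarrow> norm (frechet_derivative (Y t) (at z) e) \<le> B e"
    by (auto simp: Ball_def) metis
  define L where "L = \<bar>\<Sum>b\<in>Basis. B b\<bar> + 1"
  have d: "(Y t has_derivative frechet_derivative (Y t) (at z)) (at z)" if "t \<in> {a..b}" "z \<in> cball (\<psi> t) r" for t z
    using Ck_family_SucD(1)[OF Y] that r(2) by blast
  have dL: "norm (frechet_derivative (Y t) (at z) u) \<le> L * norm u" if "t \<in> {a..b}" "z \<in> cball (\<psi> t) r" for t z u
  proof -
    have "norm (frechet_derivative (Y t) (at z) u) \<le> (\<Sum>b\<in>Basis. B b) * norm u"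
      by (rule norm_linear_le_Basis) (use B that has_derivative_linear[OF d[OF that]] in auto)
    also have "\<dots> \<le> L * norm u" by (rule mult_right_mono) (auto simp: L_def)
    finally show ?thesis .
  qed
  have "norm (Y t z - Y t z') \<le> L * norm (z - z')" if "t \<in> {a..b}" "z \<in> cball (\<psi> t) r" "z' \<in> cball (\<psi> t) r" for t z z'
  proof (rule differentiable_bound[where S = "cball (\<psi> t) r" and f = "Y t" and f' = "\<lambda>z. frechet_derivative (Y t) (at z)"])
    fix x assume x: "x \<in> cball (\<psi> t) r"
    show "(Y t has_derivative frechet_derivative (Y t) (at x)) (at x within cball (\<psi> t) r)"
      by (rule has_derivative_at_withinI[OF d[OF that(1) x]])
    show "onorm (frechet_derivative (Y t) (at x)) \<le> L" by (rule onorm_le) (rule dL[OF that(1) x])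
  qed (use that in auto)
  then have "(\<forall>t\<in>{a..b}. cball (\<psi> t) r \<subseteq> U \<and>
     (\<forall>z\<in>cball (\<psi> t) r. \<forall>z'\<in>cball (\<psi> t) r. norm (Y t z - Y t z') \<le> L * norm (z - z')) \<and>
     (\<forall>z\<in>cball (\<psi> t) r. \<forall>u. norm (frechet_derivative (Y t) (at z) u) \<le> L * norm u))"
    using r(2) dL by blast
  moreover have "L > 0" by (simp add: L_def add.commute add_pos_nonneg)
  ultimately show ?thesis using r(1) by blast
qed

section \<open>Dependence on initial values and uniqueness\<close>

text \<open>Continuous induction: at the first point of the segment where \<open>r\<close> is
  reached, \<open>d \<le> r\<close> holds on everything passed so far, and \<open>step\<close>
  contradicts equality.\<close>

lemma bootstrap:
  fixes d :: "real \<Rightarrow> real"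
  assumes "continuous_on {a..b} d" "\<tau> \<in> {a..b}" "d \<tau> < r"
    and step: "\<And>t. t \<in> {a..b} \<Longrightarrow> (\<And>s. s \<in> closed_segment \<tau> t \<Longrightarrow> d s \<le> r) \<Longrightarrow> d t < r"
    and t: "t \<in> {a..b}"
  shows "d t < r"
proof (rule ccontr)
  assume "\<not> d t < r"
  \<comment> \<open>Parametrising the segment from \<open>\<tau>\<close> to \<open>t\<close> treats
    both directions of time at once.\<close>
  define c where "c \<theta> = \<tau> + \<theta> * (t - \<tau>)" for \<theta>
  have cin: "c \<theta> \<in> {a..b}" if "\<theta> \<in> {0..1}" for \<theta>
  proof -
    have "c \<theta> \<in> closed_segment \<tau> t" unfolding closed_segment_def c_def using that
      by (auto intro!: exI[of _ \<theta>] simp: algebra_simps)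
    then show ?thesis using assms(2) t by (auto simp: closed_segment_eq_real_ivl split: if_splits)
  qed
  have cd: "continuous_on {0..1} (\<lambda>\<theta>. d (c \<theta>))"
    by (rule continuous_on_compose2[OF assms(1)]) (use cin in \<open>auto simp: c_def intro!: continuous_intros\<close>)
  define Z where "Z = {\<theta> \<in> {0..1}. d (c \<theta>) \<ge> r}"
  have "Z = {0..1} \<inter> (\<lambda>\<theta>. d (c \<theta>)) -` {r..}" by (auto simp: Z_def)
  then have "closed Z" using continuous_closed_preimage[OF cd closed_atLeastAtMost closed_atLeast[of r]] by simp
  moreover have "bounded Z" by (rule bounded_subset[of "{0..1}"]) (auto simp: Z_def)
  ultimately have "compact Z" by (simp add: compact_eq_bounded_closed)
  moreover have "1 \<in> Z" using \<open>\<not> d t < r\<close> by (auto simp: Z_def c_def)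
  ultimately obtain m where m: "m \<in> Z" "\<And>\<theta>. \<theta> \<in> Z \<Longrightarrow> m \<le> \<theta>" using compact_attains_inf[of Z] by blast
  have m1: "m \<in> {0..1}" "d (c m) \<ge> r" using m(1) by (auto simp: Z_def)
  have "m \<noteq> 0" using m1 assms(3) by (auto simp: c_def)
  then have "m > 0" using m1 by auto
  have lt: "d (c \<theta>) < r" if "0 \<le> \<theta>" "\<theta> < m" for \<theta>
    using m(2)[of \<theta>] that m1 by (auto simp: Z_def not_le[symmetric])
  have "d (c m) \<le> r"
  proof (rule tendsto_upperbound)
    have "((\<lambda>\<theta>. d (c \<theta>)) \<longlongrightarrow> d (c m)) (at m within {0..1})" using cd m1(1) by (auto simp: continuous_on)
    then show "((\<lambda>\<theta>. d (c \<theta>)) \<longlongrightarrow> d (c m)) (at m within {0..<m})"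
      by (rule tendsto_within_subset) (use m1 in auto)
    show "\<forall>\<^sub>F \<theta> in at m within {0..<m}. d (c \<theta>) \<le> r"
      unfolding eventually_at_filter by (auto intro!: always_eventually less_imp_le lt)
    show "at m within {0..<m} \<noteq> bot" using \<open>m > 0\<close> by (simp add: at_within_eq_bot_iff)
  qed
  have "d (c m) < r"
  proof (rule step)
    show "c m \<in> {a..b}" using cin m1 by auto
    fix s assume "s \<in> closed_segment \<tau> (c m)"
    then obtain u where u: "0 \<le> u" "u \<le> 1" "s = (1 - u) * \<tau> + u * c m" by (auto simp: closed_segment_def)
    then have "s = c (u * m)" by (simp add: c_def algebra_simps)
    moreover have "u * m \<le> m" "0 \<le> u * m" using u m1 by (auto intro: mult_left_le_one_le)
    ultimately show "d s \<le> r" using lt[of "u * m"] \<open>d (c m) \<le> r\<close> by (metis less_le)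
  qed
  then show False using m1 by simp
qed

text \<open>The competing solution \<open>\<rho>\<close> is not assumed to stay in \<open>U\<close>.
  Starting close to \<open>\<psi>\<close>, it is kept inside the tube, where \<open>Y\<close> is
  Lipschitz, by Gronwall and the bootstrap together.\<close>

lemma solution_dependence:
  fixes \<psi> :: "real \<Rightarrow> 'b::euclidean_space"
  assumes "open U" and Y: "Ck_family (Suc 0) {} {a..b} U w Y" and \<tau>: "\<tau> \<in> {a..b}"
    and \<psi>: "\<And>t. t \<in> {a..b} \<Longrightarrow> (\<psi> has_vector_derivative Y t (\<psi> t)) (at t within {a..b})"
    "\<And>t. t \<in> {a..b} \<Longrightarrow> \<psi> t \<in> U"
  shows "\<exists>r>0. \<exists>K>0. \<forall>\<rho>. (\<forall>t\<in>{a..b}. (\<rho> has_vector_derivative Y t (\<rho> t)) (at t within {a..b})) \<longrightarrow>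
     norm (\<rho> \<tau> - \<psi> \<tau>) < r \<longrightarrow> (\<forall>t\<in>{a..b}. norm (\<rho> t - \<psi> t) \<le> K * norm (\<rho> \<tau> - \<psi> \<tau>))"
proof -
  have c\<psi>: "continuous_on {a..b} \<psi>"
    using \<psi>(1) by (rule continuous_on_vector_derivative)
  obtain r L where rL: "r > 0" "L > 0" and lip: "\<And>t z z'. t\<in>{a..b} \<Longrightarrow> z\<in>cball (\<psi> t) r \<Longrightarrow> z'\<in>cball (\<psi> t) r \<Longrightarrow>
     norm (Y t z - Y t z') \<le> L * norm (z - z')"
    using tube_Lipschitz[OF assms(1) Y c\<psi> \<psi>(2)] by metis
  define K where "K = exp (L * (b - a))"
  have K: "K \<ge> 1" using \<tau> rL by (auto simp: K_def)
  have main: "\<forall>t\<in>{a..b}. norm (\<rho> t - \<psi> t) \<le> K * norm (\<rho> \<tau> - \<psi> \<tau>)"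
    if \<rho>: "\<forall>t\<in>{a..b}. (\<rho> has_vector_derivative Y t (\<rho> t)) (at t within {a..b})"
      and small: "norm (\<rho> \<tau> - \<psi> \<tau>) < r / (2 * K)" for \<rho>
  proof
    have c\<rho>: "continuous_on {a..b} \<rho>"
      using \<rho> by (intro continuous_on_vector_derivative) auto
    have G: "norm (\<rho> t - \<psi> t) \<le> K * norm (\<rho> \<tau> - \<psi> \<tau>)" if t: "t \<in> {a..b}"
        and le: "\<And>s. s \<in> closed_segment \<tau> t \<Longrightarrow> norm (\<rho> s - \<psi> s) \<le> r" for t
    proof -
      have "norm (\<rho> t - \<psi> t) \<le> (norm (\<rho> \<tau> - \<psi> \<tau>) + 0 / L) * exp (L * \<bar>t - \<tau>\<bar>)"
      proof (rule gronwall[OF rL(2) order_refl \<tau> t has_vector_derivative_diff[OF \<rho>[rule_format] \<psi>(1)]])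
        fix s assume s: "s \<in> closed_segment \<tau> t"
        then have "s \<in> {a..b}" using closed_segment_in_interval \<tau> t by blast
        then show "norm (Y s (\<rho> s) - Y s (\<psi> s)) \<le> L * norm (\<rho> s - \<psi> s) + 0"
          using lip[of s "\<rho> s" "\<psi> s"] le[OF s] rL by (auto simp: dist_norm norm_minus_commute)
      qed
      also have "\<dots> \<le> norm (\<rho> \<tau> - \<psi> \<tau>) * K"
        unfolding K_def using t \<tau> rL by (auto intro!: mult_left_mono)
      finally show ?thesis by (simp add: mult.commute)
    qed
    have lt: "K * norm (\<rho> \<tau> - \<psi> \<tau>) < r"
    proof -
      have "norm (\<rho> \<tau> - \<psi> \<tau>) * (2 * K) < r" using small K by (simp add: pos_less_divide_eq)
      moreover have "norm (\<rho> \<tau> - \<psi> \<tau>) * (2 * K) \<ge> K * norm (\<rho> \<tau> - \<psi> \<tau>)" using K by simp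
      ultimately show ?thesis by linarith
    qed
    have all: "norm (\<rho> t - \<psi> t) < r" if t: "t \<in> {a..b}" for t
    proof (rule bootstrap[OF _ \<tau> _ _ t])
      show "continuous_on {a..b} (\<lambda>t. norm (\<rho> t - \<psi> t))" by (intro continuous_intros c\<rho> c\<psi>)
      show "norm (\<rho> \<tau> - \<psi> \<tau>) < r" using lt K mult_right_mono[OF K norm_ge_zero[of "\<rho> \<tau> - \<psi> \<tau>"]] by linarith
    qed (use G lt in \<open>meson le_less_trans\<close>)
    fix t assume t: "t \<in> {a..b}"
    show "norm (\<rho> t - \<psi> t) \<le> K * norm (\<rho> \<tau> - \<psi> \<tau>)"
    proof (rule G[OF t])
      fix s assume s: "s \<in> closed_segment \<tau> t"
      then have "s \<in> {a..b}" using closed_segment_in_interval \<tau> t by blast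
      then show "norm (\<rho> s - \<psi> s) \<le> r" using all less_imp_le by blast
    qed
  qed
  have "r / (2 * K) > 0" "K > 0" using rL K by auto
  with main show ?thesis by meson
qed

lemma solution_unique:
  fixes \<psi> \<rho> :: "real \<Rightarrow> 'b::euclidean_space"
  assumes "open U" and Y: "Ck_family (Suc 0) {} {a..b} U w Y" and \<tau>: "\<tau> \<in> {a..b}"
    and \<psi>: "\<And>t. t \<in> {a..b} \<Longrightarrow> (\<psi> has_vector_derivative Y t (\<psi> t)) (at t within {a..b})"
    "\<And>t. t \<in> {a..b} \<Longrightarrow> \<psi> t \<in> U"
    and \<rho>: "\<And>t. t \<in> {a..b} \<Longrightarrow> (\<rho> has_vector_derivative Y t (\<rho> t)) (at t within {a..b})"
    and eq: "\<rho> \<tau> = \<psi> \<tau>" and t: "t \<in> {a..b}"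
  shows "\<rho> t = \<psi> t"
proof -
  obtain r K where "r > 0" and *: "\<And>\<rho>. (\<forall>t\<in>{a..b}. (\<rho> has_vector_derivative Y t (\<rho> t)) (at t within {a..b})) \<Longrightarrow>
     norm (\<rho> \<tau> - \<psi> \<tau>) < r \<Longrightarrow> (\<forall>t\<in>{a..b}. norm (\<rho> t - \<psi> t) \<le> K * norm (\<rho> \<tau> - \<psi> \<tau>))"
    using solution_dependence[OF assms(1) Y \<tau> \<psi>] by metis
  from *[of \<rho>] \<rho> eq t \<open>r > 0\<close> show ?thesis by simp
qed

lemma joint_continuity:
  fixes w :: "real \<Rightarrow> 'a::euclidean_space \<Rightarrow> 'b::real_normed_vector"
  assumes "\<And>p. p \<in> S \<Longrightarrow> continuous_on T (\<lambda>t. w t p)"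
    and "\<And>p \<epsilon>. p \<in> S \<Longrightarrow> \<epsilon> > 0 \<Longrightarrow> \<exists>\<delta>>0. \<forall>t\<in>T. \<forall>q\<in>S. norm (q - p) < \<delta> \<longrightarrow> norm (w t q - w t p) \<le> \<epsilon>"
  shows "continuous_on (T \<times> S) (\<lambda>(t, p). w t p)"
  unfolding continuous_on_iff
proof (safe)
  fix t p and e :: real assume tp: "t \<in> T" "p \<in> S" and e: "e > 0"
  obtain \<delta> where \<delta>: "\<delta> > 0" "\<And>s q. s \<in> T \<Longrightarrow> q \<in> S \<Longrightarrow> norm (q - p) < \<delta> \<Longrightarrow> norm (w s q - w s p) \<le> e/3"
    using assms(2)[OF tp(2), of "e/3"] e by auto
  obtain \<eta> where \<eta>: "\<eta> > 0" "\<And>s. s \<in> T \<Longrightarrow> dist s t < \<eta> \<Longrightarrow> dist (w s p) (w t p) < e/3"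
    using assms(1)[OF tp(2), unfolded continuous_on_iff, rule_format, OF tp(1), of "e/3"] e by auto
  have "\<forall>x'\<in>T \<times> S. dist x' (t, p) < min \<delta> \<eta> \<longrightarrow> dist (case x' of (t, p) \<Rightarrow> w t p) (w t p) < e"
  proof (safe)
    fix s q assume sq: "s \<in> T" "q \<in> S" "dist (s, q) (t, p) < min \<delta> \<eta>"
    have "dist s t < \<eta>" "dist q p < \<delta>"
      using sq(3) dist_fst_le[of "(s, q)" "(t, p)"] dist_snd_le[of "(s, q)" "(t, p)"] by auto
    then have "norm (w s q - w s p) \<le> e/3" "dist (w s p) (w t p) < e/3"
      using \<delta>(2)[OF sq(1,2)] \<eta>(2)[OF sq(1)] by (auto simp: dist_norm)
    then have "dist (w s q) (w s p) + dist (w s p) (w t p) < e" using e by (simp add: dist_norm)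
    then show "dist (w s q) (w t p) < e" using dist_triangle[of "w s q" "w t p" "w s p"] by linarith
  qed
  then show "\<exists>d>0. \<forall>x'\<in>T \<times> S. dist x' (t, p) < d \<longrightarrow> dist (case x' of (t, p) \<Rightarrow> w t p) (w t p) < e"
    using \<delta>(1) \<eta>(1) by (intro exI[of _ "min \<delta> \<eta>"]) auto
qed

section \<open>First derivative with respect to parameters\<close>

text \<open>Uniformity in \<open>t\<close> comes from uniform continuity of the directional
  derivatives near the curve. An error \<open>\<epsilon> / N\<close> in each of the \<open>N\<close>
  basis directions adds up to \<open>\<epsilon>\<close>.\<close>

lemma tube_linearization:
  fixes \<psi> :: "real \<Rightarrow> 'b::euclidean_space" and Y :: "real \<Rightarrow> 'b \<Rightarrow> 'c::real_normed_vector"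
  assumes "open U" and Y: "Ck_family (Suc 0) {} {a..b} U w Y"
    and c\<psi>: "continuous_on {a..b} \<psi>" "\<And>t. t \<in> {a..b} \<Longrightarrow> \<psi> t \<in> U" and "\<epsilon> > 0"
  shows "\<exists>\<delta>>0. \<forall>t\<in>{a..b}. \<forall>z\<in>cball (\<psi> t) \<delta>.
     norm (Y t z - Y t (\<psi> t) - frechet_derivative (Y t) (at (\<psi> t)) (z - \<psi> t)) \<le> \<epsilon> * norm (z - \<psi> t)"
proof -
  define D where "D t z = frechet_derivative (Y t) (at z)" for t z
  define N where "N = real (card (Basis :: 'b set))"
  have N: "N \<ge> 1" unfolding N_def by (simp add: Suc_leI)
  have "\<exists>\<delta>>0. \<forall>t\<in>{a..b}. cball (\<psi> t) \<delta> \<subseteq> U \<and> (\<forall>x\<in>cball (\<psi> t) \<delta>. norm (D t x e - D t (\<psi> t) e) \<le> \<epsilon> / N)" for e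
    unfolding D_def using N \<open>\<epsilon> > 0\<close>
    by (intro tube_uniform_continuity[OF assms(1) c\<psi> Ck_family_cont[OF Ck_family_SucD(2)[OF Y]]]) auto
  then obtain \<delta> where \<delta>: "\<And>e. \<delta> e > 0" "\<And>e t. t \<in> {a..b} \<Longrightarrow> cball (\<psi> t) (\<delta> e) \<subseteq> U"
    "\<And>e t x. t\<in>{a..b} \<Longrightarrow> x\<in>cball (\<psi> t) (\<delta> e) \<Longrightarrow> norm (D t x e - D t (\<psi> t) e) \<le> \<epsilon> / N"
    by metis
  define d where "d = Min (\<delta> ` Basis)"
  have d: "d > 0" "\<And>e. e \<in> Basis \<Longrightarrow> d \<le> \<delta> e" unfolding d_def using \<delta>(1) by auto
  obtain e0 :: 'b where e0: "e0 \<in> Basis" using nonempty_Basis by blast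
  have "norm (Y t z - Y t (\<psi> t) - D t (\<psi> t) (z - \<psi> t)) \<le> \<epsilon> * norm (z - \<psi> t)"
    if t: "t \<in> {a..b}" and z: "z \<in> cball (\<psi> t) d" for t z
  proof -
    have cU: "cball (\<psi> t) d \<subseteq> U" using \<delta>(2)[OF t, of e0] d(2)[OF e0] by auto
    have der: "(Y t has_derivative D t x) (at x)" if "x \<in> cball (\<psi> t) d" for x
      unfolding D_def using Ck_family_SucD(1)[OF Y t] that cU by auto
    have "norm (Y t z - Y t (\<psi> t) - D t (\<psi> t) (z - \<psi> t)) \<le> norm (z - \<psi> t) * \<epsilon>"
    proof (rule differentiable_bound_linearization[where S = "cball (\<psi> t) d" and f' = "D t"])
      show "\<psi> t + s *\<^sub>R (z - \<psi> t) \<in> cball (\<psi> t) d" if "s \<in> {0..1}" for s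
      proof -
        have "\<bar>s\<bar> * norm (z - \<psi> t) \<le> 1 * norm (z - \<psi> t)" using that by (intro mult_right_mono) auto
        then show ?thesis using z by (simp add: dist_norm norm_minus_commute)
      qed
      show "(Y t has_derivative D t x) (at x within cball (\<psi> t) d)" if "x \<in> cball (\<psi> t) d" for x
        by (rule has_derivative_at_withinI[OF der[OF that]])
      show "onorm (D t x - D t (\<psi> t)) \<le> \<epsilon>" if x: "x \<in> cball (\<psi> t) d" for x
      proof (rule onorm_le)
        fix u
        have "linear (\<lambda>u. D t x u - D t (\<psi> t) u)"
          using has_derivative_linear[OF der[OF x]] has_derivative_linear[OF der, of "\<psi> t"] d(1)
          by (intro linear_compose_sub) auto
        moreover have "norm (D t x e - D t (\<psi> t) e) \<le> \<epsilon> / N" if "e \<in> Basis" for e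
          using \<delta>(3)[OF t, of x e] x d(2)[OF that] by auto
        ultimately have "norm (D t x u - D t (\<psi> t) u) \<le> (\<Sum>e\<in>(Basis :: 'b set). \<epsilon> / N) * norm u"
          by (rule norm_linear_le_Basis)
        then show "norm ((D t x - D t (\<psi> t)) u) \<le> \<epsilon> * norm u" using N by (simp add: N_def)
      qed
    qed (use d in auto)
    then show ?thesis by (simp add: mult.commute)
  qed
  then show ?thesis using d(1) unfolding D_def by blast
qed

text \<open>The candidate \<open>D\<close> solves the variational equation; the remainder solves the
  same linear equation up to a term of higher order, and Gronwall applies. Initial values may be any
  differentiable function of a parameter of another type, so that the lemma also covers systems
  augmented by their parameter.\<close>

lemma solution_family_C1:
  fixes \<phi> :: "real \<Rightarrow> 'a::euclidean_space \<Rightarrow> 'b::euclidean_space"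
  assumes "open U" "open S" and \<tau>: "\<tau> \<in> {a..b}" and Y: "Ck_family (Suc 0) {} {a..b} U w Y"
    and sol: "\<And>p t. p \<in> S \<Longrightarrow> t \<in> {a..b} \<Longrightarrow> ((\<lambda>s. \<phi> s p) has_vector_derivative Y t (\<phi> t p)) (at t within {a..b})"
    and inU: "\<And>p t. p \<in> S \<Longrightarrow> t \<in> {a..b} \<Longrightarrow> \<phi> t p \<in> U"
    and init: "\<And>p. p \<in> S \<Longrightarrow> (\<phi> \<tau> has_derivative \<phi>' p) (at p)"
  shows "\<exists>D. \<forall>p\<in>S. D \<tau> p = \<phi>' p \<and> (\<forall>t\<in>{a..b}. (\<phi> t has_derivative D t p) (at p) \<and>
      (\<forall>v. ((\<lambda>s. D s p v) has_vector_derivative frechet_derivative (Y t) (at (\<phi> t p)) (D t p v)) (at t within {a..b})))"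
proof -
  have ab: "a \<le> b" using \<tau> by auto
  have "\<exists>D. D \<tau> = \<phi>' p \<and> (\<forall>t\<in>{a..b}. (\<phi> t has_derivative D t) (at p) \<and>
      (\<forall>v. ((\<lambda>s. D s v) has_vector_derivative frechet_derivative (Y t) (at (\<phi> t p)) (D t v)) (at t within {a..b})))"
    if p: "p \<in> S" for p
  proof -
    define A where "A t = frechet_derivative (Y t) (at (\<phi> t p))" for t
    note solp = sol[OF p] and inp = inU[OF p]
    have c\<phi>: "continuous_on {a..b} (\<lambda>t. \<phi> t p)" by (rule continuous_on_vector_derivative[OF solp])
    have linA: "linear (A t)" if "t \<in> {a..b}" for t
      unfolding A_def by (rule has_derivative_linear[OF Ck_family_SucD(1)[OF Y that inp[OF that]]])
    have cA: "continuous_on {a..b} (\<lambda>t. A t u)" for u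
    proof -
      have "continuous_on {a..b} (\<lambda>t. (t, \<phi> t p))" by (intro continuous_intros c\<phi>)
      from continuous_on_compose2[OF Ck_family_cont[OF Ck_family_SucD(2)[OF Y]] this]
      show ?thesis using inp by (auto simp: A_def image_subset_iff)
    qed
    obtain r L where "r > 0" "L > 0"
       "\<forall>t\<in>{a..b}. \<forall>z\<in>cball (\<phi> t p) r. \<forall>u. norm (frechet_derivative (Y t) (at z) u) \<le> L * norm u"
      using tube_Lipschitz[OF assms(1) Y c\<phi> inp] by blast
    then have rL: "r > 0" "L > 0" "\<And>t u. t\<in>{a..b} \<Longrightarrow> norm (A t u) \<le> L * norm u"
      unfolding A_def by auto
    have "\<exists>u. u \<tau> = \<phi>' p e \<and> (\<forall>t\<in>{a..b}. (u has_vector_derivative A t (u t)) (at t))" for e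
    proof -
      \<comment> \<open>The basis expansion reduces joint continuity in \<open>(t, u)\<close> to
        continuity of \<open>A t b\<close> in \<open>t\<close> for each fixed
        \<open>b\<close>.\<close>
      define X where "X t u = (\<Sum>b\<in>Basis. (u \<bullet> b) *\<^sub>R A t b)" for t u
      have X: "X t u = A t u" if "t \<in> {a..b}" for t u unfolding X_def by (rule linear_Basis_sum[OF linA[OF that], symmetric])
      have "continuous_on ({a..b} \<times> (UNIV :: 'b set)) (\<lambda>p. A (fst p) v)" for v
        by (rule continuous_on_compose2[OF cA[of v] continuous_on_fst[OF continuous_on_id]]) auto
      then have "continuous_on ({a..b} \<times> UNIV) (\<lambda>p. \<Sum>b\<in>Basis. (snd p \<bullet> b) *\<^sub>R A (fst p) b)"
        by (intro continuous_intros)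
      then have "continuous_on ({a..b} \<times> UNIV) (\<lambda>(t, u). X t u)" by (simp add: X_def split_beta)
      moreover have "norm (X t z - X t z') \<le> L * norm (z - z')" if "t \<in> {a..b}" for t z z'
        using rL(3)[OF that, of "z - z'"] linA[OF that] by (simp add: X[OF that] linear_diff)
      ultimately obtain \<phi> where "\<phi> \<tau> = \<phi>' p e" "\<forall>t\<in>{a..b}. (\<phi> has_vector_derivative X t (\<phi> t)) (at t)"
        using picard_interval[OF ab _ rL(2), of X \<tau> "\<phi>' p e"] by blast
      then show ?thesis using X by (intro exI[of _ \<phi>]) auto
    qed
    then obtain u where u: "\<And>e. u e \<tau> = \<phi>' p e" "\<And>e t. t \<in> {a..b} \<Longrightarrow> (u e has_vector_derivative A t (u e t)) (at t)"
      by metis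
    \<comment> \<open>Solving only for the basis vectors makes \<open>D t\<close> linear by
      construction, without an appeal to uniqueness.\<close>
    define D where "D t v = (\<Sum>e\<in>Basis. (v \<bullet> e) *\<^sub>R u e t)" for t v
    have D\<tau>: "D \<tau> = \<phi>' p"
      unfolding D_def u by (rule ext) (rule linear_Basis_sum[OF has_derivative_linear[OF init[OF p]], symmetric])
    have dD: "((\<lambda>s. D s v) has_vector_derivative A t (D t v)) (at t within {a..b})" if "t \<in> {a..b}" for t v
    proof -
      have "((\<lambda>s. D s v) has_vector_derivative (\<Sum>e\<in>Basis. (v \<bullet> e) *\<^sub>R A t (u e t))) (at t within {a..b})"
        unfolding D_def by (intro has_vector_derivative_sum has_vector_derivative_scaleR[where f = "\<lambda>_. c" and f' = 0 for c, simplified]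
            has_vector_derivative_at_within[OF u(2)[OF that]])
      moreover have "(\<Sum>e\<in>Basis. (v \<bullet> e) *\<^sub>R A t (u e t)) = A t (D t v)"
        unfolding D_def by (simp add: linear_sum[OF linA[OF that]] linear_scale[OF linA[OF that]])
      ultimately show ?thesis by simp
    qed
    have blD: "bounded_linear (D t)" for t
      unfolding D_def by (intro bounded_linear_sum bounded_linear_compose[OF bounded_linear_scaleR_left bounded_linear_inner_left])
    obtain r1 K where K: "r1 > 0" "K > 0" "\<And>\<rho>. (\<forall>t\<in>{a..b}. (\<rho> has_vector_derivative Y t (\<rho> t)) (at t within {a..b})) \<Longrightarrow>
       norm (\<rho> \<tau> - \<phi> \<tau> p) < r1 \<Longrightarrow> (\<forall>t\<in>{a..b}. norm (\<rho> t - \<phi> t p) \<le> K * norm (\<rho> \<tau> - \<phi> \<tau> p))"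
      using solution_dependence[OF assms(1) Y \<tau> solp inp] by metis
    obtain r2 where r2: "r2 > 0" "ball p r2 \<subseteq> S" using assms(2) p openE by blast
    define B where "B = onorm (\<phi>' p) + 1"
    have bl0: "bounded_linear (\<phi>' p)" using init[OF p] by (rule has_derivative_bounded_linear)
    have B: "B > 0" unfolding B_def using onorm_pos_le[OF bl0] by simp
    define M where "M = exp (L * (b - a))"
    have M: "M \<ge> 1" using ab rL by (simp add: M_def)
    note init_alt = init[OF p, unfolded has_derivative_at_alt, THEN conjunct2, rule_format]
    obtain r3 where r3: "r3 > 0" "\<And>q. norm (q - p) < r3 \<Longrightarrow> norm (\<phi> \<tau> q - \<phi> \<tau> p) \<le> B * norm (q - p)"
    proof -
      obtain d where d: "d > 0" "\<And>q. norm (q - p) < d \<Longrightarrow> norm (\<phi> \<tau> q - \<phi> \<tau> p - \<phi>' p (q - p)) \<le> 1 * norm (q - p)"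
        using init_alt[of 1] by auto
      have "norm (\<phi> \<tau> q - \<phi> \<tau> p) \<le> B * norm (q - p)" if "norm (q - p) < d" for q
        using d(2)[OF that] onorm[OF bl0, of "q - p"] norm_triangle_sub[of "\<phi> \<tau> q - \<phi> \<tau> p" "\<phi>' p (q - p)"]
        unfolding B_def by (simp add: algebra_simps)
      then show thesis using d(1) that by blast
    qed
    have "(\<phi> t has_derivative D t) (at p)" if t: "t \<in> {a..b}" for t
      unfolding has_derivative_at_alt
    proof (intro conjI blD allI impI)
      fix \<epsilon> :: real assume "\<epsilon> > 0"
      \<comment> \<open>The constants are such that, after the Gronwall factor \<open>M\<close>, the
        inhomogeneity and the initial error each contribute half of
        \<open>\<epsilon> * norm (q - p)\<close>.\<close>
      define \<epsilon>1 where "\<epsilon>1 = \<epsilon> * L / (2 * M * K * B)"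
      define \<epsilon>2 where "\<epsilon>2 = \<epsilon> / (2 * M)"
      have eps: "\<epsilon>1 > 0" "\<epsilon>2 > 0" using \<open>\<epsilon> > 0\<close> M K(2) B rL(2) by (auto simp: \<epsilon>1_def \<epsilon>2_def)
      obtain \<delta> where \<delta>: "\<delta> > 0" "\<And>t z. t\<in>{a..b} \<Longrightarrow> z\<in>cball (\<phi> t p) \<delta> \<Longrightarrow>
         norm (Y t z - Y t (\<phi> t p) - A t (z - \<phi> t p)) \<le> \<epsilon>1 * norm (z - \<phi> t p)"
        using tube_linearization[OF assms(1) Y c\<phi> inp eps(1)] unfolding A_def by blast
      obtain r4 where r4: "r4 > 0" "\<And>q. norm (q - p) < r4 \<Longrightarrow> norm (\<phi> \<tau> q - \<phi> \<tau> p - \<phi>' p (q - p)) \<le> \<epsilon>2 * norm (q - p)"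
        using init_alt[OF eps(2)] by auto
      \<comment> \<open>\<open>r2\<close> keeps \<open>q\<close> in \<open>S\<close>;
        \<open>r3\<close> and \<open>r4\<close> give the two estimates on initial values;
        \<open>r1 / B\<close> makes the dependence estimate applicable;
        \<open>\<delta> / (K * B)\<close> keeps \<open>\<phi> s q\<close> where the linearization
        holds.\<close>
      define d where "d = min (min (min r2 r3) r4) (min (r1 / B) (\<delta> / (K * B)))"
      have "r1 / B > 0" "\<delta> / (K * B) > 0" using K(1,2) B \<delta>(1) by simp_all
      then have d: "d > 0" "d \<le> r2" "d \<le> r3" "d \<le> r4" "d \<le> r1 / B" "d \<le> \<delta> / (K * B)"
        unfolding d_def using r2(1) r3(1) r4(1) by linarith+
      show "\<exists>d>0. \<forall>q. norm (q - p) < d \<longrightarrow> norm (\<phi> t q - \<phi> t p - D t (q - p)) \<le> \<epsilon> * norm (q - p)"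
      proof (intro exI[of _ d] conjI d(1) allI impI)
        fix q assume q: "norm (q - p) < d"
        have qS: "q \<in> S" using r2(2) d q by (auto simp: dist_norm norm_minus_commute subset_iff)
        have i1: "norm (\<phi> \<tau> q - \<phi> \<tau> p) \<le> B * norm (q - p)" using r3 d q by auto
        have "norm (q - p) < r1 / B" using q d(5) by linarith
        then have "B * norm (q - p) < r1" using B by (simp add: pos_less_divide_eq mult.commute)
        then have "norm (\<phi> \<tau> q - \<phi> \<tau> p) < r1" using i1 by simp
        with K(3)[of "\<lambda>s. \<phi> s q"] sol[OF qS] have i2: "norm (\<phi> s q - \<phi> s p) \<le> K * norm (\<phi> \<tau> q - \<phi> \<tau> p)"
          if "s \<in> {a..b}" for s using that by blast
        have i3: "norm (\<phi> s q - \<phi> s p) \<le> K * B * norm (q - p)" if "s \<in> {a..b}" for s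
          using order_trans[OF i2[OF that] mult_left_mono[OF i1, of K]] K(2) by (simp add: mult.assoc)
        have "norm (q - p) \<le> \<delta> / (K * B)" using q d(6) by linarith
        moreover have "K * B > 0" using B K(2) by simp
        ultimately have small: "K * B * norm (q - p) \<le> \<delta>"
          by (simp only: pos_le_divide_eq mult.commute)
        define e where "e s = \<phi> s q - \<phi> s p - D s (q - p)" for s
        have de: "(e has_vector_derivative Y s (\<phi> s q) - Y s (\<phi> s p) - A s (D s (q - p))) (at s within {a..b})"
          if "s \<in> {a..b}" for s
          unfolding e_def by (intro has_vector_derivative_diff sol[OF qS that] solp[OF that] dD[OF that])
        have "norm (e t) \<le> (norm (e \<tau>) + (\<epsilon>1 * (K * B * norm (q - p))) / L) * exp (L * \<bar>t - \<tau>\<bar>)"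
        proof (rule gronwall[OF rL(2) _ \<tau> t de])
          show "0 \<le> \<epsilon>1 * (K * B * norm (q - p))" using eps K B by simp
          fix s assume s: "s \<in> closed_segment \<tau> t"
          then have s: "s \<in> {a..b}" using closed_segment_in_interval \<tau> t by blast
          have eq: "Y s (\<phi> s q) - Y s (\<phi> s p) - A s (D s (q - p)) =
            A s (e s) + (Y s (\<phi> s q) - Y s (\<phi> s p) - A s (\<phi> s q - \<phi> s p))"
            unfolding e_def by (simp add: linear_diff[OF linA[OF s]])
          have "norm (Y s (\<phi> s q) - Y s (\<phi> s p) - A s (\<phi> s q - \<phi> s p)) \<le> \<epsilon>1 * norm (\<phi> s q - \<phi> s p)"
            using i3[OF s] small by (intro \<delta>(2)[OF s]) (simp add: dist_norm norm_minus_commute)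
          also have "\<dots> \<le> \<epsilon>1 * (K * B * norm (q - p))" using i3[OF s] eps by (intro mult_left_mono) auto
          finally show "norm (Y s (\<phi> s q) - Y s (\<phi> s p) - A s (D s (q - p))) \<le>
            L * norm (e s) + \<epsilon>1 * (K * B * norm (q - p))"
            unfolding eq by (intro norm_triangle_mono rL(3)[OF s])
        qed
        also have "\<dots> \<le> (\<epsilon>2 * norm (q - p) + (\<epsilon>1 * (K * B * norm (q - p))) / L) * M"
        proof (intro mult_mono add_right_mono)
          show "norm (e \<tau>) \<le> \<epsilon>2 * norm (q - p)" unfolding e_def D\<tau> using r4 d q by auto
          show "exp (L * \<bar>t - \<tau>\<bar>) \<le> M" unfolding M_def using t \<tau> rL by auto
        qed (use eps K B rL in auto)
        also have "\<dots> = \<epsilon> * norm (q - p)"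
        proof -
          have "(\<epsilon>1 * (K * B * norm (q - p))) / L = \<epsilon>2 * norm (q - p)"
            unfolding \<epsilon>1_def \<epsilon>2_def using K(2) B rL(2) M by (simp add: field_simps)
          then have "(\<epsilon>2 * norm (q - p) + (\<epsilon>1 * (K * B * norm (q - p))) / L) * M = 2 * (\<epsilon>2 * M) * norm (q - p)"
            by (simp add: algebra_simps)
          also have "2 * (\<epsilon>2 * M) = \<epsilon>" using M by (simp add: \<epsilon>2_def)
          finally show ?thesis .
        qed
        finally show "norm (\<phi> t q - \<phi> t p - D t (q - p)) \<le> \<epsilon> * norm (q - p)" by (simp add: e_def)
      qed
    qed
    then show ?thesis using D\<tau> dD unfolding A_def by (intro exI[of _ D]) simp
  qed
  then obtain D where D: "\<forall>p\<in>S. D p \<tau> = \<phi>' p \<and> (\<forall>t\<in>{a..b}. (\<phi> t has_derivative D p t) (at p) \<and>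
      (\<forall>v. ((\<lambda>s. D p s v) has_vector_derivative frechet_derivative (Y t) (at (\<phi> t p)) (D p t v)) (at t within {a..b})))"
    using bchoice[of S "\<lambda>p D. D \<tau> = \<phi>' p \<and> (\<forall>t\<in>{a..b}. (\<phi> t has_derivative D t) (at p) \<and>
      (\<forall>v. ((\<lambda>s. D s v) has_vector_derivative frechet_derivative (Y t) (at (\<phi> t p)) (D t v)) (at t within {a..b})))"]
    by blast
  show ?thesis by (rule exI[of _ "\<lambda>t p. D p t"]) (rule D)
qed

section \<open>Higher derivatives with respect to parameters\<close>

lemma Ck_family_fst:
  assumes "Ck_family k {} T S w f" "open S" "open U"
  shows "Ck_family k {} T (S \<times> U) v (\<lambda>t p. f t (fst p))"
proof (rule Ck_family_compose[OF _ _ assms(1)])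
  show "Ck_family k {} T (S \<times> U) (\<lambda>_. 1) (\<lambda>t. fst)"
    by (rule Ck_family_bounded_linear[where c = 1])
      (auto simp: assms open_Times bounded_linear_fst weight_bounded_def split_beta intro!: continuous_intros)
qed (auto simp: assms open_Times)

text \<open>Here the equation itself varies with the parameter. The difference of two solutions
  satisfies the equation at \<open>q\<close> with inhomogeneity
  \<open>(A s q - A s p) (w s p) + (g s q - g s p)\<close>, which is small near \<open>p\<close>;
  the common initial value \<open>c\<close> contributes nothing.\<close>

lemma linear_family_continuous:
  fixes w :: "real \<Rightarrow> 'a::euclidean_space \<Rightarrow> 'b::euclidean_space"
  assumes "open S" and \<tau>: "\<tau> \<in> {a..b}"
    and lin: "\<And>t p. t \<in> {a..b} \<Longrightarrow> p \<in> S \<Longrightarrow> linear (A t p)"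
    and cA: "\<And>u. continuous_on ({a..b} \<times> S) (\<lambda>(t, p). A t p u)"
    and cg: "continuous_on ({a..b} \<times> S) (\<lambda>(t, p). g t p)"
    and sol: "\<And>p t. p \<in> S \<Longrightarrow> t \<in> {a..b} \<Longrightarrow>
        ((\<lambda>s. w s p) has_vector_derivative A t p (w t p) + g t p) (at t within {a..b})"
    and init: "\<And>p. p \<in> S \<Longrightarrow> w \<tau> p = c"
  shows "continuous_on ({a..b} \<times> S) (\<lambda>(t, p). w t p)"
proof (rule joint_continuity)
  fix p assume p: "p \<in> S"
  show cw: "continuous_on {a..b} (\<lambda>t. w t p)"
    by (rule continuous_on_vector_derivative[OF sol[OF p]])
  fix \<epsilon> :: real assume \<epsilon>: "\<epsilon> > 0"
  have ab: "a \<le> b" using \<tau> by auto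
  have tube: "\<exists>\<delta>>0. \<forall>t\<in>{a..b}. cball p \<delta> \<subseteq> S \<and> (\<forall>q\<in>cball p \<delta>. norm (h t q - h t p) \<le> e)"
    if "continuous_on ({a..b} \<times> S) (\<lambda>(t, p). h t p)" "e > 0" for h :: "real \<Rightarrow> 'a \<Rightarrow> 'b" and e
    using tube_uniform_continuity[OF assms(1), of a b "\<lambda>_. p" h e] that p by auto
  define N where "N = real (card (Basis :: 'b set))"
  have N: "N \<ge> 1" unfolding N_def by (simp add: Suc_leI)
  have "\<exists>B. \<forall>t\<in>{a..b}. norm (A t p e) \<le> B" for e
  proof -
    have "continuous_on {a..b} (\<lambda>t. (t, p))" by (intro continuous_intros)
    from continuous_on_compose2[OF cA this, of e] have "continuous_on {a..b} (\<lambda>t. A t p e)" using p by auto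
    then have "bounded ((\<lambda>t. A t p e) ` {a..b})" by (intro compact_imp_bounded compact_continuous_image) auto
    then show ?thesis by (auto simp: bounded_iff)
  qed
  then obtain B where B: "\<And>e t. t \<in> {a..b} \<Longrightarrow> norm (A t p e) \<le> B e" by metis
  define L where "L = \<bar>\<Sum>e\<in>Basis. B e + 1\<bar> + 1"
  have L: "L > 0" by (simp add: L_def add.commute add_pos_nonneg)
  have "bounded ((\<lambda>t. w t p) ` {a..b})" by (intro compact_imp_bounded compact_continuous_image cw) auto
  then obtain W where W: "\<forall>t\<in>{a..b}. norm (w t p) \<le> W" by (auto simp: bounded_iff)
  then have W: "norm (w t p) \<le> W" if "t \<in> {a..b}" for t using that by blast
  have W0: "W \<ge> 0" using W[OF \<tau>] norm_ge_zero order_trans by blast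
  define M where "M = exp (L * (b - a))"
  have M: "M > 0" by (simp add: M_def)
  \<comment> \<open>The bound 1 allows \<open>A s q\<close> to be controlled by
    \<open>B e + 1\<close> near \<open>p\<close>. The other bound makes the \<open>A\<close>-part of
    the Gronwall estimate at most \<open>\<epsilon> / 2\<close>; the summand 1 in the denominator
    keeps it positive even for \<open>W = 0\<close>.\<close>
  define e1 where "e1 = min 1 (\<epsilon> * L / (2 * M * (N * W + 1)))"
  define e2 where "e2 = \<epsilon> * L / (2 * M)"
  have e: "e1 > 0" "e2 > 0" "e1 \<le> 1" using \<epsilon> L M N W0 unfolding e1_def e2_def
    by (auto intro!: divide_pos_pos mult_pos_pos add_nonneg_pos)
  obtain \<delta> where \<delta>: "\<And>e. \<delta> e > 0" "\<And>e. cball p (\<delta> e) \<subseteq> S" "\<And>e t q. t \<in> {a..b} \<Longrightarrow> q \<in> cball p (\<delta> e) \<Longrightarrow> norm (A t q e - A t p e) \<le> e1"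
  proof -
    have "\<exists>\<delta>>0. \<forall>t\<in>{a..b}. cball p \<delta> \<subseteq> S \<and> (\<forall>q\<in>cball p \<delta>. norm (A t q e - A t p e) \<le> e1)" for e
      using tube[OF cA e(1)] .
    then obtain \<delta> where "\<And>e. \<delta> e > 0 \<and> (\<forall>t\<in>{a..b}. cball p (\<delta> e) \<subseteq> S \<and> (\<forall>q\<in>cball p (\<delta> e). norm (A t q e - A t p e) \<le> e1))"
      by metis
    then show thesis using that[of \<delta>] \<tau> by blast
  qed
  obtain \<delta>g where \<delta>g: "\<delta>g > 0" "\<And>t q. t \<in> {a..b} \<Longrightarrow> q \<in> cball p \<delta>g \<Longrightarrow> norm (g t q - g t p) \<le> e2"
    using tube[OF cg e(2)] by blast
  define d where "d = min \<delta>g (Min (\<delta> ` Basis))"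
  have d: "d > 0" "d \<le> \<delta>g" "\<And>e. e \<in> Basis \<Longrightarrow> d \<le> \<delta> e" unfolding d_def using \<delta>(1) \<delta>g(1) by (auto intro: min.coboundedI2)
  show "\<exists>\<delta>>0. \<forall>t\<in>{a..b}. \<forall>q\<in>S. norm (q - p) < \<delta> \<longrightarrow> norm (w t q - w t p) \<le> \<epsilon>"
  proof (intro exI[of _ d] conjI d(1) ballI impI)
    fix t q assume t: "t \<in> {a..b}" and q: "q \<in> S" "norm (q - p) < d"
    have qb: "q \<in> cball p (\<delta> e)" if "e \<in> Basis" for e using q(2) d(3)[OF that] by (auto simp: dist_norm norm_minus_commute)
    have qg: "q \<in> cball p \<delta>g" using q(2) d(2) by (auto simp: dist_norm norm_minus_commute)
    have "norm (w t q - w t p) \<le> (norm (w \<tau> q - w \<tau> p) + (N * e1 * W + e2) / L) * exp (L * \<bar>t - \<tau>\<bar>)"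
    proof (rule gronwall[OF L _ \<tau> t has_vector_derivative_diff[OF sol[OF q(1)] sol[OF p]]])
      show "0 \<le> N * e1 * W + e2" using N e W0 by simp
      fix s assume "s \<in> closed_segment \<tau> t"
      then have s: "s \<in> {a..b}" using closed_segment_in_interval \<tau> t by blast
      note linq = lin[OF s q(1)] and linp = lin[OF s p]
      have "norm (A s q e) \<le> B e + 1" if "e \<in> Basis" for e
        using \<delta>(3)[OF s qb[OF that]] B[OF s, of e] e(3) norm_triangle_sub[of "A s q e" "A s p e"] by linarith
      then have "norm (A s q (w s q - w s p)) \<le> (\<Sum>e\<in>Basis. B e + 1) * norm (w s q - w s p)"
        by (rule norm_linear_le_Basis[OF linq])
      also have "\<dots> \<le> L * norm (w s q - w s p)" by (rule mult_right_mono) (auto simp: L_def)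
      finally have 1: "norm (A s q (w s q - w s p)) \<le> L * norm (w s q - w s p)" .
      have "norm (A s q (w s p) - A s p (w s p)) \<le> (\<Sum>e\<in>(Basis :: 'b set). e1) * norm (w s p)"
        by (rule norm_linear_le_Basis[OF linear_compose_sub[OF linq linp]]) (use \<delta>(3)[OF s qb] in auto)
      also have "\<dots> \<le> N * e1 * W" using W[OF s] N e by (simp add: N_def mult_left_mono)
      finally have 2: "norm (A s q (w s p) - A s p (w s p)) \<le> N * e1 * W" .
      have 3: "norm (g s q - g s p) \<le> e2" by (rule \<delta>g(2)[OF s qg])
      have eq: "A s q (w s q) + g s q - (A s p (w s p) + g s p) =
        A s q (w s q - w s p) + ((A s q (w s p) - A s p (w s p)) + (g s q - g s p))"
        by (simp add: linear_diff[OF linq])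
      show "norm (A s q (w s q) + g s q - (A s p (w s p) + g s p)) \<le> L * norm (w s q - w s p) + (N * e1 * W + e2)"
        unfolding eq by (intro norm_triangle_mono 1 2 3)
    qed
    also have "\<dots> \<le> ((N * e1 * W + e2) / L) * M"
    proof -
      have "exp (L * \<bar>t - \<tau>\<bar>) \<le> M" unfolding M_def using t \<tau> L by auto
      then show ?thesis using init[OF q(1)] init[OF p] L N e W0 by (simp add: mult_left_mono divide_right_mono)
    qed
    also have "\<dots> \<le> \<epsilon>"
    proof -
      have NW: "N * W + 1 > 0" using N W0 by (simp add: add_nonneg_pos)
      have "e1 * (2 * M * (N * W + 1)) \<le> \<epsilon> * L"
        using M NW unfolding pos_le_divide_eq[symmetric, OF mult_pos_pos[OF mult_pos_pos[OF zero_less_numeral M] NW]]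
        by (simp add: e1_def)
      moreover have "e1 * (2 * M * (N * W + 1)) = 2 * M * (N * e1 * W) + 2 * M * e1" by (simp add: algebra_simps)
      ultimately have "2 * M * (N * e1 * W) \<le> \<epsilon> * L" using mult_pos_pos[OF M e(1)] by linarith
      moreover have "2 * M * e2 = \<epsilon> * L" using M by (simp add: e2_def)
      ultimately have "(N * e1 * W + e2) * M \<le> \<epsilon> * L" by (simp add: algebra_simps)
      then show ?thesis using L by (simp add: pos_divide_le_eq)
    qed
    finally show "norm (w t q - w t p) \<le> \<epsilon>" .
  qed
qed

text \<open>A derivative of \<open>w\<close> with respect to the parameter solves an equation with the same \<open>A\<close> and a new
  inhomogeneity of one order less, so the induction never leaves the type of \<open>w\<close>.\<close>

lemma linear_family_Ck:
  fixes w :: "real \<Rightarrow> 'a::euclidean_space \<Rightarrow> 'b::euclidean_space"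
  assumes "open S" and \<tau>: "\<tau> \<in> {a..b}"
    and lin: "\<And>t p. t \<in> {a..b} \<Longrightarrow> p \<in> S \<Longrightarrow> linear (A t p)"
    and A: "\<And>u. Ck_family k {} {a..b} S v (\<lambda>t p. A t p u)"
  shows "j \<le> k \<Longrightarrow> Ck_family j {} {a..b} S v g \<Longrightarrow>
    (\<And>p t. p \<in> S \<Longrightarrow> t \<in> {a..b} \<Longrightarrow>
        ((\<lambda>s. w s p) has_vector_derivative A t p (w t p) + g t p) (at t within {a..b})) \<Longrightarrow>
    (\<And>p. p \<in> S \<Longrightarrow> w \<tau> p = c) \<Longrightarrow> Ck_family j {} {a..b} S v w"
proof (induction j arbitrary: g w c)
  case 0
  have "continuous_on ({a..b} \<times> S) (\<lambda>(t, p). w t p)"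
    by (rule linear_family_continuous[OF assms(1) \<tau> lin Ck_family_cont[OF A] Ck_family_cont[OF 0(2)] 0(3,4)])
  then show ?case by (auto simp: weight_bounded_def)
next
  case (Suc j)
  have A1: "Ck_family (Suc 0) {} {a..b} S v (\<lambda>t p. A t p u)" for u
    by (rule Ck_family_le[OF A]) (use Suc.prems(1) in auto)
  have g1: "Ck_family (Suc 0) {} {a..b} S v g" by (rule Ck_family_le[OF Suc.prems(2)]) simp
  have cw: "continuous_on ({a..b} \<times> S) (\<lambda>(t, p). w t p)"
    by (rule linear_family_continuous[OF assms(1) \<tau> lin Ck_family_cont[OF A] Ck_family_cont[OF Suc.prems(2)] Suc.prems(3,4)])
  \<comment> \<open>The parameter is adjoined as an unknown that is constant in time. The pair
    \<open>(p, w t p)\<close> then solves one fixed equation, to which the first-order result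
    applies.\<close>
  define Y where "Y t z = (0 :: 'a, (\<Sum>e\<in>Basis. (snd z \<bullet> e) *\<^sub>R A t (fst z) e) + g t (fst z))" for t and z :: "'a \<times> 'b"
  have oS: "open (S \<times> (UNIV :: 'b set))" using assms(1) by (simp add: open_Times)
  have idsnd: "Ck_family i {} {a..b} (S \<times> (UNIV :: 'b set)) (\<lambda>_. 1) (\<lambda>t z. snd z \<bullet> e)" for i e
    by (rule Ck_family_bounded_linear[where c = 1, OF oS])
      (auto intro!: bounded_linear_compose[OF bounded_linear_inner_left bounded_linear_snd] continuous_intros simp: weight_bounded_def split_beta)
  have CY: "Ck_family (Suc 0) {} {a..b} (S \<times> (UNIV :: 'b set)) (\<lambda>_. 1) Y"
  proof -
    have "Ck_family (Suc 0) {} {a..b} (S \<times> (UNIV :: 'b set)) (\<lambda>t. 1 * 1) (\<lambda>t z. (snd z \<bullet> e) *\<^sub>R A t (fst z) e)" for e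
      by (rule Ck_family_bilinear[OF oS bounded_bilinear_scaleR idsnd Ck_family_fst[OF A1 assms(1) open_UNIV]])
    then have "Ck_family (Suc 0) {} {a..b} (S \<times> (UNIV :: 'b set)) (\<lambda>_. 1)
       (\<lambda>t z. (\<Sum>e\<in>Basis. (snd z \<bullet> e) *\<^sub>R A t (fst z) e) + g t (fst z))"
      by (intro Ck_family_add[OF oS Ck_family_sum[OF oS]] Ck_family_fst[OF g1 assms(1) open_UNIV]) simp
    from Ck_family_linear[OF oS _ this, of "\<lambda>y. (0, y)"] show ?thesis
      by (simp add: Y_def[abs_def] bounded_linear_Pair bounded_linear_zero bounded_linear_ident)
  qed
  have dY: "(Y t has_derivative (\<lambda>d. (0, (\<Sum>e\<in>Basis. (snd d \<bullet> e) *\<^sub>R A t p e + (u \<bullet> e) *\<^sub>R frechet_derivative (\<lambda>q. A t q e) (at p) (fst d)) +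
       frechet_derivative (g t) (at p) (fst d)))) (at (p, u))" if "t \<in> {a..b}" "p \<in> S" for t p u
  proof -
    have 1: "((\<lambda>z. A t (fst z) e) has_derivative (\<lambda>d. frechet_derivative (\<lambda>q. A t q e) (at p) (fst d))) (at (p, u))" for e
      using diff_chain_at[OF bounded_linear_imp_has_derivative[OF bounded_linear_fst, of "at (p, u)"], of "\<lambda>q. A t q e"]
        Ck_family_SucD(1)[OF A1 that] by (auto simp: o_def)
    have 2: "((\<lambda>z. g t (fst z)) has_derivative (\<lambda>d. frechet_derivative (g t) (at p) (fst d))) (at (p, u))"
      using diff_chain_at[OF bounded_linear_imp_has_derivative[OF bounded_linear_fst, of "at (p, u)"], of "g t"]
        Ck_family_SucD(1)[OF g1 that] by (auto simp: o_def)
    have 3: "((\<lambda>z. snd z \<bullet> e) has_derivative (\<lambda>d. snd d \<bullet> e)) (at (p, u))" for e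
      by (rule bounded_linear_imp_has_derivative[OF bounded_linear_compose[OF bounded_linear_inner_left bounded_linear_snd]])
    have "((\<lambda>z. (snd z \<bullet> e) *\<^sub>R A t (fst z) e) has_derivative
        (\<lambda>d. (snd d \<bullet> e) *\<^sub>R A t p e + (u \<bullet> e) *\<^sub>R frechet_derivative (\<lambda>q. A t q e) (at p) (fst d))) (at (p, u))" for e
      using has_derivative_scaleR[OF 3 1, of e e] by (simp add: add.commute)
    then show ?thesis unfolding Y_def by (intro has_derivative_Pair has_derivative_const has_derivative_add has_derivative_sum 2)
  qed
  define \<phi> where "\<phi> t p = (p, w t p)" for t p
  have sol: "((\<lambda>s. \<phi> s p) has_vector_derivative Y t (\<phi> t p)) (at t within {a..b})" if "p \<in> S" "t \<in> {a..b}" for p t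
  proof -
    have "(\<Sum>e\<in>Basis. (w t p \<bullet> e) *\<^sub>R A t p e) = A t p (w t p)"
      by (rule linear_Basis_sum[OF lin[OF that(2,1)], symmetric])
    then show ?thesis unfolding \<phi>_def Y_def
      using has_vector_derivative_Pair[OF has_vector_derivative_const Suc.prems(3)[OF that]] by simp
  qed
  have init: "(\<phi> \<tau> has_derivative (\<lambda>v. (v, 0))) (at p)" if "p \<in> S" for p
  proof -
    have "((\<lambda>p. (p, c)) has_derivative (\<lambda>v. (v, 0))) (at p)" by (auto intro!: derivative_eq_intros)
    then show ?thesis
      by (rule has_derivative_transform_within_open[OF _ assms(1) that]) (simp add: \<phi>_def Suc.prems(4))
  qed
  have inS: "\<phi> t p \<in> S \<times> UNIV" if "p \<in> S" "t \<in> {a..b}" for t p using that by (simp add: \<phi>_def)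
  from solution_family_C1[OF oS assms(1) \<tau> CY sol inS init]
  obtain D where D: "\<And>p. p \<in> S \<Longrightarrow> D \<tau> p = (\<lambda>v. (v, 0))"
    "\<And>p t. p \<in> S \<Longrightarrow> t \<in> {a..b} \<Longrightarrow> (\<phi> t has_derivative D t p) (at p)"
    "\<And>p t v. p \<in> S \<Longrightarrow> t \<in> {a..b} \<Longrightarrow>
      ((\<lambda>s. D s p v) has_vector_derivative frechet_derivative (Y t) (at (\<phi> t p)) (D t p v)) (at t within {a..b})"
    by blast
  have dw: "(w t has_derivative (\<lambda>v. snd (D t p v))) (at p)" if "p \<in> S" "t \<in> {a..b}" for p t
    using has_derivative_snd[OF D(2)[OF that]] by (simp add: \<phi>_def)
  have fstD: "fst (D t p v) = v" if "p \<in> S" "t \<in> {a..b}" for p t v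
  proof -
    have "((\<lambda>p. p) has_derivative (\<lambda>v. fst (D t p v))) (at p)"
      using has_derivative_fst[OF D(2)[OF that]] by (simp add: \<phi>_def)
    from has_derivative_unique[OF this has_derivative_ident] show ?thesis by metis
  qed
  have wj: "Ck_family j {} {a..b} S v w"
    by (rule Suc.IH[OF _ Ck_family_Suc_imp[OF Suc.prems(2)] Suc.prems(3,4)]) (use Suc.prems(1) in auto)
  show ?case
  proof (rule Ck_family_SucI[OF assms(1) _ dw])
    show "weight_bounded {} {a..b} S v w" using cw by (auto simp: weight_bounded_def)
    fix d :: 'a
    \<comment> \<open>The part of the differentiated right-hand side in which \<open>w\<close>
      itself is not differentiated.\<close>
    define g' where "g' t p = (\<Sum>e\<in>Basis. (w t p \<bullet> e) *\<^sub>R frechet_derivative (\<lambda>q. A t q e) (at p) d) + frechet_derivative (g t) (at p) d" for t p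
    show "Ck_family j {} {a..b} S v (\<lambda>t p. snd (D t p d))"
    proof (rule Suc.IH)
      show "j \<le> k" using Suc.prems(1) by simp
      have "Ck_family j {} {a..b} S v (\<lambda>t p. frechet_derivative (\<lambda>q. A t q e) (at p) d)" for e
        by (rule Ck_family_SucD(2)[OF Ck_family_le[OF A Suc.prems(1)]])
      then have "Ck_family j {} {a..b} S (\<lambda>t. v t * v t) (\<lambda>t p. (w t p \<bullet> e) *\<^sub>R frechet_derivative (\<lambda>q. A t q e) (at p) d)" for e
        by (intro Ck_family_bilinear[OF assms(1) bounded_bilinear_scaleR] Ck_family_linear[OF assms(1) bounded_linear_inner_left wj])
      then have "Ck_family j {} {a..b} S v (\<lambda>t p. (w t p \<bullet> e) *\<^sub>R frechet_derivative (\<lambda>q. A t q e) (at p) d)" for e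
        by (rule Ck_family_ignore)
      then show "Ck_family j {} {a..b} S v g'" unfolding g'_def
        by (intro Ck_family_add[OF assms(1)] Ck_family_sum[OF assms(1)] Ck_family_SucD(2)[OF Suc.prems(2)])
      fix p t assume pt: "p \<in> S" "t \<in> {a..b}"
      have "(\<Sum>e\<in>Basis. (snd (D t p d) \<bullet> e) *\<^sub>R A t p e) = A t p (snd (D t p d))"
        by (rule linear_Basis_sum[OF lin[OF pt(2,1)], symmetric])
      then have "snd (frechet_derivative (Y t) (at (\<phi> t p)) (D t p d)) = A t p (snd (D t p d)) + g' t p"
        unfolding \<phi>_def frechet_derivative_at[OF dY[OF pt(2,1)], symmetric]
        by (simp add: fstD[OF pt] g'_def sum.distrib add.assoc)
      then show "((\<lambda>s. snd (D s p d)) has_vector_derivative A t p (snd (D t p d)) + g' t p) (at t within {a..b})"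
        using bounded_linear.has_vector_derivative[OF bounded_linear_snd D(3)[OF pt, of d]] by simp
    next
      show "snd (D \<tau> p d) = 0" if "p \<in> S" for p using D(1)[OF that] by simp
    qed
  qed
qed

text \<open>The coefficient of the variational equation, the derivative of \<open>Y\<close> along
  \<open>\<phi>\<close>, has as many derivatives as \<open>\<phi>\<close>. So do the solutions of
  that linear equation, which are the derivatives of \<open>\<phi>\<close>; each round therefore
  gains one order.\<close>

lemma solution_family_Ck:
  fixes \<phi> :: "real \<Rightarrow> 'a::euclidean_space \<Rightarrow> 'a"
  assumes "open U" "open S" and \<tau>: "\<tau> \<in> {a..b}" and Y: "\<And>k. Ck_family k {} {a..b} U w Y"
    and sol: "\<And>p t. p \<in> S \<Longrightarrow> t \<in> {a..b} \<Longrightarrow> ((\<lambda>s. \<phi> s p) has_vector_derivative Y t (\<phi> t p)) (at t within {a..b})"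
    and inU: "\<And>p t. p \<in> S \<Longrightarrow> t \<in> {a..b} \<Longrightarrow> \<phi> t p \<in> U"
    and init: "\<And>p. p \<in> S \<Longrightarrow> \<phi> \<tau> p = p"
  shows "Ck_family k {} {a..b} S w \<phi>"
proof -
  have cont: "continuous_on ({a..b} \<times> S) (\<lambda>(t, p). \<phi> t p)"
  proof (rule joint_continuity)
    fix p assume p: "p \<in> S"
    show "continuous_on {a..b} (\<lambda>t. \<phi> t p)" by (rule continuous_on_vector_derivative[OF sol[OF p]])
    fix \<epsilon> :: real assume "\<epsilon> > 0"
    obtain r K where K: "r > 0" "K > 0" "\<And>\<rho>. (\<forall>t\<in>{a..b}. (\<rho> has_vector_derivative Y t (\<rho> t)) (at t within {a..b})) \<Longrightarrow>
       norm (\<rho> \<tau> - \<phi> \<tau> p) < r \<Longrightarrow> (\<forall>t\<in>{a..b}. norm (\<rho> t - \<phi> t p) \<le> K * norm (\<rho> \<tau> - \<phi> \<tau> p))"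
      using solution_dependence[OF assms(1) Y \<tau> sol[OF p] inU[OF p]] by metis
    show "\<exists>\<delta>>0. \<forall>t\<in>{a..b}. \<forall>q\<in>S. norm (q - p) < \<delta> \<longrightarrow> norm (\<phi> t q - \<phi> t p) \<le> \<epsilon>"
    proof (intro exI[of _ "min r (\<epsilon> / K)"] conjI ballI impI)
      fix t q assume t: "t \<in> {a..b}" and q: "q \<in> S" "norm (q - p) < min r (\<epsilon> / K)"
      have "norm (\<phi> t q - \<phi> t p) \<le> K * norm (q - p)"
        using K(3)[of "\<lambda>s. \<phi> s q"] sol[OF q(1)] q t init[OF p] init[OF q(1)] by auto
      also have "\<dots> \<le> \<epsilon>" using q(2) K(2) by (simp add: pos_less_divide_eq mult.commute)
      finally show "norm (\<phi> t q - \<phi> t p) \<le> \<epsilon>" .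
    qed (use K \<open>\<epsilon> > 0\<close> in auto)
  qed
  have d0: "(\<phi> \<tau> has_derivative (\<lambda>v. v)) (at p)" if "p \<in> S" for p
    by (rule has_derivative_transform_within_open[OF has_derivative_ident assms(2) that]) (simp add: init)
  from solution_family_C1[OF assms(1,2) \<tau> Y sol inU d0]
  obtain D where D: "\<And>p. p \<in> S \<Longrightarrow> D \<tau> p = (\<lambda>v. v)"
    "\<And>p t. p \<in> S \<Longrightarrow> t \<in> {a..b} \<Longrightarrow> (\<phi> t has_derivative D t p) (at p)"
    "\<And>p t v. p \<in> S \<Longrightarrow> t \<in> {a..b} \<Longrightarrow>
      ((\<lambda>s. D s p v) has_vector_derivative frechet_derivative (Y t) (at (\<phi> t p)) (D t p v)) (at t within {a..b})"
    by blast
  show ?thesis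
  proof (induction k)
    case 0
    then show ?case using cont by (auto simp: weight_bounded_def)
  next
    case (Suc k)
    show ?case
    proof (rule Ck_family_SucI[OF assms(2) _ D(2)])
      show "weight_bounded {} {a..b} S w \<phi>" using cont by (auto simp: weight_bounded_def)
      fix v :: 'a
      show "Ck_family k {} {a..b} S w (\<lambda>t p. D t p v)"
      proof (rule linear_family_Ck[OF assms(2) \<tau>, where A = "\<lambda>t p. frechet_derivative (Y t) (at (\<phi> t p))" and g = "\<lambda>_ _. 0" and j = k and k = k])
        show "linear (frechet_derivative (Y t) (at (\<phi> t p)))" if "t \<in> {a..b}" "p \<in> S" for t p
          by (rule has_derivative_linear[OF Ck_family_SucD(1)[OF Y that(1) inU[OF that(2,1)]]])
        show "Ck_family k {} {a..b} S w (\<lambda>t p. frechet_derivative (Y t) (at (\<phi> t p)) u)" for u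
          by (rule Ck_family_compose[OF assms(2) inU Ck_family_SucD(2)[OF Y] Suc.IH])
        show "Ck_family k {} {a..b} S w (\<lambda>_ _. 0)" by (rule Ck_family_zero[OF assms(2)])
        show "((\<lambda>s. D s p v) has_vector_derivative frechet_derivative (Y t) (at (\<phi> t p)) (D t p v) + 0) (at t within {a..b})"
          if "p \<in> S" "t \<in> {a..b}" for p t using D(3)[OF that] by simp
        show "D \<tau> p v = v" if "p \<in> S" for p using D(1)[OF that] by simp
      qed simp
    qed
  qed
qed

section \<open>Symbols\<close>

lemma jbracket_ge_1: "jbracket x \<ge> 1"
  by (simp add: jbracket_def)

lemma norm_le_jbracket: "norm x \<le> jbracket x"
  unfolding jbracket_def by (rule real_le_rsqrt) simp

lemma jbracket_le: "jbracket x \<le> 1 + norm x"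
  unfolding jbracket_def by (rule real_le_lsqrt) (auto simp: power2_eq_square algebra_simps)

section \<open>Symmetry of second derivatives and multi-index derivatives\<close>

text \<open>The mean value theorem is used twice, first along \<open>u\<close> for the difference in
  direction \<open>v\<close>, then along \<open>v\<close> for the derivative in direction
  \<open>u\<close>.\<close>

lemma second_difference_mean_value:
  fixes f :: "'a::euclidean_space \<Rightarrow> real"
  assumes "Ck_on 2 f UNIV" "h > 0"
  shows "\<exists>p. norm (p - x) \<le> h * (norm u + norm v) \<and>
     f (x + h *\<^sub>R u + h *\<^sub>R v) - f (x + h *\<^sub>R u) - (f (x + h *\<^sub>R v) - f x) =
       h * h * frechet_derivative (\<lambda>y. frechet_derivative f (at y) u) (at p) v"
proof -
  have d1: "(f has_derivative frechet_derivative f (at y)) (at y)"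
    and d2: "((\<lambda>y. frechet_derivative f (at y) u) has_derivative frechet_derivative (\<lambda>y. frechet_derivative f (at y) u) (at y)) (at y)" for y
    using assms(1) by (auto simp: numeral_2_eq_2 frechet_derivative_works[symmetric])
  have line: "((\<lambda>s. g (c + s *\<^sub>R w)) has_real_derivative g' (c + s *\<^sub>R w) w) (at s)"
    if "\<And>y. (g has_derivative g' y) (at y)" for g :: "'a \<Rightarrow> real" and g' c w s
  proof -
    have "((\<lambda>s. c + s *\<^sub>R w) has_derivative (\<lambda>d. d *\<^sub>R w)) (at s)" by (auto intro!: derivative_eq_intros)
    from diff_chain_at[OF this that] have "((\<lambda>s. g (c + s *\<^sub>R w)) has_derivative (\<lambda>d. g' (c + s *\<^sub>R w) (d *\<^sub>R w))) (at s)"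
      by (simp add: o_def)
    moreover have "(\<lambda>d. g' (c + s *\<^sub>R w) (d *\<^sub>R w)) = (*) (g' (c + s *\<^sub>R w) w)"
      using linear_scale[OF has_derivative_linear[OF that]] by (auto simp: mult.commute)
    ultimately show ?thesis by (simp add: has_field_derivative_def)
  qed
  let ?D = "\<lambda>y. frechet_derivative f (at y) u"
  let ?g = "\<lambda>s. f ((x + h *\<^sub>R v) + s *\<^sub>R u) - f (x + s *\<^sub>R u)"
  have "\<exists>s>0. s < h \<and> ?g h - ?g 0 = (h - 0) * (?D ((x + h *\<^sub>R v) + s *\<^sub>R u) - ?D (x + s *\<^sub>R u))"
    by (rule MVT2[OF assms(2)]) (intro DERIV_diff line[OF d1])
  then obtain s where s: "0 < s" "s < h" "?g h - ?g 0 = h * (?D ((x + h *\<^sub>R v) + s *\<^sub>R u) - ?D (x + s *\<^sub>R u))"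
    by auto
  have "\<exists>r>0. r < h \<and> ?D ((x + s *\<^sub>R u) + h *\<^sub>R v) - ?D ((x + s *\<^sub>R u) + 0 *\<^sub>R v) =
     (h - 0) * frechet_derivative ?D (at ((x + s *\<^sub>R u) + r *\<^sub>R v)) v"
    by (rule MVT2[OF assms(2)]) (intro line[OF d2])
  then obtain r where r: "0 < r" "r < h" "?D ((x + s *\<^sub>R u) + h *\<^sub>R v) - ?D (x + s *\<^sub>R u) =
     h * frechet_derivative ?D (at ((x + s *\<^sub>R u) + r *\<^sub>R v)) v" by auto
  have "norm (s *\<^sub>R u + r *\<^sub>R v) \<le> h * (norm u + norm v)"
    using s r by (simp add: distrib_left) (intro norm_triangle_mono; simp add: mult_right_mono)
  moreover have "(x + h *\<^sub>R v) + s *\<^sub>R u = (x + s *\<^sub>R u) + h *\<^sub>R v" "(x + h *\<^sub>R v) + h *\<^sub>R u = x + h *\<^sub>R u + h *\<^sub>R v" by (simp_all add: algebra_simps)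
  ultimately show ?thesis using s(3) r(3)
    by (intro exI[of _ "(x + s *\<^sub>R u) + r *\<^sub>R v"]) (simp add: algebra_simps)
qed

text \<open>The second difference is symmetric in \<open>u\<close> and \<open>v\<close>. It equals
  either mixed derivative at points that approach \<open>x\<close> with \<open>h\<close>, so
  continuity makes the two agree at \<open>x\<close>.\<close>

lemma second_derivative_symmetric:
  fixes f :: "'a::euclidean_space \<Rightarrow> real"
  assumes "Ck_on 2 f UNIV"
  shows "frechet_derivative (\<lambda>y. frechet_derivative f (at y) u) (at x) v =
    frechet_derivative (\<lambda>y. frechet_derivative f (at y) v) (at x) u" (is "?A u v x = ?A v u x")
proof (rule ccontr)
  assume ne: "?A u v x \<noteq> ?A v u x"
  define e where "e = \<bar>?A u v x - ?A v u x\<bar> / 2"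
  have e: "e > 0" using ne by (simp add: e_def)
  have c: "isCont (?A u v) x" for u v
    using assms by (simp add: numeral_2_eq_2 continuous_on_eq_continuous_at)
  obtain d1 where d1: "d1 > 0" "\<And>y. dist y x < d1 \<Longrightarrow> dist (?A u v y) (?A u v x) < e"
    using c[of u v] e unfolding continuous_at_eps_delta by (metis dist_commute)
  obtain d2 where d2: "d2 > 0" "\<And>y. dist y x < d2 \<Longrightarrow> dist (?A v u y) (?A v u x) < e"
    using c[of v u] e unfolding continuous_at_eps_delta by (metis dist_commute)
  \<comment> \<open>The summand 1 keeps the denominator positive and makes the displacement strictly
    smaller than both continuity radii.\<close>
  define h where "h = min d1 d2 / (norm u + norm v + 1)"
  have h: "h > 0" using d1(1) d2(1) by (simp add: h_def add_nonneg_pos)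
  have "h * (norm u + norm v + 1) = min d1 d2"
  proof -
    have "norm u + norm v + 1 > 0" by (simp add: add_nonneg_pos)
    then show ?thesis by (simp add: h_def)
  qed
  then have "h * (norm u + norm v) + h = min d1 d2" by (simp add: distrib_left)
  then have hs: "h * (norm u + norm v) < min d1 d2" "h * (norm v + norm u) < min d1 d2"
    using h unfolding add.commute[of "norm v" "norm u"] by linarith+
  obtain p where p: "norm (p - x) \<le> h * (norm u + norm v)"
     "f (x + h *\<^sub>R u + h *\<^sub>R v) - f (x + h *\<^sub>R u) - (f (x + h *\<^sub>R v) - f x) = h * h * ?A u v p"
    using second_difference_mean_value[OF assms h] by blast
  obtain q where q: "norm (q - x) \<le> h * (norm v + norm u)"
     "f (x + h *\<^sub>R v + h *\<^sub>R u) - f (x + h *\<^sub>R v) - (f (x + h *\<^sub>R u) - f x) = h * h * ?A v u q"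
    using second_difference_mean_value[OF assms h] by blast
  have "x + h *\<^sub>R u + h *\<^sub>R v = x + h *\<^sub>R v + h *\<^sub>R u" by simp
  then have "h * h * ?A u v p = h * h * ?A v u q" using p(2) q(2) by (simp add: algebra_simps)
  then have "?A u v p = ?A v u q" using h by simp
  moreover have "dist (?A u v p) (?A u v x) < e" using p(1) hs by (intro d1(2)) (simp add: dist_norm)
  moreover have "dist (?A v u q) (?A v u x) < e" using q(1) hs by (intro d2(2)) (simp add: dist_norm)
  ultimately show False unfolding e_def dist_real_def by (simp add: abs_if split: if_splits)
qed

lemma smooth_on_partial_deriv:
  "smooth_on f UNIV \<Longrightarrow> smooth_on (partial_deriv i f) UNIV"
  unfolding smooth_on_def partial_deriv_def[abs_def] by (metis Ck_on.simps(2))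

lemma partial_deriv_commute:
  "smooth_on f UNIV \<Longrightarrow> partial_deriv i (partial_deriv j f) = partial_deriv j (partial_deriv i f)"
  unfolding partial_deriv_def[abs_def] smooth_on_def by (metis second_derivative_symmetric)

lemma smooth_on_foldr_partial_deriv:
  "smooth_on f UNIV \<Longrightarrow> smooth_on (foldr partial_deriv is f) UNIV"
  by (induction "is") (auto intro: smooth_on_partial_deriv)

lemma foldr_partial_deriv_move:
  "smooth_on f UNIV \<Longrightarrow> foldr partial_deriv (is @ i # js) f = foldr partial_deriv (i # is @ js) f"
proof (induction "is")
  case (Cons j "is")
  then show ?case using partial_deriv_commute[OF smooth_on_foldr_partial_deriv, of f j i "is @ js"] by simp
qed simp

lemma foldr_partial_deriv_permute:
  assumes "smooth_on f UNIV" "mset is = mset js"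
  shows "foldr partial_deriv is f = foldr partial_deriv js f"
  using assms(2)
proof (induction "is" arbitrary: js)
  case (Cons i "is")
  then have "i \<in> set js" by (metis list.set_intros(1) mset_eq_setD)
  then obtain us vs where js: "js = us @ i # vs" by (meson split_list)
  then have "mset is = mset (us @ vs)" using Cons.prems by simp
  then have "foldr partial_deriv is f = foldr partial_deriv (us @ vs) f" by (rule Cons.IH)
  then have "foldr partial_deriv (i # is) f = foldr partial_deriv (i # us @ vs) f" by simp
  then show ?case using foldr_partial_deriv_move[OF assms(1), of us i vs] unfolding js by (rule trans[OF _ sym])
qed simp

text \<open>\<open>multi_deriv\<close> works with an unspecified list having the prescribed counts.
  Since partial derivatives commute, every list with these counts gives the same function.\<close>

lemma foldr_partial_deriv_eq_multi_deriv:
  assumes "smooth_on f UNIV"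
  shows "foldr partial_deriv is f = multi_deriv (count_list is) f"
proof -
  have "\<forall>i. count_list (SOME js. \<forall>i. count_list js i = count_list is i) i = count_list is i"
    by (rule someI[of _ "is"]) simp
  then have "mset (SOME js. \<forall>i. count_list js i = count_list is i) = mset is"
    by (simp add: multiset_eq_iff count_mset)
  then show ?thesis unfolding multi_deriv_def using foldr_partial_deriv_permute[OF assms] by metis
qed

lemma mi_order_count_list: "mi_order (count_list is) = length is"
  unfolding mi_order_def by (rule sum_count_set) auto

section \<open>Symbol classes in the position variable\<close>

text \<open>The symbol class of order \<open>m\<close>, truncated at \<open>k\<close> derivatives:
  each differentiation lowers the order by one.\<close>

primrec symbol :: "nat \<Rightarrow> real \<Rightarrow> (real^'n \<Rightarrow> real) \<Rightarrow> bool" where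
  "symbol 0 m b \<longleftrightarrow> continuous_on UNIV b \<and> (\<exists>C. \<forall>x. \<bar>b x\<bar> \<le> C * jbracket x powr m)"
| "symbol (Suc k) m b \<longleftrightarrow> (continuous_on UNIV b \<and> (\<exists>C. \<forall>x. \<bar>b x\<bar> \<le> C * jbracket x powr m)) \<and> (\<forall>x. b differentiable (at x)) \<and>
     (\<forall>v. symbol k (m - 1) (\<lambda>x. frechet_derivative b (at x) v))"

lemma symbol_0D: "symbol k m b \<Longrightarrow> symbol 0 m b"
  by (cases k) auto

lemma symbol_SucD:
  assumes "symbol (Suc k) m b"
  shows "(b has_derivative frechet_derivative b (at x)) (at x)" "symbol k (m - 1) (\<lambda>x. frechet_derivative b (at x) v)"
  using assms frechet_derivative_works by auto

lemma symbol_Suc_imp: "symbol (Suc k) m b \<Longrightarrow> symbol k m b"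
  by (induction k arbitrary: m b) auto

lemma symbol_add:
  fixes b c :: "real^'n \<Rightarrow> real"
  shows "symbol k m b \<Longrightarrow> symbol k m c \<Longrightarrow> symbol k m (\<lambda>x. b x + c x)"
proof (induction k arbitrary: m b c)
  have base: "symbol 0 m (\<lambda>x. b x + c x)" if "symbol 0 m b" "symbol 0 m c" for m and b c :: "real^'n \<Rightarrow> real"
  proof -
    obtain B C where "\<forall>x. \<bar>b x\<bar> \<le> B * jbracket x powr m" "\<forall>x. \<bar>c x\<bar> \<le> C * jbracket x powr m" using \<open>symbol 0 m b\<close> \<open>symbol 0 m c\<close> by auto
    then have "\<bar>b x + c x\<bar> \<le> (B + C) * jbracket x powr m" for x
      unfolding distrib_right by (intro order_trans[OF abs_triangle_ineq] add_mono) auto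
    moreover have "continuous_on UNIV (\<lambda>x. b x + c x)" using that by (intro continuous_on_add) auto
    ultimately show ?thesis by auto
  qed
  {
    case 0 then show ?case by (rule base)
  next
    case (Suc k)
    have "frechet_derivative (\<lambda>x. b x + c x) (at x) = (\<lambda>v. frechet_derivative b (at x) v + frechet_derivative c (at x) v)" for x
      using has_derivative_add[OF symbol_SucD(1)[OF Suc.prems(1)] symbol_SucD(1)[OF Suc.prems(2)]]
      by (rule frechet_derivative_at[symmetric])
    then show ?case
      using Suc base[OF symbol_0D[OF Suc.prems(1)] symbol_0D[OF Suc.prems(2)]] by (auto intro: differentiable_add)
  }
qed

lemma symbol_cmult:
  fixes b :: "real^'n \<Rightarrow> real"
  shows "symbol k m b \<Longrightarrow> symbol k m (\<lambda>x. r * b x)"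
proof (induction k arbitrary: m b)
  have base: "symbol 0 m (\<lambda>x. r * b x)" if "symbol 0 m b" for m and b :: "real^'n \<Rightarrow> real"
  proof -
    obtain B where "\<forall>x. \<bar>b x\<bar> \<le> B * jbracket x powr m" using \<open>symbol 0 m b\<close> by auto
    then have "\<bar>r * b x\<bar> \<le> (\<bar>r\<bar> * B) * jbracket x powr m" for x
      unfolding abs_mult mult.assoc by (intro mult_left_mono) auto
    moreover have "continuous_on UNIV (\<lambda>x. r * b x)" using that by (intro continuous_on_mult continuous_on_const) auto
    ultimately show ?thesis by auto
  qed
  {
    case 0 then show ?case by (rule base)
  next
    case (Suc k)
    have "frechet_derivative (\<lambda>x. r * b x) (at x) = (\<lambda>v. r * frechet_derivative b (at x) v)" for x
      using has_derivative_mult_right[OF symbol_SucD(1)[OF Suc.prems(1)]]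
      by (rule frechet_derivative_at[symmetric])
    then show ?case using Suc base[OF symbol_0D[OF Suc.prems(1)]] by auto
  }
qed

lemma symbol_sum: "finite I \<Longrightarrow> (\<And>i. i \<in> I \<Longrightarrow> symbol k m (b i)) \<Longrightarrow> symbol k m (\<lambda>x. \<Sum>i\<in>I. b i x)"
proof (induction I rule: finite_induct)
  case empty
  have "symbol k m (\<lambda>x. 0)" by (induction k arbitrary: m) (auto intro!: exI[of _ 0])
  then show ?case by simp
qed (auto intro: symbol_add)

lemma frechet_derivative_partial:
  fixes b :: "real^'n \<Rightarrow> real"
  assumes "b differentiable (at x)"
  shows "frechet_derivative b (at x) v = (\<Sum>i\<in>UNIV. v $ i * partial_deriv i b x)"
proof -
  have lin: "linear (frechet_derivative b (at x))" by (rule linear_frechet_derivative[OF assms])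
  have "frechet_derivative b (at x) v = frechet_derivative b (at x) (\<Sum>i\<in>UNIV. v $ i *\<^sub>R axis i 1)"
    using basis_expansion[of v] by (simp add: scalar_mult_eq_scaleR)
  also have "\<dots> = (\<Sum>i\<in>UNIV. v $ i * partial_deriv i b x)"
    by (simp add: linear_sum[OF lin] linear_scale[OF lin] partial_deriv_def)
  finally show ?thesis .
qed

lemma symbolI:
  fixes b :: "real^'n \<Rightarrow> real"
  assumes "smooth_on b UNIV"
    and "\<And>is. \<exists>C. \<forall>x. \<bar>foldr partial_deriv is b x\<bar> \<le> C * jbracket x powr (m - real (length is))"
  shows "symbol k m b"
  using assms
proof (induction k arbitrary: m b)
  have base: "symbol 0 m b" if "smooth_on b UNIV"
    "\<And>is. \<exists>C. \<forall>x. \<bar>foldr partial_deriv is b x\<bar> \<le> C * jbracket x powr (m - real (length is))" for m and b :: "real^'n \<Rightarrow> real"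
    using that(1)[unfolded smooth_on_def, rule_format, of 0] that(2)[of "[]"] by simp
  {
    case 0 then show ?case using base[OF 0] by blast
  next
    case (Suc k)
    have diff: "b differentiable (at x)" for x
      using Suc.prems(1)[unfolded smooth_on_def, rule_format, of 1] by simp
    have "symbol k (m - 1) (partial_deriv i b)" for i
    proof (rule Suc.IH[OF smooth_on_partial_deriv[OF Suc.prems(1)]])
      fix "is" :: "'n list"
      \<comment> \<open>\<open>foldr\<close> applies the last entry of the list first, so an
        innermost derivative is appended at the end.\<close>
      show "\<exists>C. \<forall>x. \<bar>foldr partial_deriv is (partial_deriv i b) x\<bar> \<le> C * jbracket x powr (m - 1 - real (length is))"
        using Suc.prems(2)[of "is @ [i]"] by (simp add: algebra_simps)
    qed
    then have "symbol k (m - 1) (\<lambda>x. \<Sum>i\<in>UNIV. v $ i * partial_deriv i b x)" for v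
      by (intro symbol_sum symbol_cmult) auto
    then show ?case using base[OF Suc.prems] diff by (simp add: frechet_derivative_partial[OF diff])
  }
qed

lemma symbol_multi_deriv:
  fixes b :: "real^'n \<Rightarrow> real"
  assumes "smooth_on b UNIV"
    and "\<And>\<alpha>. \<exists>C. \<forall>x. \<bar>multi_deriv \<alpha> b x\<bar> \<le> C * jbracket x powr (m - real (mi_order \<alpha>))"
  shows "symbol k m b"
proof (rule symbolI[OF assms(1)])
  fix "is" :: "'n list"
  show "\<exists>C. \<forall>x. \<bar>foldr partial_deriv is b x\<bar> \<le> C * jbracket x powr (m - real (length is))"
    using assms(2)[of "count_list is"] by (simp add: mi_order_count_list foldr_partial_deriv_eq_multi_deriv[OF assms(1)])
qed

section \<open>Symbols evaluated along families of linear growth\<close>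

abbreviation tpow :: "real \<Rightarrow> real \<Rightarrow> real" where
  "tpow m \<equiv> \<lambda>t. (1 + t) powr m"

lemma Ck_family_tpow_mono:
  assumes "Ck_family k \<K> {0..} S (tpow m) f" "m \<le> m'"
  shows "Ck_family k \<K> {0..} S (tpow m') f"
  by (rule Ck_family_mono_weight[OF assms(1), where c = 1]) (use assms(2) in \<open>auto intro: powr_mono\<close>)

lemma Ck_family_tpow_bilinear:
  fixes f :: "real \<Rightarrow> 'a::euclidean_space \<Rightarrow> 'b::real_normed_vector" and g :: "real \<Rightarrow> 'a \<Rightarrow> 'c::real_normed_vector"
    and prod :: "'b \<Rightarrow> 'c \<Rightarrow> 'd::real_normed_vector"
  assumes "open S" "bounded_bilinear prod" "Ck_family k \<K> {0..} S (tpow m) f" "Ck_family k \<K> {0..} S (tpow m') g"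
    "m + m' \<le> m''"
  shows "Ck_family k \<K> {0..} S (tpow m'') (\<lambda>t x. prod (f t x) (g t x))"
proof -
  have "Ck_family k \<K> {0..} S (\<lambda>t. tpow m t * tpow m' t) (\<lambda>t x. prod (f t x) (g t x))"
    by (rule Ck_family_bilinear[OF assms(1-4)])
  then have "Ck_family k \<K> {0..} S (tpow (m + m')) (\<lambda>t x. prod (f t x) (g t x))"
    by (simp add: powr_add)
  then show ?thesis using assms(5) by (rule Ck_family_tpow_mono)
qed

lemmas Ck_family_tpow_scaleR = Ck_family_tpow_bilinear[OF _ bounded_bilinear_scaleR]
lemmas Ck_family_tpow_mult = Ck_family_tpow_bilinear[OF _ bounded_bilinear_mult]

text \<open>The exponent may have either sign. Adding the powers of both constants spares the case
  distinction where the bound is used.\<close>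

lemma powr_comparable:
  fixes y u :: real
  assumes "0 < c" "0 < C" "0 < u" "c * u \<le> y" "y \<le> C * u"
  shows "y powr m \<le> (c powr m + C powr m) * u powr m"
proof (cases "m \<ge> 0")
  case True
  have "y powr m \<le> (C * u) powr m" using assms True by (intro powr_mono2) (auto intro: order_trans[OF _ assms(4)] less_imp_le)
  also have "\<dots> = C powr m * u powr m" using assms by (simp add: powr_mult)
  finally show ?thesis by (simp add: distrib_right add_increasing)
next
  case False
  have "y powr m \<le> (c * u) powr m" using assms False by (intro powr_mono2') auto
  also have "\<dots> = c powr m * u powr m" using assms by (simp add: powr_mult)
  finally show ?thesis by (simp add: distrib_right add_increasing2)
qed

lemma symbol_compose_bound:
  assumes "symbol k m b"
    and "\<And>K. K \<in> \<K> \<Longrightarrow> \<exists>c>0. \<exists>C>0. \<forall>t\<ge>0. \<forall>z\<in>S. (t, z) \<in> K \<longrightarrow> c * (1 + t) \<le> jbracket (x t z) \<and> jbracket (x t z) \<le> C * (1 + t)"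
    and cx: "continuous_on ({0..} \<times> S) (\<lambda>(t, z). x t z)"
  shows "weight_bounded \<K> {0..} S (tpow m) (\<lambda>t z. b (x t z))"
  unfolding weight_bounded_def
proof (intro conjI ballI)
  have s0: "continuous_on UNIV b" "\<exists>C. \<forall>x. \<bar>b x\<bar> \<le> C * jbracket x powr m" using symbol_0D[OF assms(1)] by auto
  show "continuous_on ({0..} \<times> S) (\<lambda>(t, z). b (x t z))"
    using continuous_on_compose2[OF s0(1) cx] by (simp add: split_beta)
  fix K assume "K \<in> \<K>"
  then obtain c C where c: "c > 0" "C > 0" "\<And>t z. t \<ge> 0 \<Longrightarrow> z \<in> S \<Longrightarrow> (t, z) \<in> K \<Longrightarrow> c * (1 + t) \<le> jbracket (x t z) \<and> jbracket (x t z) \<le> C * (1 + t)"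
    using assms(2) by meson
  obtain B where B: "\<And>x. \<bar>b x\<bar> \<le> B * jbracket x powr m" using s0(2) by auto
  have "norm (b (x t z)) \<le> (\<bar>B\<bar> * (c powr m + C powr m)) * tpow m t" if "t \<ge> 0" "z \<in> S" "(t, z) \<in> K" for t z
  proof -
    have "norm (b (x t z)) \<le> \<bar>B\<bar> * jbracket (x t z) powr m" using B[of "x t z"]
      by (metis abs_ge_self mult_right_mono order_trans powr_ge_zero real_norm_def)
    also have "\<dots> \<le> \<bar>B\<bar> * ((c powr m + C powr m) * tpow m t)"
      using c(3)[OF that] c(1,2) that(1) by (intro mult_left_mono powr_comparable) auto
    finally show ?thesis by (simp add: mult.assoc)
  qed
  then show "\<exists>C. \<forall>t\<in>{0..}. \<forall>z\<in>S. (t, z) \<in> K \<longrightarrow> norm (b (x t z)) \<le> C * tpow m t" by auto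
qed

text \<open>A derivative in \<open>z\<close> costs a factor \<open>tpow 1\<close> from the inner
  family and lowers the order of \<open>b\<close> by one, so the weight \<open>tpow m\<close> is
  unchanged. For this the bracket has to be comparable with \<open>1 + t\<close> on each
  region.\<close>

lemma symbol_compose:
  assumes "open S" "symbol k m b" and x: "Ck_family k \<K> {0..} S (tpow 1) x"
    and bd: "\<And>K. K \<in> \<K> \<Longrightarrow> \<exists>c>0. \<exists>C>0. \<forall>t\<ge>0. \<forall>z\<in>S. (t, z) \<in> K \<longrightarrow> c * (1 + t) \<le> jbracket (x t z) \<and> jbracket (x t z) \<le> C * (1 + t)"
  shows "Ck_family k \<K> {0..} S (tpow m) (\<lambda>t z. b (x t z))"
  using assms(2) x
proof (induction k arbitrary: m b)
  case 0
  then show ?case using symbol_compose_bound[OF 0(1) bd Ck_family_cont[OF 0(2)]] by simp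
next
  case (Suc k)
  note bD = symbol_SucD[OF Suc.prems(1)] and xD = Ck_family_SucD[OF Suc.prems(2)]
  have "Ck_family k \<K> {0..} S (tpow m) (\<lambda>t z. \<Sum>e\<in>Basis. (frechet_derivative (x t) (at z) v \<bullet> e) *\<^sub>R frechet_derivative b (at (x t z)) e)" for v
    by (intro Ck_family_sum[OF assms(1)] Ck_family_tpow_scaleR[OF assms(1), where m = 1 and m' = "m - 1"] Suc.IH bD(2)
        Ck_family_Suc_imp[OF Suc.prems(2)] Ck_family_linear[OF assms(1) bounded_linear_inner_left xD(2)]) simp
  then have "Ck_family k \<K> {0..} S (tpow m) (\<lambda>t z. frechet_derivative b (at (x t z)) (frechet_derivative (x t) (at z) v))" for v
    by (subst Ck_family_cong[OF assms(1) linear_Basis_sum[OF has_derivative_linear[OF bD(1)]]]) auto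
  moreover have "((\<lambda>z. b (x t z)) has_derivative
      (\<lambda>v. frechet_derivative b (at (x t z)) (frechet_derivative (x t) (at z) v))) (at z)" if "t \<in> {0..}" "z \<in> S" for t z
    using diff_chain_at[OF xD(1)[OF that] bD(1)] by (simp add: o_def)
  ultimately show ?case
    by (intro Ck_family_SucI[OF assms(1) symbol_compose_bound[OF Suc.prems(1) bd Ck_family_cont[OF Suc.prems(2)]]])
qed

text \<open>By the mean value inequality the difference is a derivative of \<open>b\<close>, of
  order \<open>m - 1\<close>, times a displacement of order \<open>r\<close>. The intermediate point
  is unknown, hence the bracket bounds along the whole segment; and one derivative of
  \<open>b\<close> is spent, hence \<open>Suc k\<close>.\<close>

lemma symbol_difference:
  fixes b :: "real^'n \<Rightarrow> real" and x1 x2 :: "real \<Rightarrow> 'a::euclidean_space \<Rightarrow> real^'n"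
  assumes "open S" "symbol (Suc k) m b" and x1: "Ck_family k \<K> {0..} S (tpow 1) x1" and x2: "Ck_family k \<K> {0..} S (tpow 1) x2"
    and diff: "Ck_family k \<K> {0..} S (tpow r) (\<lambda>t z. x1 t z - x2 t z)"
    and bd: "\<And>K. K \<in> \<K> \<Longrightarrow> \<exists>c>0. \<exists>C>0. \<forall>t\<ge>0. \<forall>z\<in>S. (t, z) \<in> K \<longrightarrow>
       (\<forall>p\<in>closed_segment (x2 t z) (x1 t z). c * (1 + t) \<le> jbracket p \<and> jbracket p \<le> C * (1 + t))"
  shows "Ck_family k \<K> {0..} S (tpow (m - 1 + r)) (\<lambda>t z. b (x1 t z) - b (x2 t z))"
  using assms(2) x1 x2 diff
proof (induction k arbitrary: m b)
  have bd1: "\<exists>c>0. \<exists>C>0. \<forall>t\<ge>0. \<forall>z\<in>S. (t, z) \<in> K \<longrightarrow> c * (1 + t) \<le> jbracket (x1 t z) \<and> jbracket (x1 t z) \<le> C * (1 + t)"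
    and bd2: "\<exists>c>0. \<exists>C>0. \<forall>t\<ge>0. \<forall>z\<in>S. (t, z) \<in> K \<longrightarrow> c * (1 + t) \<le> jbracket (x2 t z) \<and> jbracket (x2 t z) \<le> C * (1 + t)"
    if "K \<in> \<K>" for K
    using bd[OF that] by (meson ends_in_segment)+
  have base: "weight_bounded \<K> {0..} S (tpow (m - 1 + r)) (\<lambda>t z. b (x1 t z) - b (x2 t z))"
    if b: "symbol (Suc k) m b" for m b k
    unfolding weight_bounded_def
  proof (intro conjI ballI)
    note bD = symbol_SucD[OF b]
    have cb: "continuous_on UNIV b" using symbol_0D[OF b] by simp
    show "continuous_on ({0..} \<times> S) (\<lambda>(t, z). b (x1 t z) - b (x2 t z))"
      using continuous_on_diff[OF continuous_on_compose2[OF cb Ck_family_cont[OF x1]] continuous_on_compose2[OF cb Ck_family_cont[OF x2]]]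
      by (simp add: split_beta)
    have "\<exists>C. \<forall>p. \<bar>frechet_derivative b (at p) e\<bar> \<le> C * jbracket p powr (m - 1)" for e
      using symbol_0D[OF bD(2), of e] by simp
    then obtain B where B: "\<And>e p. \<bar>frechet_derivative b (at p) e\<bar> \<le> B e * jbracket p powr (m - 1)" by metis
    define B1 where "B1 = \<bar>\<Sum>e\<in>Basis. B e\<bar>"
    have dB: "norm (frechet_derivative b (at p) u) \<le> (B1 * jbracket p powr (m - 1)) * norm u" for p u
    proof -
      have "norm (frechet_derivative b (at p) u) \<le> (\<Sum>e\<in>Basis. B e * jbracket p powr (m - 1)) * norm u"
        by (rule norm_linear_le_Basis[OF has_derivative_linear[OF bD(1)]]) (use B in auto)
      also have "\<dots> = (\<Sum>e\<in>Basis. B e) * (jbracket p powr (m - 1) * norm u)"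
        by (simp add: sum_distrib_right[symmetric])
      also have "\<dots> \<le> B1 * (jbracket p powr (m - 1) * norm u)" unfolding B1_def by (intro mult_right_mono) auto
      finally show ?thesis by (simp add: mult.assoc)
    qed
    fix K assume K: "K \<in> \<K>"
    obtain c C where c: "c > 0" "C > 0" "\<And>t z p. t \<ge> 0 \<Longrightarrow> z \<in> S \<Longrightarrow> (t, z) \<in> K \<Longrightarrow> p \<in> closed_segment (x2 t z) (x1 t z) \<Longrightarrow>
        c * (1 + t) \<le> jbracket p \<and> jbracket p \<le> C * (1 + t)"
      using bd[OF K] by meson
    obtain E where E: "\<forall>t\<in>{0..}. \<forall>z\<in>S. (t, z) \<in> K \<longrightarrow> norm (x1 t z - x2 t z) \<le> E * tpow r t"
      using Ck_family_weight_bounded[OF diff] K unfolding weight_bounded_def by meson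
    define M where "M = c powr (m - 1) + C powr (m - 1)"
    have "norm (b (x1 t z) - b (x2 t z)) \<le> (B1 * M * E) * tpow (m - 1 + r) t" if "t \<in> {0..}" "z \<in> S" "(t, z) \<in> K" for t z
    proof -
      have "norm (b (x1 t z) - b (x2 t z)) \<le> (B1 * (M * tpow (m - 1) t)) * norm (x1 t z - x2 t z)"
      proof (rule differentiable_bound[where S = "closed_segment (x2 t z) (x1 t z)" and f = b and f' = "\<lambda>p. frechet_derivative b (at p)"])
        fix p assume p: "p \<in> closed_segment (x2 t z) (x1 t z)"
        show "(b has_derivative frechet_derivative b (at p)) (at p within closed_segment (x2 t z) (x1 t z))"
          by (rule has_derivative_at_withinI[OF bD(1)])
        have "B1 * jbracket p powr (m - 1) \<le> B1 * (M * tpow (m - 1) t)"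
          unfolding M_def using c(3)[OF _ that(2,3) p] c(1,2) that(1)
          by (intro mult_left_mono powr_comparable) (auto simp: B1_def)
        then show "onorm (frechet_derivative b (at p)) \<le> B1 * (M * tpow (m - 1) t)"
          by (intro onorm_le order_trans[OF dB]) (auto intro: mult_right_mono)
      qed auto
      also have "\<dots> \<le> (B1 * (M * tpow (m - 1) t)) * (E * tpow r t)"
        using E that by (intro mult_left_mono) (auto simp: B1_def M_def)
      also have "\<dots> = (B1 * M * E) * (tpow (m - 1) t * tpow r t)" by simp
      also have "tpow (m - 1) t * tpow r t = tpow (m - 1 + r) t" by (rule powr_add[symmetric])
      finally show ?thesis .
    qed
    then show "\<exists>C. \<forall>t\<in>{0..}. \<forall>z\<in>S. (t, z) \<in> K \<longrightarrow> norm (b (x1 t z) - b (x2 t z)) \<le> C * tpow (m - 1 + r) t" by blast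
  qed
  {
    case 0
    then show ?case using base[OF 0(1)] by simp
  next
    case (Suc k)
    note bD = symbol_SucD[OF Suc.prems(1)] and x1D = Ck_family_SucD[OF Suc.prems(2)] and x2D = Ck_family_SucD[OF Suc.prems(3)]
    note rep = linear_Basis_sum[OF has_derivative_linear[OF bD(1)]]
    have dxd: "Ck_family k \<K> {0..} S (tpow r) (\<lambda>t z. frechet_derivative (x1 t) (at z) v - frechet_derivative (x2 t) (at z) v)" for v
    proof -
      have "frechet_derivative (\<lambda>z. x1 t z - x2 t z) (at z) = (\<lambda>v. frechet_derivative (x1 t) (at z) v - frechet_derivative (x2 t) (at z) v)"
        if "t \<in> {0..}" "z \<in> S" for t z
        using has_derivative_diff[OF x1D(1)[OF that] x2D(1)[OF that]] by (rule frechet_derivative_at[symmetric])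
      then show ?thesis using Ck_family_SucD(2)[OF Suc.prems(4), of v]
        by (subst (asm) Ck_family_cong[OF assms(1)]) auto
    qed
    \<comment> \<open>The difference of the two chain-rule terms is split: one part contains a
      difference of derivatives of \<open>b\<close>, the induction hypothesis at order
      \<open>m - 1\<close>; the other contains the difference of the inner derivatives, of order
      \<open>r\<close>.\<close>
    have "Ck_family k \<K> {0..} S (tpow (m - 1 + r)) (\<lambda>t z. \<Sum>e\<in>Basis.
        (frechet_derivative (x1 t) (at z) v \<bullet> e) *\<^sub>R (frechet_derivative b (at (x1 t z)) e - frechet_derivative b (at (x2 t z)) e) +
        ((frechet_derivative (x1 t) (at z) v - frechet_derivative (x2 t) (at z) v) \<bullet> e) *\<^sub>R frechet_derivative b (at (x2 t z)) e)" for v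
    proof (intro Ck_family_sum[OF assms(1)] Ck_family_add[OF assms(1)])
      fix e :: "real^'n"
      show "Ck_family k \<K> {0..} S (tpow (m - 1 + r)) (\<lambda>t z. (frechet_derivative (x1 t) (at z) v \<bullet> e) *\<^sub>R (frechet_derivative b (at (x1 t z)) e - frechet_derivative b (at (x2 t z)) e))"
        by (rule Ck_family_tpow_scaleR[OF assms(1) Ck_family_linear[OF assms(1) bounded_linear_inner_left x1D(2)] Suc.IH[OF bD(2)]])
          (rule Ck_family_Suc_imp[OF Suc.prems(2)] Ck_family_Suc_imp[OF Suc.prems(3)] Ck_family_Suc_imp[OF Suc.prems(4)] | simp)+
      show "Ck_family k \<K> {0..} S (tpow (m - 1 + r)) (\<lambda>t z. ((frechet_derivative (x1 t) (at z) v - frechet_derivative (x2 t) (at z) v) \<bullet> e) *\<^sub>R frechet_derivative b (at (x2 t z)) e)"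
        by (rule Ck_family_tpow_scaleR[OF assms(1) Ck_family_linear[OF assms(1) bounded_linear_inner_left dxd]
            symbol_compose[OF assms(1) symbol_Suc_imp[OF bD(2)] Ck_family_Suc_imp[OF Suc.prems(3)] bd2]]) auto
    qed
    moreover have "(\<Sum>e\<in>Basis. (u \<bullet> e) *\<^sub>R (frechet_derivative b (at p) e - frechet_derivative b (at q) e) +
        ((u - w) \<bullet> e) *\<^sub>R frechet_derivative b (at q) e) = frechet_derivative b (at p) u - frechet_derivative b (at q) w" for u w p q
      unfolding rep[of p u] rep[of q w] by (simp add: sum.distrib sum_subtractf algebra_simps)
    ultimately have "Ck_family k \<K> {0..} S (tpow (m - 1 + r)) (\<lambda>t z. frechet_derivative b (at (x1 t z)) (frechet_derivative (x1 t) (at z) v) -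
        frechet_derivative b (at (x2 t z)) (frechet_derivative (x2 t) (at z) v))" for v by simp
    moreover have "((\<lambda>z. b (x1 t z) - b (x2 t z)) has_derivative
        (\<lambda>v. frechet_derivative b (at (x1 t z)) (frechet_derivative (x1 t) (at z) v) -
          frechet_derivative b (at (x2 t z)) (frechet_derivative (x2 t) (at z) v))) (at z)" if "t \<in> {0..}" "z \<in> S" for t z
      using has_derivative_diff[OF diff_chain_at[OF x1D(1)[OF that] bD(1)] diff_chain_at[OF x2D(1)[OF that] bD(1)]] by (simp add: o_def)
    ultimately show ?case by (intro Ck_family_SucI[OF assms(1) base[OF Suc.prems(1)]])
  }
qed

section \<open>Families defined by time integrals\<close>

lemma weight_bounded_slice:
  assumes "weight_bounded \<K> {0..} S w f" "z \<in> S"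
  shows "continuous_on {0..t} (\<lambda>s. f s z)"
proof -
  have "continuous_on {0..t} (\<lambda>s. (s, z))" by (intro continuous_intros)
  from continuous_on_compose2[OF _ this, of "{0..} \<times> S" "\<lambda>(s, z). f s z"] show ?thesis
    using assms by (auto simp: weight_bounded_def image_subset_iff)
qed

lemma integral_family_has_derivative:
  fixes f :: "real \<Rightarrow> 'a::euclidean_space \<Rightarrow> 'b::euclidean_space"
  assumes "open S" and f: "Ck_family (Suc 0) {} {0..} S w f" and t: "t \<ge> 0" and z: "z \<in> S"
  shows "((\<lambda>z. integral {0..t} (\<lambda>s. f s z)) has_derivative (\<lambda>v. integral {0..t} (\<lambda>s. frechet_derivative (f s) (at z) v))) (at z)"
proof -
  note fD = Ck_family_SucD[OF f]
  note slice = weight_bounded_slice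
  note wb = Ck_family_weight_bounded[OF f]
  \<comment> \<open>\<open>leibniz_rule\<close> asks for a continuous operator-valued derivative; in
    finite dimension continuity in each basis direction suffices.\<close>
  define f' where "f' z s = Blinfun (frechet_derivative (f s) (at z))" for z s
  have f': "blinfun_apply (f' z s) = frechet_derivative (f s) (at z)" if "s \<ge> 0" "z \<in> S" for s z
    unfolding f'_def using fD(1) that by (intro bounded_linear_Blinfun_apply has_derivative_bounded_linear) auto
  obtain r where r: "r > 0" "ball z r \<subseteq> S" using assms(1) z openE by blast
  have cf': "continuous_on (ball z r \<times> cbox 0 t) (\<lambda>(z, s). f' z s)"
  proof (rule continuous_on_blinfun_componentwise)
    fix e :: 'a assume "e \<in> Basis"
    have "continuous_on (ball z r \<times> cbox 0 t) (\<lambda>p. (snd p, fst p))" by (intro continuous_intros)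
    from continuous_on_compose2[OF Ck_family_cont[OF fD(2)[of e]] this]
    have "continuous_on (ball z r \<times> cbox 0 t) (\<lambda>p. frechet_derivative (f (snd p)) (at (fst p)) e)"
      using r(2) by (auto simp: image_subset_iff split_beta)
    then show "continuous_on (ball z r \<times> cbox 0 t) (\<lambda>x. blinfun_apply (case x of (z, s) \<Rightarrow> f' z s) e)"
      by (rule continuous_on_eq) (use f' r(2) in auto)
  qed
  have "((\<lambda>z. integral (cbox 0 t) (\<lambda>s. f s z)) has_derivative integral (cbox 0 t) (f' z)) (at z within ball z r)"
  proof (rule leibniz_rule[OF _ _ cf'])
    fix y s assume y: "y \<in> ball z r" and s: "s \<in> cbox 0 t"
    then have "y \<in> S" "s \<ge> 0" using r by auto
    then show "((\<lambda>z. f s z) has_derivative blinfun_apply (f' y s)) (at y within ball z r)"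
      unfolding f'[OF \<open>s \<ge> 0\<close> \<open>y \<in> S\<close>] by (intro has_derivative_at_withinI[OF fD(1)]) auto
  next
    fix y assume "y \<in> ball z r"
    then show "(\<lambda>s. f s y) integrable_on cbox 0 t"
      using integrable_continuous_interval[OF slice[OF wb, of y t]] r by auto
  qed (use r in auto)
  moreover have "at z within ball z r = at z" using r(1) by (intro at_within_open) auto
  moreover have "blinfun_apply (integral (cbox 0 t) (f' z)) = (\<lambda>v. integral {0..t} (\<lambda>s. frechet_derivative (f s) (at z) v))"
  proof
    fix v
    have "continuous_on (cbox 0 t) (\<lambda>s. (z, s))" by (intro continuous_intros)
    from continuous_on_compose2[OF cf' this] have "continuous_on (cbox 0 t) (f' z)" using r(1) by (auto simp: image_subset_iff)
    then have "f' z integrable_on cbox 0 t" by (rule integrable_continuous)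
    from integral_linear[OF this blinfun.bounded_linear_left[of v]]
    have "blinfun_apply (integral (cbox 0 t) (f' z)) v = integral (cbox 0 t) (\<lambda>s. blinfun_apply (f' z s) v)" by (simp add: o_def)
    also have "\<dots> = integral {0..t} (\<lambda>s. frechet_derivative (f s) (at z) v)"
      by (simp only: box_real, rule integral_cong) (use f' z in auto)
    finally show "blinfun_apply (integral (cbox 0 t) (f' z)) v = integral {0..t} (\<lambda>s. frechet_derivative (f s) (at z) v)" .
  qed
  ultimately show ?thesis by (simp only: box_real)
qed

text \<open>The integral up to \<open>t\<close> looks at all earlier times, so the regions have to
  be closed under decreasing \<open>t\<close>; this is \<open>down\<close>.\<close>

lemma Ck_family_integral:
  fixes f :: "real \<Rightarrow> 'a::euclidean_space \<Rightarrow> 'b::euclidean_space"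
  assumes "open S" and f: "Ck_family k \<K> {0..} S w f"
    and down: "\<And>K t s z. K \<in> \<K> \<Longrightarrow> (t, z) \<in> K \<Longrightarrow> 0 \<le> s \<Longrightarrow> s \<le> t \<Longrightarrow> (s, z) \<in> K"
    and w: "\<And>t. t \<ge> 0 \<Longrightarrow> 0 \<le> w t" "\<And>t. t \<ge> 0 \<Longrightarrow> w integrable_on {0..t}" "\<And>t. t \<ge> 0 \<Longrightarrow> integral {0..t} w \<le> u t"
  shows "Ck_family k \<K> {0..} S u (\<lambda>t z. integral {0..t} (\<lambda>s. f s z))"
  using f
proof (induction k arbitrary: f)
  note slice = weight_bounded_slice
  have base: "weight_bounded \<K> {0..} S u (\<lambda>t z. integral {0..t} (\<lambda>s. f s z))"
    if wb: "weight_bounded \<K> {0..} S w f" for f :: "real \<Rightarrow> 'a \<Rightarrow> 'b"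
    unfolding weight_bounded_def
  proof (intro conjI ballI)
    note cf = wb[unfolded weight_bounded_def, THEN conjunct1]
    \<comment> \<open>Rescaling to the fixed interval from 0 to 1 turns the variable end point into
      a parameter, so that joint continuity follows from continuity under the integral.\<close>
    have scale: "integral {0..t} (\<lambda>s. f s z) = t *\<^sub>R integral (cbox 0 1) (\<lambda>\<theta>. f (\<theta> * t) z)" if "t \<ge> 0" "z \<in> S" for t z
    proof (cases "t = 0")
      case False
      then have "t > 0" using that by simp
      have "((\<lambda>s. f s z) has_integral integral {0..t} (\<lambda>s. f s z)) (cbox 0 t)"
        using integrable_continuous_interval[OF slice[OF wb that(2), of t]] by (simp add: has_integral_integral)
      from has_integral_affinity'[OF this \<open>t > 0\<close>, of 0]
      have "((\<lambda>\<theta>. f (\<theta> * t) z) has_integral (1 / t) *\<^sub>R integral {0..t} (\<lambda>s. f s z)) (cbox 0 1)"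
        using \<open>t > 0\<close> by (simp add: mult.commute divide_inverse)
      then show ?thesis using False by (simp add: integral_unique)
    qed simp
    have "continuous_on ((({0..} :: real set) \<times> S) \<times> cbox 0 (1::real)) (\<lambda>q. (snd q * fst (fst q), snd (fst q)))" by (intro continuous_intros)
    from continuous_on_compose2[OF cf this]
    have "continuous_on (({0..} \<times> S) \<times> cbox 0 1) (\<lambda>(p, \<theta>). f (\<theta> * fst p) (snd p))" by (auto simp: split_beta image_subset_iff)
    from integral_continuous_on_param[OF this]
    have "continuous_on ({0..} \<times> S) (\<lambda>p. fst p *\<^sub>R integral (cbox 0 1) (\<lambda>\<theta>. f (\<theta> * fst p) (snd p)))"
      by (intro continuous_intros)
    then show "continuous_on ({0..} \<times> S) (\<lambda>(t, z). integral {0..t} (\<lambda>s. f s z))"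
      by (rule continuous_on_eq) (auto simp: scale)
    fix K assume K: "K \<in> \<K>"
    then obtain C where C: "\<forall>t\<in>{0..}. \<forall>z\<in>S. (t, z) \<in> K \<longrightarrow> norm (f t z) \<le> C * w t"
      using wb unfolding weight_bounded_def by meson
    have "norm (integral {0..t} (\<lambda>s. f s z)) \<le> \<bar>C\<bar> * u t" if "t \<in> {0..}" "z \<in> S" "(t, z) \<in> K" for t z
    proof -
      have "norm (integral {0..t} (\<lambda>s. f s z)) \<le> integral {0..t} (\<lambda>s. \<bar>C\<bar> * w s)"
      proof (rule integral_norm_bound_integral)
        show "(\<lambda>s. f s z) integrable_on {0..t}" by (rule integrable_continuous_interval[OF slice[OF wb that(2)]])
        show "(\<lambda>s. \<bar>C\<bar> * w s) integrable_on {0..t}" using w(2)[of t] that by (intro integrable_on_mult_right) auto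
        fix s assume s: "s \<in> {0..t}"
        have "norm (f s z) \<le> C * w s" using C s that(2) down[OF K that(3)] by auto
        also have "\<dots> \<le> \<bar>C\<bar> * w s" using w(1)[of s] s by (intro mult_right_mono) auto
        finally show "norm (f s z) \<le> \<bar>C\<bar> * w s" .
      qed
      also have "\<dots> = \<bar>C\<bar> * integral {0..t} w" by simp
      also have "\<dots> \<le> \<bar>C\<bar> * u t" using w(3)[of t] that by (intro mult_left_mono) auto
      finally show ?thesis .
    qed
    then show "\<exists>C. \<forall>t\<in>{0..}. \<forall>z\<in>S. (t, z) \<in> K \<longrightarrow> norm (integral {0..t} (\<lambda>s. f s z)) \<le> C * u t" by blast
  qed
  {
    case 0
    then show ?case using base by simp
  next
    case (Suc k)
    note fD = Ck_family_SucD[OF Suc.prems]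
    note wb = Ck_family_weight_bounded[OF Suc.prems]
    have "Ck_family (Suc 0) {} {0..} S w f"
      by (rule Ck_family_ignore[OF Ck_family_le[OF Suc.prems]]) simp
    note der = integral_family_has_derivative[OF assms(1) this]
    show ?case
      by (rule Ck_family_SucI[OF assms(1) base[OF wb], where f' = "\<lambda>t z v. integral {0..t} (\<lambda>s. frechet_derivative (f s) (at z) v)"])
        (use der Suc.IH[OF fD(2)] in auto)
  }
qed

text \<open>Differentiation only lowers the order, so every derivative of a symbol of order at most
  0 is bounded.\<close>

lemma symbol_bounded_Ck_family:
  fixes b :: "real^'n \<Rightarrow> real"
  assumes "symbol k m b" "m \<le> 0"
  shows "Ck_family k \<K> T UNIV (\<lambda>_. 1) (\<lambda>t. b)"
  using assms
proof (induction k arbitrary: m b)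
  have base: "weight_bounded \<K> T UNIV (\<lambda>_. 1) (\<lambda>t. b)" if "symbol k m b" "m \<le> 0" for k m and b :: "real^'n \<Rightarrow> real"
  proof -
    have c: "continuous_on UNIV b" and "\<exists>C. \<forall>x. \<bar>b x\<bar> \<le> C * jbracket x powr m" using symbol_0D[OF that(1)] by auto
    then obtain C where C: "\<And>x. \<bar>b x\<bar> \<le> C * jbracket x powr m" by auto
    have "\<bar>b x\<bar> \<le> \<bar>C\<bar> * 1" for x
    proof -
      have "\<bar>b x\<bar> \<le> \<bar>C\<bar> * jbracket x powr m" using C[of x] by (meson abs_ge_self mult_right_mono order_trans powr_ge_zero)
      also have "\<dots> \<le> \<bar>C\<bar> * 1"
        using powr_mono[OF that(2) jbracket_ge_1[of x]] jbracket_ge_1[of x] by (intro mult_left_mono) auto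
      finally show ?thesis .
    qed
    moreover have "continuous_on (T \<times> UNIV) (\<lambda>(t, x). b x)"
      using continuous_on_compose2[OF c continuous_on_snd[OF continuous_on_id]] by (simp add: split_beta)
    ultimately show ?thesis unfolding weight_bounded_def by auto
  qed
  {
    case 0 then show ?case using base[OF 0] by simp
  next
    case (Suc k)
    show ?case using Suc.IH[OF symbol_SucD(2)[OF Suc.prems(1)]] Suc.prems
      by (intro Ck_family_SucI[OF open_UNIV base[OF Suc.prems] symbol_SucD(1)[OF Suc.prems(1)]]) auto
  }
qed

section \<open>Vector-valued families and linear substitutions\<close>

lemma Ck_family_vec:
  fixes f :: "'n::finite \<Rightarrow> real \<Rightarrow> 'a::euclidean_space \<Rightarrow> real"
  assumes "open S" "\<And>i. Ck_family k \<K> T S w (f i)"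
  shows "Ck_family k \<K> T S w (\<lambda>t z. (\<chi> i. f i t z) :: real^'n)"
proof -
  have "(\<chi> i. f i t z) = (\<Sum>i\<in>UNIV. f i t z *\<^sub>R axis i 1)" for t z
    using basis_expansion[of "\<chi> i. f i t z"] by (simp add: scalar_mult_eq_scaleR)
  then show ?thesis using assms
    by (simp add: Ck_family_sum Ck_family_linear[OF _ bounded_linear_scaleR_left])
qed

lemma Ck_family_Pair:
  assumes "open S" "Ck_family k \<K> T S w f" "Ck_family k \<K> T S w g"
  shows "Ck_family k \<K> T S w (\<lambda>t z. (f t z, g t z))"
proof -
  have "Ck_family k \<K> T S w (\<lambda>t z. (f t z, 0) + (0, g t z))"
    by (intro Ck_family_add[OF assms(1)] Ck_family_linear[OF assms(1) _ assms(2)] Ck_family_linear[OF assms(1) _ assms(3)]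
        bounded_linear_Pair bounded_linear_ident bounded_linear_zero)
  then show ?thesis by simp
qed

text \<open>Here, unlike in \<open>Ck_family_compose\<close>, the weights survive: the inner map is
  fixed and linear, so its derivative is constant, and regions are carried into regions.\<close>

lemma Ck_family_compose_linear:
  fixes L :: "'a::euclidean_space \<Rightarrow> 'c::euclidean_space" and f :: "real \<Rightarrow> 'c \<Rightarrow> 'b::real_normed_vector"
  assumes "open S" "bounded_linear L" "\<And>z. z \<in> S \<Longrightarrow> L z \<in> S'"
    and KK: "\<And>K. K \<in> \<K> \<Longrightarrow> \<exists>K'\<in>\<K>'. \<forall>t\<in>T. \<forall>z\<in>S. (t, z) \<in> K \<longrightarrow> (t, L z) \<in> K'"
    and "Ck_family k \<K>' T S' w f"
  shows "Ck_family k \<K> T S w (\<lambda>t z. f t (L z))"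
  using assms(5)
proof (induction k arbitrary: f)
  have base: "weight_bounded \<K> T S w (\<lambda>t z. f t (L z))" if wb: "weight_bounded \<K>' T S' w f" for f :: "real \<Rightarrow> 'c \<Rightarrow> 'b"
    unfolding weight_bounded_def
  proof (intro conjI ballI)
    have "continuous_on (T \<times> S) (\<lambda>p. (fst p, L (snd p)))"
      by (intro continuous_intros bounded_linear.continuous_on[OF assms(2)])
    from continuous_on_compose2[OF that[unfolded weight_bounded_def, THEN conjunct1] this]
    show "continuous_on (T \<times> S) (\<lambda>(t, z). f t (L z))" using assms(3) by (auto simp: image_subset_iff split_beta)
    fix K assume "K \<in> \<K>"
    then obtain K' where K': "K' \<in> \<K>'" "\<forall>t\<in>T. \<forall>z\<in>S. (t, z) \<in> K \<longrightarrow> (t, L z) \<in> K'" using KK by meson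
    then obtain C where "\<forall>t\<in>T. \<forall>z\<in>S'. (t, z) \<in> K' \<longrightarrow> norm (f t z) \<le> C * w t" using wb unfolding weight_bounded_def by blast
    then show "\<exists>C. \<forall>t\<in>T. \<forall>z\<in>S. (t, z) \<in> K \<longrightarrow> norm (f t (L z)) \<le> C * w t" using K'(2) assms(3) by blast
  qed
  {
    case 0 then show ?case using base by simp
  next
    case (Suc k)
    note fD = Ck_family_SucD[OF Suc.prems]
    have "((\<lambda>z. f t (L z)) has_derivative (\<lambda>v. frechet_derivative (f t) (at (L z)) (L v))) (at z)" if "t \<in> T" "z \<in> S" for t z
      using diff_chain_at[OF bounded_linear_imp_has_derivative[OF assms(2)] fD(1)[OF that(1) assms(3)[OF that(2)]]] by (simp add: o_def)
    then show ?case
      by (rule Ck_family_SucI[OF assms(1) base[OF Ck_family_weight_bounded[OF Suc.prems]] _ Suc.IH[OF fD(2)]])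
  }
qed

section \<open>The Hamilton flow\<close>

text \<open>With \<open>\<mu> < 1\<close> the integral of \<open>tpow (- \<mu>)\<close> is bounded
  by a multiple of \<open>tpow (1 - \<mu>)\<close>, a nonnegative power, with no separate
  logarithmic or bounded case.\<close>

locale long_range_metric =
  fixes a :: "real^'n \<Rightarrow> real^'n^'n" and \<mu> :: real
  assumes a_symbol: "\<And>k m n. symbol k (- \<mu>) (\<lambda>x. a x $ m $ n - (if m = n then 1 else 0))"
    and a_sym: "\<And>x m n. a x $ m $ n = a x $ n $ m"
    and a_pos: "\<And>x v. v \<noteq> 0 \<Longrightarrow> v \<bullet> (a x *v v) > 0"
    and mu: "1/2 < \<mu>" "\<mu> < 1"
begin

definition b :: "'n \<Rightarrow> 'n \<Rightarrow> real^'n \<Rightarrow> real" where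
  "b m n x = a x $ m $ n - (if m = n then 1 else 0)"

definition Db :: "'n \<Rightarrow> 'n \<Rightarrow> 'n \<Rightarrow> real^'n \<Rightarrow> real" where
  "Db i m n x = partial_deriv i (b m n) x"

definition grad_x :: "real^'n \<Rightarrow> real^'n \<Rightarrow> real^'n" where
  "grad_x x \<xi> = (\<chi> i. \<Sum>m\<in>UNIV. \<Sum>n\<in>UNIV. 1/2 * Db i m n x * \<xi> $ m * \<xi> $ n)"

definition H :: "(real^'n) \<times> (real^'n) \<Rightarrow> (real^'n) \<times> (real^'n)" where
  "H z = (a (fst z) *v snd z, - grad_x (fst z) (snd z))"

lemma b_symbol: "symbol k (- \<mu>) (b m n)"
  using a_symbol[of k m n] unfolding b_def[abs_def] .

lemma Db_symbol: "symbol k (- \<mu> - 1) (Db i m n)"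
  using symbol_SucD(2)[OF b_symbol[of "Suc k" m n], of "axis i 1"] unfolding Db_def[abs_def] partial_deriv_def .

lemma b_has_derivative: "(b m n has_derivative (\<lambda>v. \<Sum>i\<in>UNIV. v $ i * Db i m n x)) (at x)"
proof -
  note d = symbol_SucD(1)[OF b_symbol[of "Suc 0" m n], of x]
  have "frechet_derivative (b m n) (at x) = (\<lambda>v. \<Sum>i\<in>UNIV. v $ i * Db i m n x)"
    unfolding Db_def by (rule ext) (rule frechet_derivative_partial, use d in \<open>auto simp: differentiable_def\<close>)
  then show ?thesis using d by simp
qed

lemma a_eq_b: "a x $ m $ n = b m n x + (if m = n then 1 else 0)"
  by (simp add: b_def)

lemma a_mult_b: "(a x *v \<xi>) $ m = (\<Sum>n\<in>UNIV. b m n x * \<xi> $ n) + \<xi> $ m"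
  by (simp add: matrix_vector_mult_def a_eq_b distrib_right sum.distrib if_distrib[of "\<lambda>c. c * _"] sum.delta cong: if_cong)

lemma kinetic_has_derivative:
  "((\<lambda>z. kinetic a (fst z) (snd z)) has_derivative (\<lambda>d. grad_x x \<xi> \<bullet> fst d + (a x *v \<xi>) \<bullet> snd d)) (at (x, \<xi>))"
proof -
  have da: "((\<lambda>z. a (fst z) $ m $ n) has_derivative (\<lambda>d. \<Sum>i\<in>UNIV. fst d $ i * Db i m n x)) (at (x, \<xi>))" for m n
  proof -
    have "((\<lambda>z. b m n (fst z)) has_derivative (\<lambda>d. \<Sum>i\<in>UNIV. fst d $ i * Db i m n x)) (at (x, \<xi>))"
      using diff_chain_at[OF bounded_linear_imp_has_derivative[OF bounded_linear_fst, of "at (x, \<xi>)"], of "b m n"] b_has_derivative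
      by (auto simp: o_def)
    from has_derivative_add[OF this has_derivative_const] show ?thesis by (simp add: a_eq_b)
  qed
  have ds: "((\<lambda>z. snd z $ m) has_derivative (\<lambda>d. snd d $ m)) (at (x, \<xi>))" for m
    by (rule bounded_linear_imp_has_derivative[OF bounded_linear_compose[OF bounded_linear_vec_nth bounded_linear_snd]])
  have "((\<lambda>z. kinetic a (fst z) (snd z)) has_derivative (\<lambda>d. 1/2 * (\<Sum>m\<in>UNIV. \<Sum>n\<in>UNIV.
      a x $ m $ n * \<xi> $ m * snd d $ n + (a x $ m $ n * snd d $ m + (\<Sum>i\<in>UNIV. fst d $ i * Db i m n x) * \<xi> $ m) * \<xi> $ n))) (at (x, \<xi>))"
    unfolding kinetic_def
    by (rule has_derivative_eq_rhs, (rule has_derivative_mult_right has_derivative_sum has_derivative_mult da ds)+) simp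
  moreover have "1/2 * (\<Sum>m\<in>UNIV. \<Sum>n\<in>UNIV.
      a x $ m $ n * \<xi> $ m * snd d $ n + (a x $ m $ n * snd d $ m + (\<Sum>i\<in>UNIV. fst d $ i * Db i m n x) * \<xi> $ m) * \<xi> $ n)
    = grad_x x \<xi> \<bullet> fst d + (a x *v \<xi>) \<bullet> snd d" for d
  proof -
    have 2: "(\<Sum>m\<in>UNIV. \<Sum>n\<in>UNIV. a x $ m $ n * snd d $ m * \<xi> $ n) = (a x *v \<xi>) \<bullet> snd d"
      by (simp add: inner_vec_def matrix_vector_mult_def sum_distrib_left mult_ac)
    \<comment> \<open>Symmetry of \<open>a\<close> makes the two terms that contain
      \<open>snd d\<close> equal, which cancels the factor 1/2.\<close>
    have "(\<Sum>m\<in>UNIV. \<Sum>n\<in>UNIV. a x $ m $ n * \<xi> $ m * snd d $ n) =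
        (\<Sum>n\<in>UNIV. \<Sum>m\<in>UNIV. a x $ n $ m * snd d $ n * \<xi> $ m)"
      by (subst sum.swap) (simp add: a_sym[of x] mult_ac)
    then have 1: "(\<Sum>m\<in>UNIV. \<Sum>n\<in>UNIV. a x $ m $ n * \<xi> $ m * snd d $ n) = (a x *v \<xi>) \<bullet> snd d"
      by (simp only: 2)
    have "grad_x x \<xi> \<bullet> fst d = (\<Sum>i\<in>UNIV. \<Sum>m\<in>UNIV. \<Sum>n\<in>UNIV. 1/2 * (fst d $ i * Db i m n x * \<xi> $ m * \<xi> $ n))"
      unfolding inner_vec_def grad_x_def by (simp add: sum_distrib_left sum_distrib_right mult_ac)
    also have "\<dots> = (\<Sum>m\<in>UNIV. \<Sum>i\<in>UNIV. \<Sum>n\<in>UNIV. 1/2 * (fst d $ i * Db i m n x * \<xi> $ m * \<xi> $ n))" by (rule sum.swap)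
    also have "\<dots> = (\<Sum>m\<in>UNIV. \<Sum>n\<in>UNIV. \<Sum>i\<in>UNIV. 1/2 * (fst d $ i * Db i m n x * \<xi> $ m * \<xi> $ n))"
      by (intro sum.cong refl sum.swap)
    also have "\<dots> = 1/2 * (\<Sum>m\<in>UNIV. \<Sum>n\<in>UNIV. (\<Sum>i\<in>UNIV. fst d $ i * Db i m n x) * \<xi> $ m * \<xi> $ n)"
      by (simp add: sum_distrib_left sum_distrib_right)
    finally have 3: "grad_x x \<xi> \<bullet> fst d = 1/2 * (\<Sum>m\<in>UNIV. \<Sum>n\<in>UNIV. (\<Sum>i\<in>UNIV. fst d $ i * Db i m n x) * \<xi> $ m * \<xi> $ n)" .
    show ?thesis unfolding 3 by (simp only: distrib_right sum.distrib 1 2) simp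
  qed
  ultimately show ?thesis by (simp only:)
qed

lemma grad_eqI:
  fixes f :: "real^'m \<Rightarrow> real"
  assumes "(f has_derivative (\<lambda>v. g \<bullet> v)) (at x)"
  shows "grad f x = g"
  unfolding grad_def partial_deriv_def frechet_derivative_at[OF assms, symmetric]
  by (simp add: vec_eq_iff inner_axis)

lemma grad_kinetic:
  "grad (\<lambda>\<xi>. kinetic a x \<xi>) \<xi> = a x *v \<xi>" "grad (\<lambda>x. kinetic a x \<xi>) x = grad_x x \<xi>"
proof -
  have 1: "((\<lambda>\<xi>. (x, \<xi>)) has_derivative (\<lambda>v. (0, v))) (at \<xi>)" by (auto intro!: derivative_eq_intros)
  have 2: "((\<lambda>x. (x, \<xi>)) has_derivative (\<lambda>v. (v, 0))) (at x)" by (auto intro!: derivative_eq_intros)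
  show "grad (\<lambda>\<xi>. kinetic a x \<xi>) \<xi> = a x *v \<xi>"
    by (rule grad_eqI) (use diff_chain_at[OF 1 kinetic_has_derivative] in \<open>simp add: o_def\<close>)
  show "grad (\<lambda>x. kinetic a x \<xi>) x = grad_x x \<xi>"
    by (rule grad_eqI) (use diff_chain_at[OF 2 kinetic_has_derivative] in \<open>simp add: o_def\<close>)
qed

lemma hamilton_trajectory_iff:
  "hamilton_trajectory (kinetic a) p \<gamma> \<longleftrightarrow> \<gamma> 0 = p \<and> (\<forall>t. (\<gamma> has_vector_derivative H (\<gamma> t)) (at t))"
proof -
  have "((\<lambda>s. fst (\<gamma> s)) has_vector_derivative fst (H (\<gamma> t))) (at t) \<and> ((\<lambda>s. snd (\<gamma> s)) has_vector_derivative snd (H (\<gamma> t))) (at t)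
    \<longleftrightarrow> (\<gamma> has_vector_derivative H (\<gamma> t)) (at t)" for t
    using has_vector_derivative_Pair[of "\<lambda>s. fst (\<gamma> s)" "fst (H (\<gamma> t))" t UNIV "\<lambda>s. snd (\<gamma> s)" "snd (H (\<gamma> t))"]
      bounded_linear.has_vector_derivative[OF bounded_linear_fst, of \<gamma> "H (\<gamma> t)" "at t"]
      bounded_linear.has_vector_derivative[OF bounded_linear_snd, of \<gamma> "H (\<gamma> t)" "at t"] by auto
  then show ?thesis unfolding hamilton_trajectory_def grad_kinetic H_def by simp
qed

text \<open>The regions bound the momentum but not the position: energy conservation will bound the
  momentum of a trajectory, while its position is unbounded.\<close>

lemma H_Ck_family: "Ck_family k (range (\<lambda>R. UNIV \<times> UNIV \<times> cball 0 R)) T UNIV (\<lambda>_. 1) (\<lambda>t. H)"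
proof -
  let ?K = "range (\<lambda>R. (UNIV :: real set) \<times> (UNIV :: (real^'n) set) \<times> cball (0 :: real^'n) R)"
  have xi: "Ck_family k ?K T UNIV (\<lambda>_. 1) (\<lambda>t z. snd z $ m)" for m
  proof (rule Ck_family_bounded_linear[where c = 1, OF open_UNIV bounded_linear_compose[OF bounded_linear_vec_nth bounded_linear_snd]])
    have "\<bar>v $ m\<bar> \<le> R * 1" if "norm v \<le> R" for v :: "real^'n" and R using order_trans[OF component_le_norm_cart that] by simp
    then show "weight_bounded ?K T UNIV (\<lambda>_. 1) (\<lambda>t z. snd z $ m)"
      unfolding weight_bounded_def split_beta by (auto intro!: continuous_intros)
  qed auto
  have sy: "Ck_family k ?K T UNIV (\<lambda>_. 1) (\<lambda>t z. c (fst z))" if "\<And>k. symbol k r c" "r \<le> 0" for c r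
    by (rule Ck_family_compose_linear[OF open_UNIV bounded_linear_fst _ _ symbol_bounded_Ck_family[OF that(1) that(2), where \<K> = "{UNIV}"]]) auto
  have mult: "Ck_family k ?K T UNIV (\<lambda>_. 1) (\<lambda>t z. f t z * g t z)" if "Ck_family k ?K T UNIV (\<lambda>_. 1) f" "Ck_family k ?K T UNIV (\<lambda>_. 1) g"
    for f g :: "real \<Rightarrow> (real^'n) \<times> (real^'n) \<Rightarrow> real"
    using Ck_family_bilinear[OF open_UNIV bounded_bilinear_mult that] by simp
  have 1: "Ck_family k ?K T UNIV (\<lambda>_. 1) (\<lambda>t z. \<chi> m. (\<Sum>n\<in>UNIV. b m n (fst z) * snd z $ n) + snd z $ m)"
    using mu by (intro Ck_family_vec Ck_family_add Ck_family_sum mult xi sy[OF b_symbol] open_UNIV) auto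
  have c: "Ck_family k ?K T UNIV (\<lambda>_. 1) (\<lambda>t z. 1/2 :: real)" by (rule Ck_family_const_time[where C = 1]) auto
  have 2: "Ck_family k ?K T UNIV (\<lambda>_. 1) (\<lambda>t z. \<chi> i. \<Sum>m\<in>UNIV. \<Sum>n\<in>UNIV. 1/2 * Db i m n (fst z) * snd z $ m * snd z $ n)"
    using mu by (intro Ck_family_vec Ck_family_sum mult c xi sy[OF Db_symbol] open_UNIV) auto
  have "H = (\<lambda>z. ((\<chi> m. (\<Sum>n\<in>UNIV. b m n (fst z) * snd z $ n) + snd z $ m), - (\<chi> i. \<Sum>m\<in>UNIV. \<Sum>n\<in>UNIV. 1/2 * Db i m n (fst z) * snd z $ m * snd z $ n)))"
    unfolding H_def[abs_def] grad_x_def by (simp add: vec_eq_iff a_mult_b fun_eq_iff)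
  then show ?thesis using Ck_family_Pair[OF open_UNIV 1 Ck_family_minus[OF open_UNIV 2]] by (simp only:)
qed

end

section \<open>Ellipticity, energy conservation and global trajectories\<close>

context long_range_metric
begin

lemma coefficient_bounds:
  "\<exists>C>0. \<forall>x v. norm (a x *v v - v) \<le> C * jbracket x powr (- \<mu>) * norm v \<and>
     norm (grad_x x v) \<le> C * jbracket x powr (- \<mu> - 1) * (norm v)\<^sup>2"
proof -
  have "\<exists>B. \<forall>x. \<bar>b m n x\<bar> \<le> B * jbracket x powr (- \<mu>)" for m n using b_symbol[of 0 m n] by simp
  then obtain B where B: "\<And>m n x. \<bar>b m n x\<bar> \<le> B m n * jbracket x powr (- \<mu>)" by metis
  have "\<exists>D. \<forall>x. \<bar>Db i m n x\<bar> \<le> D * jbracket x powr (- \<mu> - 1)" for i m n using Db_symbol[of 0 i m n] by simp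
  then obtain D where D: "\<And>i m n x. \<bar>Db i m n x\<bar> \<le> D i m n * jbracket x powr (- \<mu> - 1)" by metis
  define C1 where "C1 = (\<Sum>m\<in>UNIV. \<Sum>n\<in>UNIV. B m n)"
  define C2 where "C2 = (\<Sum>i\<in>UNIV. \<Sum>m\<in>UNIV. \<Sum>n\<in>UNIV. 1/2 * D i m n)"
  define C where "C = \<bar>C1\<bar> + \<bar>C2\<bar> + 1"
  have 1: "norm (a x *v v - v) \<le> C * jbracket x powr (- \<mu>) * norm v" for x v
  proof -
    have "norm (a x *v v - v) \<le> (\<Sum>m\<in>UNIV. \<bar>(a x *v v - v) $ m\<bar>)" by (rule norm_le_l1_cart)
    also have "\<dots> \<le> (\<Sum>m\<in>UNIV. \<Sum>n\<in>UNIV. B m n * (jbracket x powr (- \<mu>) * norm v))"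
    proof (rule sum_mono)
      fix m
      have "\<bar>(a x *v v - v) $ m\<bar> \<le> (\<Sum>n\<in>UNIV. \<bar>b m n x * v $ n\<bar>)" by (simp add: a_mult_b sum_abs)
      also have "\<dots> \<le> (\<Sum>n\<in>UNIV. (B m n * jbracket x powr (- \<mu>)) * norm v)"
        unfolding abs_mult by (intro sum_mono mult_mono B component_le_norm_cart order_trans[OF _ B]) auto
      finally show "\<bar>(a x *v v - v) $ m\<bar> \<le> (\<Sum>n\<in>UNIV. B m n * (jbracket x powr (- \<mu>) * norm v))" by (simp add: mult.assoc)
    qed
    also have "\<dots> = C1 * (jbracket x powr (- \<mu>) * norm v)" by (simp add: C1_def sum_distrib_right)
    also have "\<dots> \<le> C * (jbracket x powr (- \<mu>) * norm v)" by (intro mult_right_mono) (auto simp: C_def)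
    finally show ?thesis by (simp add: mult.assoc)
  qed
  have 2: "norm (grad_x x v) \<le> C * jbracket x powr (- \<mu> - 1) * (norm v)\<^sup>2" for x v
  proof -
    let ?w = "jbracket x powr (- \<mu> - 1) * (norm v)\<^sup>2"
    have "norm (grad_x x v) \<le> (\<Sum>i\<in>UNIV. \<bar>grad_x x v $ i\<bar>)" by (rule norm_le_l1_cart)
    also have "\<dots> \<le> (\<Sum>i\<in>UNIV. \<Sum>m\<in>UNIV. \<Sum>n\<in>UNIV. (1/2 * D i m n) * ?w)"
    proof (rule sum_mono)
      fix i
      have "\<bar>grad_x x v $ i\<bar> \<le> (\<Sum>m\<in>UNIV. \<bar>\<Sum>n\<in>UNIV. 1/2 * Db i m n x * v $ m * v $ n\<bar>)"
        by (simp only: grad_x_def vec_lambda_beta sum_abs)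
      also have "\<dots> \<le> (\<Sum>m\<in>UNIV. \<Sum>n\<in>UNIV. \<bar>1/2 * Db i m n x * v $ m * v $ n\<bar>)"
        by (intro sum_mono sum_abs)
      also have "\<dots> \<le> (\<Sum>m\<in>UNIV. \<Sum>n\<in>UNIV. (1/2 * D i m n) * ?w)"
      proof (intro sum_mono)
        fix m n
        have "\<bar>1/2 * Db i m n x * v $ m * v $ n\<bar> = 1/2 * \<bar>Db i m n x\<bar> * (\<bar>v $ m\<bar> * \<bar>v $ n\<bar>)" by (simp add: abs_mult)
        also have "\<dots> \<le> 1/2 * (D i m n * jbracket x powr (- \<mu> - 1)) * (norm v * norm v)"
          by (intro mult_mono mult_left_mono D component_le_norm_cart) (auto intro: order_trans[OF _ D])
        finally show "\<bar>1/2 * Db i m n x * v $ m * v $ n\<bar> \<le> (1/2 * D i m n) * ?w" by (simp add: power2_eq_square mult_ac)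
      qed
      finally show "\<bar>grad_x x v $ i\<bar> \<le> (\<Sum>m\<in>UNIV. \<Sum>n\<in>UNIV. (1/2 * D i m n) * ?w)" .
    qed
    also have "\<dots> = C2 * ?w" by (simp add: C2_def sum_distrib_right)
    also have "\<dots> \<le> C * ?w" by (intro mult_right_mono) (auto simp: C_def)
    finally show ?thesis by (simp add: mult.assoc)
  qed
  have "C > 0" by (simp add: C_def add_nonneg_pos)
  then show ?thesis using 1 2 by blast
qed

lemma kinetic_inner: "kinetic a x v = 1/2 * (v \<bullet> (a x *v v))"
  by (simp add: kinetic_def inner_vec_def matrix_vector_mult_def sum_distrib_left mult_ac)

text \<open>Uniform ellipticity. Far out it follows from the decay of \<open>a\<close> minus the
  identity, and on a ball from positivity and compactness.\<close>

lemma kinetic_bounds: "\<exists>c>0. \<exists>C>0. \<forall>x v. c * (norm v)\<^sup>2 \<le> kinetic a x v \<and> kinetic a x v \<le> C * (norm v)\<^sup>2"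
proof -
  obtain C where C: "C > 0" "\<And>x v. norm (a x *v v - v) \<le> C * jbracket x powr (- \<mu>) * norm v"
    using coefficient_bounds by blast
  have diff: "\<bar>v \<bullet> (a x *v v) - (norm v)\<^sup>2\<bar> \<le> C * jbracket x powr (- \<mu>) * (norm v)\<^sup>2" for x v
  proof -
    have "v \<bullet> (a x *v v) - (norm v)\<^sup>2 = v \<bullet> (a x *v v - v)" by (simp add: inner_diff_right power2_norm_eq_inner)
    then have "\<bar>v \<bullet> (a x *v v) - (norm v)\<^sup>2\<bar> \<le> norm v * norm (a x *v v - v)" using Cauchy_Schwarz_ineq2 by simp
    also have "\<dots> \<le> norm v * (C * jbracket x powr (- \<mu>) * norm v)" by (intro mult_left_mono C) auto
    finally show ?thesis by (simp add: power2_eq_square mult_ac)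
  qed
  have upper: "kinetic a x v \<le> (C + 1) * (norm v)\<^sup>2" for x v
  proof -
    have "jbracket x powr (- \<mu>) \<le> jbracket x powr 0" using jbracket_ge_1 mu by (intro powr_mono) auto
    then have "C * jbracket x powr (- \<mu>) * (norm v)\<^sup>2 \<le> C * 1 * (norm v)\<^sup>2"
      using C(1) jbracket_ge_1[of x] by (intro mult_right_mono mult_left_mono) auto
    then have "v \<bullet> (a x *v v) \<le> (C + 1) * (norm v)\<^sup>2" using diff[of v x] by (simp add: distrib_right)
    moreover have "0 \<le> v \<bullet> (a x *v v)" using a_pos[of v x] by (cases "v = 0") auto
    ultimately show ?thesis by (simp add: kinetic_inner)
  qed
  \<comment> \<open>Solves \<open>C * R powr (- \<mu>) = 1/2\<close>, so that outside the ball of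
    this radius at least half of the Euclidean form remains.\<close>
  define R where "R = (2 * C) powr (1 / \<mu>)"
  have R: "R > 0" using C by (simp add: R_def)
  have far: "v \<bullet> (a x *v v) \<ge> 1/2 * (norm v)\<^sup>2" if "norm x \<ge> R" for x v
  proof -
    have "2 * C = R powr \<mu>" using C mu by (simp add: R_def powr_powr)
    also have "\<dots> \<le> jbracket x powr \<mu>" using that norm_le_jbracket[of x] mu R by (intro powr_mono2) auto
    finally have "C * jbracket x powr (- \<mu>) \<le> 1/2" using jbracket_ge_1[of x] by (simp add: powr_minus field_simps)
    then have "C * jbracket x powr (- \<mu>) * (norm v)\<^sup>2 \<le> 1/2 * (norm v)\<^sup>2" by (intro mult_right_mono) auto
    then show ?thesis using diff[of v x] by linarith
  qed
  have ca: "continuous_on UNIV (\<lambda>x. a x $ m $ n)" for m n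
    using symbol_0D[OF b_symbol[of 0 m n]] by (auto simp: a_eq_b intro!: continuous_intros)
  define Q where "Q p = snd p \<bullet> (a (fst p) *v snd p)" for p
  have "continuous_on UNIV Q"
    unfolding Q_def inner_vec_def matrix_vector_mult_def
    by (simp, intro continuous_intros continuous_on_compose2[OF ca]) auto
  moreover have "compact (cball (0::real^'n) R \<times> sphere (0::real^'n) 1)" by (intro compact_Times compact_cball compact_sphere)
  moreover have "(0, axis undefined 1) \<in> cball (0::real^'n) R \<times> sphere (0::real^'n) 1" using R by simp
  ultimately obtain q where q: "q \<in> cball (0::real^'n) R \<times> sphere (0::real^'n) 1"
     "\<And>p. p \<in> cball (0::real^'n) R \<times> sphere (0::real^'n) 1 \<Longrightarrow> Q q \<le> Q p"
    using continuous_attains_inf[of "cball (0::real^'n) R \<times> sphere (0::real^'n) 1" Q] continuous_on_subset by blast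
  have "snd q \<noteq> 0" using q(1) by auto
  then have Q0: "Q q > 0" unfolding Q_def by (rule a_pos)
  have near: "v \<bullet> (a x *v v) \<ge> Q q * (norm v)\<^sup>2" if "norm x \<le> R" for x v
  proof (cases "v = 0")
    case False
    have "Q q \<le> Q (x, (1 / norm v) *\<^sub>R v)" using that False by (intro q(2)) auto
    also have "\<dots> = (v \<bullet> (a x *v v)) / (norm v)\<^sup>2"
      by (simp add: Q_def matrix_vector_mult_scaleR power2_eq_square)
    finally show ?thesis using False by (simp add: pos_le_divide_eq)
  qed simp
  define c where "c = min (Q q / 2) (1/4)"
  have "c * (norm v)\<^sup>2 \<le> kinetic a x v" for x v
  proof (cases "norm x \<le> R")
    case True
    have "c * (norm v)\<^sup>2 \<le> Q q / 2 * (norm v)\<^sup>2" by (intro mult_right_mono) (auto simp: c_def)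
    then show ?thesis using near[OF True, of v] by (simp add: kinetic_inner)
  next
    case False
    have "c * (norm v)\<^sup>2 \<le> 1/4 * (norm v)\<^sup>2" by (intro mult_right_mono) (auto simp: c_def)
    then show ?thesis using far[of x v] False by (simp add: kinetic_inner)
  qed
  moreover have "c > 0" "C + 1 > 0" using Q0 C by (auto simp: c_def)
  ultimately show ?thesis using upper by blast
qed

lemma H_unique:
  assumes "\<And>t. (\<gamma> has_vector_derivative H (\<gamma> t)) (at t)" "\<And>t. (\<gamma>' has_vector_derivative H (\<gamma>' t)) (at t)"
    "\<gamma> \<tau> = \<gamma>' \<tau>"
  shows "\<gamma> = \<gamma>'"
proof
  fix t
  have "Ck_family (Suc 0) {} {min \<tau> t..max \<tau> t} UNIV (\<lambda>_. 1) (\<lambda>t. H)"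
    by (rule Ck_family_ignore[OF H_Ck_family])
  from solution_unique[OF open_UNIV this, of \<tau> \<gamma>' \<gamma> t]
  show "\<gamma> t = \<gamma>' t" using assms by (auto intro: has_vector_derivative_at_within simp del: has_vector_derivative_at_within)
qed

text \<open>Stated on a convex set of times, because it is first applied to a solution of a
  truncated equation that is known to agree with \<open>H\<close> only on a segment.\<close>

lemma kinetic_conserved:
  assumes "\<And>s. s \<in> X \<Longrightarrow> (\<gamma> has_vector_derivative H (\<gamma> s)) (at s)" "convex X" "s \<in> X" "t \<in> X"
  shows "kinetic a (fst (\<gamma> s)) (snd (\<gamma> s)) = kinetic a (fst (\<gamma> t)) (snd (\<gamma> t))"
proof -
  have "((\<lambda>s. kinetic a (fst (\<gamma> s)) (snd (\<gamma> s))) has_derivative (\<lambda>_. 0)) (at s within X)" if "s \<in> X" for s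
  proof -
    obtain x \<xi> where x: "\<gamma> s = (x, \<xi>)" by (cases "\<gamma> s")
    have "((\<lambda>s. kinetic a (fst (\<gamma> s)) (snd (\<gamma> s))) has_derivative (\<lambda>d. grad_x x \<xi> \<bullet> fst (d *\<^sub>R H (x, \<xi>)) + (a x *v \<xi>) \<bullet> snd (d *\<^sub>R H (x, \<xi>)))) (at s)"
    proof -
      have "((\<lambda>z. kinetic a (fst z) (snd z)) has_derivative (\<lambda>d. grad_x x \<xi> \<bullet> fst d + (a x *v \<xi>) \<bullet> snd d)) (at (\<gamma> s))"
        unfolding x by (rule kinetic_has_derivative)
      from diff_chain_at[OF assms(1)[OF that, unfolded has_vector_derivative_def] this]
      show ?thesis by (simp only: o_def x)
    qed
    moreover have "(\<lambda>d. grad_x x \<xi> \<bullet> fst (d *\<^sub>R H (x, \<xi>)) + (a x *v \<xi>) \<bullet> snd (d *\<^sub>R H (x, \<xi>))) = (\<lambda>_. 0)"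
      by (simp add: H_def inner_commute fun_eq_iff)
    ultimately show ?thesis by (metis has_derivative_at_withinI)
  qed
  then obtain c where "\<And>s. s \<in> X \<Longrightarrow> kinetic a (fst (\<gamma> s)) (snd (\<gamma> s)) = c"
    using has_derivative_zero_constant[OF assms(2), of "\<lambda>s. kinetic a (fst (\<gamma> s)) (snd (\<gamma> s))"] by blast
  then show ?thesis using assms(3,4) by simp
qed

text \<open>\<open>H\<close> is quadratic in the momentum, hence not globally Lipschitz. The
  equation is solved with the momentum projected onto a ball; conservation of energy then shows that
  the projection never acts.\<close>

lemma trajectory_exists_at_0: "\<exists>\<gamma>. \<gamma> 0 = p \<and> (\<forall>t. (\<gamma> has_vector_derivative H (\<gamma> t)) (at t))"
proof -
  obtain c where c: "c > 0" "\<And>x v. c * (norm v)\<^sup>2 \<le> kinetic a x v" using kinetic_bounds by blast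
  define E where "E = kinetic a (fst p) (snd p)"
  \<comment> \<open>The summand 1 makes the energy bound on the momentum strict, as the bootstrap
    requires.\<close>
  define R where "R = sqrt (E / c) + 1"
  have E0: "E \<ge> 0" using order_trans[OF _ c(2)[of "snd p" "fst p"]] c(1) by (simp add: E_def)
  have bd: "norm v < R" if "kinetic a x v = E" for x v
  proof -
    have "(norm v)\<^sup>2 \<le> E / c" using c(2)[of v x] that c(1) by (simp add: pos_le_divide_eq mult.commute)
    then have "norm v \<le> sqrt (E / c)" by (rule real_le_rsqrt)
    then show ?thesis by (simp add: R_def)
  qed
  have R: "R > 0" using E0 c(1) by (simp add: R_def add_nonneg_pos)
  let ?B = "UNIV \<times> cball 0 R :: ((real^'n) \<times> (real^'n)) set"
  have "\<exists>C. \<forall>z\<in>?B. norm (frechet_derivative H (at z) e) \<le> C" for e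
  proof -
    have "weight_bounded (range (\<lambda>R. UNIV \<times> UNIV \<times> cball 0 R)) UNIV UNIV (\<lambda>_. 1) (\<lambda>(t::real) z. frechet_derivative H (at z) e)"
      by (rule Ck_family_weight_bounded[OF Ck_family_SucD(2)[OF H_Ck_family[of "Suc 0"]]])
    then have "\<exists>C. \<forall>t\<in>UNIV. \<forall>z\<in>UNIV. (t, z) \<in> (UNIV :: real set) \<times> UNIV \<times> cball 0 R \<longrightarrow> norm (frechet_derivative H (at z) e) \<le> C * 1"
      unfolding weight_bounded_def by blast
    then obtain C where "\<forall>t\<in>UNIV. \<forall>z\<in>UNIV. (t, z) \<in> (UNIV :: real set) \<times> UNIV \<times> cball 0 R \<longrightarrow> norm (frechet_derivative H (at z) e) \<le> C * 1" ..
    then show ?thesis by (intro exI[of _ C]) auto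
  qed
  then obtain B where B: "\<And>e z. z \<in> ?B \<Longrightarrow> norm (frechet_derivative H (at z) e) \<le> B e" by metis
  define L where "L = \<bar>\<Sum>e\<in>Basis. B e\<bar> + 1"
  have L: "L > 0" by (simp add: L_def add_nonneg_pos)
  have dH: "(H has_derivative frechet_derivative H (at z)) (at z)" for z
    using Ck_family_SucD(1)[OF H_Ck_family[of "Suc 0" UNIV], of 0] by simp
  have lipH: "norm (H z - H z') \<le> L * norm (z - z')" if "z \<in> ?B" "z' \<in> ?B" for z z'
  proof (rule differentiable_bound[where S = ?B and f = H and f' = "\<lambda>z. frechet_derivative H (at z)"])
    show "convex ?B" by (intro convex_Times convex_cball) auto
    fix y assume y: "y \<in> ?B"
    show "(H has_derivative frechet_derivative H (at y)) (at y within ?B)" by (rule has_derivative_at_withinI[OF dH])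
    show "onorm (frechet_derivative H (at y)) \<le> L"
    proof (rule onorm_le)
      fix u
      have "norm (frechet_derivative H (at y) u) \<le> (\<Sum>e\<in>Basis. B e) * norm u"
        by (rule norm_linear_le_Basis[OF has_derivative_linear[OF dH] B[OF y]])
      also have "\<dots> \<le> L * norm u" by (rule mult_right_mono) (auto simp: L_def)
      finally show "norm (frechet_derivative H (at y) u) \<le> L * norm u" .
    qed
  qed (use that in auto)
  \<comment> \<open>The projection does not increase distances, so \<open>H\<close> composed with it
    inherits the Lipschitz constant that \<open>H\<close> has for bounded momenta.\<close>
  define \<pi> where "\<pi> z = (fst z, closest_point (cball 0 R) (snd z))" for z :: "(real^'n) \<times> (real^'n)"
  have ne: "cball (0::real^'n) R \<noteq> {}" using R by simp
  have \<pi>B: "\<pi> z \<in> ?B" for z using closest_point_in_set[OF closed_cball ne, of "snd z"] by (auto simp: \<pi>_def)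
  have \<pi>lip: "norm (\<pi> z - \<pi> z') \<le> norm (z - z')" for z z'
  proof -
    have "dist (snd (\<pi> z)) (snd (\<pi> z')) \<le> dist (snd z) (snd z')"
      unfolding \<pi>_def snd_conv by (rule closest_point_lipschitz[OF convex_cball closed_cball ne])
    then show ?thesis unfolding norm_prod_def by (intro real_sqrt_le_mono add_mono power_mono) (auto simp: \<pi>_def dist_norm)
  qed
  have lip: "norm (H (\<pi> z) - H (\<pi> z')) \<le> L * norm (z - z')" for z z'
    using order_trans[OF lipH[OF \<pi>B \<pi>B] mult_left_mono[OF \<pi>lip, of L]] L by simp
  have "continuous_on UNIV (\<lambda>z. H (\<pi> z))"
    by (rule lipschitz_on_continuous_on[OF lipschitz_onI[of _ _ L]]) (use lip L in \<open>auto simp: dist_norm\<close>)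
  then have "continuous_on UNIV (\<lambda>(t::real, z). H (\<pi> z))"
    using continuous_on_compose2[OF _ continuous_on_snd[OF continuous_on_id], of UNIV "\<lambda>z. H (\<pi> z)" UNIV] by (simp add: split_beta)
  from picard_global_0[OF this L lip order_refl, of p] obtain \<gamma> where
    \<gamma>: "\<gamma> 0 = p" "\<And>t. (\<gamma> has_vector_derivative H (\<pi> (\<gamma> t))) (at t)" by blast
  have c\<gamma>: "continuous_on X \<gamma>" for X by (rule continuous_on_vector_derivative[OF has_vector_derivative_at_within[OF \<gamma>(2)]])
  have \<pi>id: "\<pi> z = z" if "norm (snd z) \<le> R" for z using that by (simp add: \<pi>_def closest_point_self)
  have "norm (snd (\<gamma> t)) < R" for t
  proof (rule bootstrap[of "min 0 t" "max 0 t" "\<lambda>t. norm (snd (\<gamma> t))" 0 R t])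
    show "continuous_on {min 0 t..max 0 t} (\<lambda>t. norm (snd (\<gamma> t)))" by (intro continuous_intros c\<gamma>)
    show "norm (snd (\<gamma> 0)) < R" by (rule bd[of "fst p"]) (simp add: \<gamma> E_def)
    fix u assume small: "\<And>s. s \<in> closed_segment 0 u \<Longrightarrow> norm (snd (\<gamma> s)) \<le> R"
    have "kinetic a (fst (\<gamma> u)) (snd (\<gamma> u)) = kinetic a (fst (\<gamma> 0)) (snd (\<gamma> 0))"
      by (rule kinetic_conserved[where X = "closed_segment 0 u"]) (use \<gamma>(2) \<pi>id small in \<open>metis\<close>, auto)
    then show "norm (snd (\<gamma> u)) < R" by (intro bd[of "fst (\<gamma> u)"]) (simp add: \<gamma> E_def)
  qed auto
  then have "\<pi> (\<gamma> t) = \<gamma> t" for t by (intro \<pi>id less_imp_le)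
  then show ?thesis using \<gamma> by auto
qed

lemma trajectory_exists: "\<exists>\<gamma>. \<gamma> \<tau> = p \<and> (\<forall>t. (\<gamma> has_vector_derivative H (\<gamma> t)) (at t))"
proof -
  obtain \<gamma> where \<gamma>: "\<gamma> 0 = p" "\<And>t. (\<gamma> has_vector_derivative H (\<gamma> t)) (at t)" using trajectory_exists_at_0 by blast
  have "((\<lambda>s. \<gamma> (s - \<tau>)) has_vector_derivative H (\<gamma> (t - \<tau>))) (at t)" for t
    by (rule has_vector_derivative_shift[OF \<gamma>(2)])
  then show ?thesis using \<gamma>(1) by (intro exI[of _ "\<lambda>s. \<gamma> (s - \<tau>)"]) auto
qed

lemma hamilton_flow_eq:
  assumes "\<gamma> 0 = p" "\<And>t. (\<gamma> has_vector_derivative H (\<gamma> t)) (at t)"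
  shows "hamilton_flow (kinetic a) t p = \<gamma> t"
proof -
  have "(THE \<gamma>. hamilton_trajectory (kinetic a) p \<gamma>) = \<gamma>"
    by (rule the_equality) (use assms H_unique[of _ \<gamma> 0] in \<open>auto simp: hamilton_trajectory_iff\<close>)
  then show ?thesis by (simp add: hamilton_flow_def)
qed

lemma hamilton_flow_0: "hamilton_flow (kinetic a) 0 p = p"
  and hamilton_flow_derivative:
    "((\<lambda>s. hamilton_flow (kinetic a) s p) has_vector_derivative H (hamilton_flow (kinetic a) t p)) (at t)"
proof -
  obtain \<gamma> where \<gamma>: "\<gamma> 0 = p" "\<And>t. (\<gamma> has_vector_derivative H (\<gamma> t)) (at t)" using trajectory_exists_at_0 by blast
  then have "(\<lambda>s. hamilton_flow (kinetic a) s p) = \<gamma>" using hamilton_flow_eq by blast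
  then show "hamilton_flow (kinetic a) 0 p = p"
    "((\<lambda>s. hamilton_flow (kinetic a) s p) has_vector_derivative H (hamilton_flow (kinetic a) t p)) (at t)"
    using \<gamma> by (metis, metis)
qed

text \<open>The conserved energy is positive exactly when the momentum is nonzero.\<close>

lemma trajectory_phase_space:
  assumes "\<And>t. (\<gamma> has_vector_derivative H (\<gamma> t)) (at t)" "snd (\<gamma> \<tau>) \<noteq> 0"
  shows "snd (\<gamma> t) \<noteq> 0"
proof -
  have "kinetic a (fst (\<gamma> t)) (snd (\<gamma> t)) = kinetic a (fst (\<gamma> \<tau>)) (snd (\<gamma> \<tau>))"
    by (rule kinetic_conserved[OF assms(1), of UNIV]) auto
  moreover have "kinetic a (fst (\<gamma> \<tau>)) (snd (\<gamma> \<tau>)) > 0" using a_pos[OF assms(2)] by (simp add: kinetic_inner)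
  ultimately show ?thesis by (auto simp: kinetic_inner)
qed

end

section \<open>Modified free coordinates\<close>

text \<open>The time derivative is given only at the single point \<open>(t, c t)\<close>; joint
  continuity of the derivative in the second argument is what turns the partial derivatives into a
  total one. Derivatives are one-sided at \<open>t = 0\<close>.\<close>

lemma Ck_family_along_curve:
  fixes F :: "real \<Rightarrow> 'a::euclidean_space \<Rightarrow> 'b::euclidean_space"
  assumes "open S" and F: "Ck_family (Suc 0) {} {0..} S w F" and t: "t \<ge> 0"
    and dt: "((\<lambda>s. F s (c t)) has_vector_derivative f') (at t within {0..})"
    and c: "(c has_vector_derivative c') (at t within {0..})" "c t \<in> S"
  shows "((\<lambda>s. F s (c s)) has_vector_derivative f' + frechet_derivative (F t) (at (c t)) c') (at t within {0..})"
proof -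
  note FD = Ck_family_SucD[OF F]
  obtain r where r: "r > 0" "ball (c t) r \<subseteq> S" using assms(1) c(2) openE by blast
  define D where "D s z = Blinfun (frechet_derivative (F s) (at z))" for s z
  have D: "blinfun_apply (D s z) = frechet_derivative (F s) (at z)" if "s \<ge> 0" "z \<in> S" for s z
    unfolding D_def using FD(1) that by (intro bounded_linear_Blinfun_apply has_derivative_bounded_linear) auto
  have cD: "continuous_on ({0..} \<times> ball (c t) r) (\<lambda>(s, z). D s z)"
  proof (rule continuous_on_blinfun_componentwise)
    fix e :: 'a
    have "continuous_on ({0..} \<times> ball (c t) r) (\<lambda>(s, z). frechet_derivative (F s) (at z) e)"
      by (rule continuous_on_subset[OF Ck_family_cont[OF FD(2)[of e]]]) (use r in auto)
    then show "continuous_on ({0..} \<times> ball (c t) r) (\<lambda>p. blinfun_apply (case p of (s, z) \<Rightarrow> D s z) e)"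
      by (rule continuous_on_eq) (use D r(2) in auto)
  qed
  have total: "((\<lambda>(s, z). F s z) has_derivative (\<lambda>(\<tau>, v). \<tau> *\<^sub>R f' + blinfun_apply (D t (c t)) v)) (at (t, c t) within {0..} \<times> ball (c t) r)"
  proof (rule has_derivative_partialsI)
    show "((\<lambda>s. F s (c t)) has_derivative (\<lambda>\<tau>. \<tau> *\<^sub>R f')) (at t within {0..})"
      using dt by (simp add: has_vector_derivative_def)
    fix s z assume "s \<in> {0::real..}" "z \<in> ball (c t) r"
    then have sz: "s \<in> {0..}" "z \<in> S" using r by auto
    show "((\<lambda>y. F s y) has_derivative blinfun_apply (D s z)) (at z within ball (c t) r)"
      using has_derivative_at_withinI[OF FD(1)[OF sz]] D[of s z] sz by simp
  next
    show "continuous (at (t, c t) within {0..} \<times> ball (c t) r) (\<lambda>(s, z). D s z)"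
      using cD t r(1) by (auto simp: continuous_on_eq_continuous_within)
  qed (use r in auto)
  have "(c \<longlongrightarrow> c t) (at t within {0..})"
    using has_vector_derivative_continuous[OF c(1)] by (simp add: continuous_within)
  then have "\<forall>\<^sub>F s in at t within {0..}. dist (c s) (c t) < r" using r(1) by (rule tendstoD)
  then obtain \<delta> where \<delta>: "\<delta> > 0" "\<And>s. s \<ge> 0 \<Longrightarrow> s \<noteq> t \<Longrightarrow> dist s t < \<delta> \<Longrightarrow> dist (c s) (c t) < r"
    unfolding eventually_at by auto
  \<comment> \<open>Near \<open>t\<close> the curve stays in the ball on which the total derivative
    was established, and restricting to such times does not change the filter.\<close>
  define N where "N = {0..} \<inter> ball t \<delta>"
  have N: "c s \<in> ball (c t) r" if "s \<in> N" for s
    using \<delta>(2)[of s] that r(1) by (cases "s = t") (auto simp: N_def dist_commute)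
  have atN: "at t within N = at t within {0..}"
    by (rule at_within_nhd[of _ "ball t \<delta>"]) (use \<delta>(1) in \<open>auto simp: N_def\<close>)
  have g: "((\<lambda>s. (s, c s)) has_derivative (\<lambda>\<tau>. (\<tau>, \<tau> *\<^sub>R c'))) (at t within N)"
    using c(1) unfolding atN has_vector_derivative_def by (intro has_derivative_Pair has_derivative_ident)
  have "((\<lambda>(s, z). F s z) has_derivative (\<lambda>(\<tau>, v). \<tau> *\<^sub>R f' + blinfun_apply (D t (c t)) v)) (at (t, c t) within (\<lambda>s. (s, c s)) ` N)"
    by (rule has_derivative_subset[OF total]) (use N in \<open>auto simp: N_def\<close>)
  from diff_chain_within[OF g this]
  have "((\<lambda>s. F s (c s)) has_derivative (\<lambda>\<tau>. \<tau> *\<^sub>R f' + blinfun_apply (D t (c t)) (\<tau> *\<^sub>R c'))) (at t within N)"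
    by (simp add: o_def)
  then show ?thesis unfolding atN has_vector_derivative_def D[OF t c(2), symmetric]
    by (simp only: blinfun.scaleR_right scaleR_add_right)
qed

text \<open>The displacement \<open>d\<close> is of lower order than the ray, whose speed is at
  least \<open>1 / R\<close>, so it cannot cancel the ray for large \<open>t\<close>. For bounded
  \<open>t\<close> the lower bound comes from the bracket being at least 1.\<close>

lemma jbracket_ray_bounds:
  fixes \<eta> d :: "real^'n"
  assumes "0 < \<mu>" "\<mu> < 1" "R > 0" "C \<ge> 0"
  shows "\<exists>c>0. \<exists>B>0. \<forall>t\<ge>0. \<forall>\<eta> d :: real^'n. 1 / R \<le> norm \<eta> \<longrightarrow> norm \<eta> \<le> R \<longrightarrow> norm d \<le> C * tpow (1 - \<mu>) t \<longrightarrow>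
     c * (1 + t) \<le> jbracket (t *\<^sub>R \<eta> + d) \<and> jbracket (t *\<^sub>R \<eta> + d) \<le> B * (1 + t)"
proof -
  have "((\<lambda>t::real. C * (1 + t) powr (- \<mu>)) \<longlongrightarrow> C * 0) at_top"
    using assms(1) by (intro tendsto_mult_left tendsto_neg_powr filterlim_tendsto_add_at_top[OF tendsto_const filterlim_ident]) auto
  then have "\<forall>\<^sub>F t in at_top. C * (1 + t) powr (- \<mu>) < 1 / (4 * R)"
    using assms(3) by (intro order_tendstoD(2)) auto
  then obtain T0 where T0: "\<And>t. t \<ge> T0 \<Longrightarrow> C * (1 + t) powr (- \<mu>) < 1 / (4 * R)"
    by (auto simp: eventually_at_top_linorder)
  \<comment> \<open>Once \<open>t \<ge> 3\<close>, a displacement of at most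
    \<open>(1 + t) / (4 * R)\<close> leaves \<open>(1 + t) / (2 * R)\<close> of the ray length
    \<open>t / R\<close>.\<close>
  define T where "T = max T0 3"
  define c where "c = min (1 / (2 * R)) (1 / (1 + T))"
  have T: "T \<ge> 3" by (simp add: T_def)
  have c: "c > 0" using assms T by (simp add: c_def)
  have p1: "(1 + t) powr (1 - \<mu>) = (1 + t) powr (- \<mu>) * (1 + t)" if "t \<ge> 0" for t
    using powr_add[of "1 + t" "- \<mu>" 1] that by (simp add: add.commute)
  have lower: "c * (1 + t) \<le> jbracket (t *\<^sub>R \<eta> + d)" if "t \<ge> 0" "1 / R \<le> norm \<eta>" "norm d \<le> C * tpow (1 - \<mu>) t" for t and \<eta> d :: "real^'n"
  proof (cases "t \<ge> T")
    case True
    have "norm d \<le> C * (1 + t) powr (- \<mu>) * (1 + t)" using that(3) by (simp add: p1[OF that(1)])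
    also have "\<dots> \<le> 1 / (4 * R) * (1 + t)" using T0[of t] True that(1) by (intro mult_right_mono) (auto simp: T_def)
    finally have d: "norm d \<le> 1 / (4 * R) * (1 + t)" .
    have "t * (1 / R) \<le> t * norm \<eta>" using that by (intro mult_left_mono) auto
    then have "norm (t *\<^sub>R \<eta>) \<ge> t / R" using that(1) by simp
    then have "norm (t *\<^sub>R \<eta> + d) \<ge> t / R - 1 / (4 * R) * (1 + t)" using d norm_diff_ineq[of "t *\<^sub>R \<eta>" d] by linarith
    moreover have "t / R - 1 / (4 * R) * (1 + t) \<ge> 1 / (2 * R) * (1 + t)" using True T assms(3) by (simp add: field_simps)
    moreover have "c * (1 + t) \<le> 1 / (2 * R) * (1 + t)" using that(1) by (intro mult_right_mono) (auto simp: c_def)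
    ultimately show ?thesis using norm_le_jbracket[of "t *\<^sub>R \<eta> + d"] by linarith
  next
    case False
    have "c * (1 + t) \<le> 1 / (1 + T) * (1 + t)" using that(1) by (intro mult_right_mono) (auto simp: c_def)
    also have "\<dots> \<le> 1" using False that(1) by simp
    also have "\<dots> \<le> jbracket (t *\<^sub>R \<eta> + d)" by (rule jbracket_ge_1)
    finally show ?thesis .
  qed
  have upper: "jbracket (t *\<^sub>R \<eta> + d) \<le> (1 + R + C) * (1 + t)" if "t \<ge> 0" "norm \<eta> \<le> R" "norm d \<le> C * tpow (1 - \<mu>) t" for t and \<eta> d :: "real^'n"
  proof -
    have "(1 + t) powr (1 - \<mu>) \<le> (1 + t) powr 1" using that(1) assms by (intro powr_mono) auto
    then have "norm d \<le> C * (1 + t)" using that(1,3) assms(4) order_trans[OF that(3) mult_left_mono] by simp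
    moreover have "norm (t *\<^sub>R \<eta>) \<le> t * R" using that by (simp add: mult_left_mono)
    ultimately have "norm (t *\<^sub>R \<eta> + d) \<le> t * R + C * (1 + t)" using norm_triangle_le add_mono by blast
    then show ?thesis using jbracket_le[of "t *\<^sub>R \<eta> + d"] that(1) assms by (simp add: algebra_simps)
  qed
  have "1 + R + C > 0" using assms by simp
  with c lower upper show ?thesis by blast
qed

lemma integral_tpow:
  assumes "m > -1" "t \<ge> 0"
  shows "tpow m integrable_on {0..t}" "integral {0..t} (tpow m) \<le> tpow (m + 1) t / (m + 1)"
proof -
  have "((\<lambda>s. tpow (m + 1) s / (m + 1)) has_vector_derivative tpow m s) (at s within {0..t})" if "s \<in> {0..t}" for s
  proof -
    have "((\<lambda>s. tpow (m + 1) s / (m + 1)) has_real_derivative tpow m s) (at s within {0..t})"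
      using that assms by (auto intro!: derivative_eq_intros)
    then show ?thesis by (simp add: has_real_derivative_iff_has_vector_derivative)
  qed
  then have "(tpow m has_integral tpow (m + 1) t / (m + 1) - tpow (m + 1) 0 / (m + 1)) {0..t}"
    using assms(2) by (intro fundamental_theorem_of_calculus) auto
  note I = this
  show "tpow m integrable_on {0..t}" by (rule has_integral_integrable[OF I])
  show "integral {0..t} (tpow m) \<le> tpow (m + 1) t / (m + 1)" using assms(1) by (simp add: integral_unique[OF I])
qed

text \<open>The lower bound on the momentum makes all rays \<open>t *\<^sub>R \<eta>\<close> escape
  at a uniform speed.\<close>

definition momentum_region :: "real \<Rightarrow> (real \<times> (real^'n)) set" where
  "momentum_region R = {(t, \<eta>). 1 / R \<le> norm \<eta> \<and> norm \<eta> \<le> R}"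

text \<open>The modified position is allowed to grow like \<open>t powr (1 - \<mu>)\<close>: this much is known about a
  trajectory before its modified position has been shown to be bounded.\<close>

definition phase_region :: "real \<Rightarrow> real \<Rightarrow> (real \<times> (real^'n) \<times> (real^'n)) set" where
  "phase_region \<mu> R = {(t, y, \<eta>). norm y \<le> R * tpow (1 - \<mu>) t \<and> 1 / R \<le> norm \<eta> \<and> norm \<eta> \<le> R}"

abbreviation MR :: "(real \<times> (real^'n)) set set" where "MR \<equiv> momentum_region ` {0<..}"

section \<open>A priori growth of escaping trajectories\<close>

context long_range_metric
begin

abbreviation PR :: "(real \<times> (real^'n) \<times> (real^'n)) set set" where "PR \<equiv> phase_region \<mu> ` {0<..}"

text \<open>The derivative of \<open>x \<bullet> \<xi>\<close> is twice the energy minus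
  \<open>x \<bullet> grad_x\<close>, and the second term tends to 0 because the trajectory escapes.
  So \<open>x \<bullet> \<xi>\<close> grows linearly and, with bounded momentum, so does
  \<open>norm x\<close>. This rate makes the derivative of \<open>x - t \<xi>\<close> of order
  \<open>tpow (- \<mu>)\<close>, and integration gives the bound.\<close>

lemma trajectory_growth:
  assumes \<gamma>: "\<And>t. (\<gamma> has_vector_derivative H (\<gamma> t)) (at t)" and \<xi>0: "snd (\<gamma> 0) \<noteq> 0"
    and esc: "filterlim (\<lambda>t. norm (fst (\<gamma> t))) at_top at_top"
  shows "\<exists>R>0. \<forall>t\<ge>0. norm (fst (\<gamma> t) - t *\<^sub>R snd (\<gamma> t)) \<le> R * tpow (1 - \<mu>) t \<and>
    1 / R \<le> norm (snd (\<gamma> t)) \<and> norm (snd (\<gamma> t)) \<le> R"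
proof -
  define x where "x t = fst (\<gamma> t)" for t
  define \<xi> where "\<xi> t = snd (\<gamma> t)" for t
  have dx: "(x has_vector_derivative a (x t) *v \<xi> t) (at t)" and d\<xi>: "(\<xi> has_vector_derivative - grad_x (x t) (\<xi> t)) (at t)" for t
    using bounded_linear.has_vector_derivative[OF bounded_linear_fst \<gamma>] bounded_linear.has_vector_derivative[OF bounded_linear_snd \<gamma>]
    by (simp_all add: x_def[abs_def] \<xi>_def[abs_def] H_def)
  define E where "E = kinetic a (x 0) (\<xi> 0)"
  have E: "kinetic a (x t) (\<xi> t) = E" for t
    unfolding E_def x_def \<xi>_def by (rule kinetic_conserved[OF \<gamma>, of UNIV]) auto
  have E0: "E > 0" unfolding E_def using \<xi>0 a_pos by (simp add: kinetic_inner \<xi>_def)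
  obtain c1 C1 where c1: "c1 > 0" "C1 > 0" "\<And>x v. c1 * (norm v)\<^sup>2 \<le> kinetic a x v" "\<And>x v. kinetic a x v \<le> C1 * (norm v)\<^sup>2"
    using kinetic_bounds by blast
  define B where "B = sqrt (E / c1)"
  define b0 where "b0 = sqrt (E / C1)"
  have B0: "B > 0" "b0 > 0" using E0 c1 by (auto simp: B_def b0_def)
  have \<xi>B: "norm (\<xi> t) \<le> B" for t
    unfolding B_def using c1(3)[of "\<xi> t" "x t"] E[of t] c1(1) by (intro real_le_rsqrt) (simp add: pos_le_divide_eq mult.commute)
  have \<xi>b: "b0 \<le> norm (\<xi> t)" for t
    unfolding b0_def using c1(4)[of "x t" "\<xi> t"] E[of t] c1(2) by (intro real_le_lsqrt) (auto simp: pos_divide_le_eq mult.commute)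
  obtain C where C: "C > 0" "\<And>x v. norm (a x *v v - v) \<le> C * jbracket x powr (- \<mu>) * norm v"
     "\<And>x v. norm (grad_x x v) \<le> C * jbracket x powr (- \<mu> - 1) * (norm v)\<^sup>2" using coefficient_bounds by blast
  \<comment> \<open>The factor \<open>x\<close> uses up one power of the bracket in the bound for
    \<open>grad_x\<close>; what is left still vanishes at infinity.\<close>
  have virial: "\<bar>x t \<bullet> grad_x (x t) (\<xi> t)\<bar> \<le> C * B\<^sup>2 * jbracket (x t) powr (- \<mu>)" for t
  proof -
    have "\<bar>x t \<bullet> grad_x (x t) (\<xi> t)\<bar> \<le> norm (x t) * norm (grad_x (x t) (\<xi> t))" by (rule Cauchy_Schwarz_ineq2)
    also have "\<dots> \<le> jbracket (x t) * (C * jbracket (x t) powr (- \<mu> - 1) * B\<^sup>2)"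
    proof (intro mult_mono norm_le_jbracket)
      have "C * jbracket (x t) powr (- \<mu> - 1) * (norm (\<xi> t))\<^sup>2 \<le> C * jbracket (x t) powr (- \<mu> - 1) * B\<^sup>2"
        using \<xi>B C(1) by (intro mult_left_mono power_mono) auto
      then show "norm (grad_x (x t) (\<xi> t)) \<le> C * jbracket (x t) powr (- \<mu> - 1) * B\<^sup>2"
        using C(3)[of "x t" "\<xi> t"] by linarith
    qed (use jbracket_ge_1[of "x t"] in auto)
    also have "\<dots> = C * B\<^sup>2 * (jbracket (x t) powr (- \<mu> - 1) * jbracket (x t) powr 1)"
      using jbracket_ge_1[of "x t"] by simp
    also have "jbracket (x t) powr (- \<mu> - 1) * jbracket (x t) powr 1 = jbracket (x t) powr (- \<mu>)"
      unfolding powr_add[symmetric] by simp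
    finally show ?thesis .
  qed
  have "filterlim (\<lambda>t. jbracket (x t)) at_top at_top"
    by (rule filterlim_at_top_mono[OF esc]) (auto simp: x_def norm_le_jbracket)
  then have "((\<lambda>t. C * B\<^sup>2 * jbracket (x t) powr (- \<mu>)) \<longlongrightarrow> C * B\<^sup>2 * 0) at_top"
    using mu by (intro tendsto_mult_left tendsto_neg_powr) auto
  then have "\<forall>\<^sub>F t in at_top. C * B\<^sup>2 * jbracket (x t) powr (- \<mu>) < E" using E0 by (intro order_tendstoD(2)) auto
  then obtain T1 where T1: "\<And>t. t \<ge> T1 \<Longrightarrow> C * B\<^sup>2 * jbracket (x t) powr (- \<mu>) < E" by (auto simp: eventually_at_top_linorder)
  define T0 where "T0 = max T1 0"
  have dv: "((\<lambda>t. x t \<bullet> \<xi> t) has_real_derivative 2 * E - x t \<bullet> grad_x (x t) (\<xi> t)) (at t)" for t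
  proof -
    have "((\<lambda>t. x t \<bullet> \<xi> t) has_derivative (\<lambda>h. x t \<bullet> (h *\<^sub>R - grad_x (x t) (\<xi> t)) + (h *\<^sub>R (a (x t) *v \<xi> t)) \<bullet> \<xi> t)) (at t)"
      by (rule has_derivative_inner[OF dx[unfolded has_vector_derivative_def] d\<xi>[unfolded has_vector_derivative_def]])
    moreover have "(\<lambda>h. x t \<bullet> (h *\<^sub>R - grad_x (x t) (\<xi> t)) + (h *\<^sub>R (a (x t) *v \<xi> t)) \<bullet> \<xi> t) = (*) (2 * E - x t \<bullet> grad_x (x t) (\<xi> t))"
      using E[of t] by (auto simp: kinetic_inner fun_eq_iff inner_commute algebra_simps)
    ultimately show ?thesis by (simp only: has_field_derivative_def)
  qed
  have v: "x t \<bullet> \<xi> t \<ge> x T0 \<bullet> \<xi> T0 + E * (t - T0)" if "t \<ge> T0" for t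
  proof -
    have "x T0 \<bullet> \<xi> T0 - E * T0 \<le> x t \<bullet> \<xi> t - E * t"
    proof (rule DERIV_nonneg_imp_nondecreasing[OF that])
      fix s assume "T0 \<le> s" "s \<le> t"
      then have "x s \<bullet> grad_x (x s) (\<xi> s) \<le> E" using virial[of s] T1[of s] by (simp add: T0_def)
      moreover have "((\<lambda>t. x t \<bullet> \<xi> t - E * t) has_real_derivative (2 * E - x s \<bullet> grad_x (x s) (\<xi> s)) - E) (at s)"
        by (intro DERIV_diff dv) (auto intro!: derivative_eq_intros)
      ultimately show "\<exists>y. ((\<lambda>t. x t \<bullet> \<xi> t - E * t) has_real_derivative y) (at s) \<and> 0 \<le> y" by (intro exI conjI) auto
    qed
    then show ?thesis by (simp add: algebra_simps)
  qed
  \<comment> \<open>From \<open>T2\<close> on, half of the growth \<open>E * t\<close> compensates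
    for the value of \<open>x \<bullet> \<xi>\<close> at \<open>T0\<close> and the delay
    \<open>T0\<close>, which leaves \<open>E * (1 + t) / 2\<close>.\<close>
  define T2 where "T2 = max T0 (2 * (T0 - (x T0 \<bullet> \<xi> T0) / E) + 1)"
  define c where "c = min (E / (2 * B)) (1 / (1 + T2))"
  have T2: "T2 \<ge> 0" "T2 \<ge> T0" by (auto simp: T2_def T0_def)
  have c: "c > 0" using T2 E0 B0 by (simp add: c_def)
  have lower: "c * (1 + t) \<le> jbracket (x t)" if "t \<ge> 0" for t
  proof (cases "t \<ge> T2")
    case True
    have "2 * (T0 - (x T0 \<bullet> \<xi> T0) / E) + 1 \<le> t" using True by (simp add: T2_def)
    then have "E * (2 * (T0 - (x T0 \<bullet> \<xi> T0) / E) + 1) \<le> E * t" using E0 by (intro mult_left_mono) auto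
    then have "2 * E * T0 - 2 * (x T0 \<bullet> \<xi> T0) + E \<le> E * t" using E0 by (simp add: algebra_simps)
    then have "E * (1 + t) / 2 \<le> x T0 \<bullet> \<xi> T0 + E * (t - T0)"
      by (simp add: distrib_left right_diff_distrib)
    also have "\<dots> \<le> x t \<bullet> \<xi> t" using v[of t] True T2 by auto
    also have "\<dots> \<le> norm (x t) * norm (\<xi> t)" by (rule norm_cauchy_schwarz)
    also have "\<dots> \<le> jbracket (x t) * B" using \<xi>B B0 jbracket_ge_1[of "x t"] by (intro mult_mono norm_le_jbracket) auto
    finally have "E / (2 * B) * (1 + t) \<le> jbracket (x t)" using B0 by (simp add: field_simps)
    moreover have "c * (1 + t) \<le> E / (2 * B) * (1 + t)" using that by (intro mult_right_mono) (auto simp: c_def)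
    ultimately show ?thesis by linarith
  next
    case False
    have "c * (1 + t) \<le> 1 / (1 + T2) * (1 + t)" using that by (intro mult_right_mono) (auto simp: c_def)
    also have "\<dots> \<le> 1" using False that by simp
    finally show ?thesis using jbracket_ge_1[of "x t"] by linarith
  qed
  have jb: "jbracket (x t) powr m \<le> c powr m * tpow m t" if "t \<ge> 0" "m \<le> 0" for t m
  proof -
    have "jbracket (x t) powr m \<le> (c * (1 + t)) powr m" using lower[OF that(1)] c that by (intro powr_mono2') auto
    then show ?thesis using c that(1) by (simp add: powr_mult)
  qed
  define M where "M = C * c powr (- \<mu>) * B + C * c powr (- \<mu> - 1) * B\<^sup>2"
  \<comment> \<open>The leading velocity \<open>\<xi>\<close> cancels. Both remaining terms have
    order \<open>tpow (- \<mu>)\<close>, the second because the factor \<open>t\<close> meets a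
    bound of order \<open>tpow (- \<mu> - 1)\<close>.\<close>
  have du: "((\<lambda>t. x t - t *\<^sub>R \<xi> t) has_vector_derivative (a (x t) *v \<xi> t - \<xi> t) + t *\<^sub>R grad_x (x t) (\<xi> t)) (at t)" for t
  proof -
    have "((\<lambda>t. t *\<^sub>R \<xi> t) has_vector_derivative t *\<^sub>R (- grad_x (x t) (\<xi> t)) + 1 *\<^sub>R \<xi> t) (at t)"
      by (rule has_vector_derivative_scaleR) (auto intro: d\<xi>)
    from has_vector_derivative_diff[OF dx[of t] this] show ?thesis by (simp add: algebra_simps)
  qed
  have nu: "norm ((a (x t) *v \<xi> t - \<xi> t) + t *\<^sub>R grad_x (x t) (\<xi> t)) \<le> M * tpow (- \<mu>) t" if "t \<ge> 0" for t
  proof -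
    have "norm (a (x t) *v \<xi> t - \<xi> t) \<le> C * jbracket (x t) powr (- \<mu>) * norm (\<xi> t)" by (rule C(2))
    also have "\<dots> \<le> C * (c powr (- \<mu>) * tpow (- \<mu>) t) * B"
      using jb[OF that, of "- \<mu>"] mu C(1) \<xi>B by (intro mult_mono mult_left_mono) auto
    finally have 1: "norm (a (x t) *v \<xi> t - \<xi> t) \<le> C * c powr (- \<mu>) * B * tpow (- \<mu>) t" by (simp add: mult_ac)
    have "norm (t *\<^sub>R grad_x (x t) (\<xi> t)) \<le> (1 + t) * norm (grad_x (x t) (\<xi> t))" using that by (simp add: mult_right_mono)
    also have "\<dots> \<le> (1 + t) * (C * jbracket (x t) powr (- \<mu> - 1) * (norm (\<xi> t))\<^sup>2)" using that by (intro mult_left_mono C(3)) auto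
    also have "\<dots> \<le> (1 + t) * (C * (c powr (- \<mu> - 1) * tpow (- \<mu> - 1) t) * B\<^sup>2)"
      using jb[OF that, of "- \<mu> - 1"] mu C(1) \<xi>B that by (intro mult_mono mult_left_mono power_mono) auto
    also have "\<dots> = C * c powr (- \<mu> - 1) * B\<^sup>2 * (tpow (- \<mu> - 1) t * tpow 1 t)" using that by simp
    also have "tpow (- \<mu> - 1) t * tpow 1 t = tpow (- \<mu>) t" unfolding powr_add[symmetric] by simp
    finally have 2: "norm (t *\<^sub>R grad_x (x t) (\<xi> t)) \<le> C * c powr (- \<mu> - 1) * B\<^sup>2 * tpow (- \<mu>) t" .
    show ?thesis unfolding M_def distrib_right by (intro norm_triangle_mono 1 2)
  qed
  have M: "M \<ge> 0" using C B0 by (simp add: M_def)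
  define N where "N = norm (x 0) + M / (1 - \<mu>)"
  have ub: "norm (x t - t *\<^sub>R \<xi> t) \<le> N * tpow (1 - \<mu>) t" if "t \<ge> 0" for t
  proof -
    have ge1: "tpow (1 - \<mu>) t \<ge> 1" using that mu by (simp add: ge_one_powr_ge_zero)
    have "norm (x t - t *\<^sub>R \<xi> t) \<le> norm (x 0) + M / (1 - \<mu>) * tpow (1 - \<mu>) t"
    proof (cases "t = 0")
      case False
      have "norm ((x t - t *\<^sub>R \<xi> t) - (x 0 - 0 *\<^sub>R \<xi> 0)) \<le> M / (1 - \<mu>) * tpow (1 - \<mu>) t - M / (1 - \<mu>) * tpow (1 - \<mu>) 0"
      proof (rule differentiable_bound_general[where a = 0 and b = t and f = "\<lambda>t. x t - t *\<^sub>R \<xi> t" and \<phi> = "\<lambda>t. M / (1 - \<mu>) * tpow (1 - \<mu>) t"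
            and f' = "\<lambda>t. (a (x t) *v \<xi> t - \<xi> t) + t *\<^sub>R grad_x (x t) (\<xi> t)" and \<phi>' = "\<lambda>t. M * tpow (- \<mu>) t"])
        show "0 < t" using that False by simp
        show "continuous_on {0..t} (\<lambda>t. x t - t *\<^sub>R \<xi> t)"
          by (rule continuous_on_vector_derivative[OF has_vector_derivative_at_within[OF du]])
        show "continuous_on {0..t} (\<lambda>t. M / (1 - \<mu>) * tpow (1 - \<mu>) t)" by (intro continuous_intros) auto
        fix s assume s: "0 < s" "s < t"
        show "((\<lambda>t. x t - t *\<^sub>R \<xi> t) has_vector_derivative (a (x s) *v \<xi> s - \<xi> s) + s *\<^sub>R grad_x (x s) (\<xi> s)) (at s)" by (rule du)
        have "((\<lambda>t. M / (1 - \<mu>) * tpow (1 - \<mu>) t) has_real_derivative M * tpow (- \<mu>) s) (at s)"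
          using s mu by (auto intro!: derivative_eq_intros)
        then show "((\<lambda>t. M / (1 - \<mu>) * tpow (1 - \<mu>) t) has_vector_derivative M * tpow (- \<mu>) s) (at s)"
          by (simp add: has_real_derivative_iff_has_vector_derivative)
        show "norm ((a (x s) *v \<xi> s - \<xi> s) + s *\<^sub>R grad_x (x s) (\<xi> s)) \<le> M * tpow (- \<mu>) s" using nu s by simp
      qed
      moreover have "M / (1 - \<mu>) * tpow (1 - \<mu>) 0 \<ge> 0" using M mu by simp
      ultimately show ?thesis using norm_triangle_sub[of "x t - t *\<^sub>R \<xi> t" "x 0"] by simp
    qed (use M mu in auto)
    also have "\<dots> \<le> norm (x 0) * tpow (1 - \<mu>) t + M / (1 - \<mu>) * tpow (1 - \<mu>) t"
      using mult_left_mono[OF ge1 norm_ge_zero[of "x 0"]] by simp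
    finally show ?thesis by (simp add: N_def distrib_right)
  qed
  define R where "R = max N (max B (1 / b0))"
  have "R > 0" using B0 by (simp add: R_def)
  moreover have "1 / R \<le> b0"
  proof -
    have "1 / R \<le> 1 / (1 / b0)" using B0 \<open>R > 0\<close> by (intro divide_left_mono) (auto simp: R_def)
    then show ?thesis by simp
  qed
  moreover have "N * tpow (1 - \<mu>) t \<le> R * tpow (1 - \<mu>) t" for t by (intro mult_right_mono) (auto simp: R_def)
  moreover have "B \<le> R" by (simp add: R_def)
  ultimately show ?thesis using ub \<xi>B \<xi>b unfolding x_def \<xi>_def by (meson order_trans)
qed

end

section \<open>The vector field in modified coordinates\<close>

context long_range_metric
begin

abbreviation SE :: "(real^'n) set" where "SE \<equiv> UNIV - {0}"
abbreviation SP :: "((real^'n) \<times> (real^'n)) set" where "SP \<equiv> phase_space"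

lemma open_SE: "open SE" by (simp add: open_delete)
lemma open_SP: "open SP" unfolding phase_space_def by (intro open_Times) auto

text \<open>The gradient in \<open>\<eta>\<close> of
  \<open>kinetic a (s *\<^sub>R \<eta>) \<eta>\<close> minus its free part \<open>\<eta>\<close>;
  compare \<open>kinetic_ray_has_derivative\<close>.\<close>

definition radial :: "real \<Rightarrow> real^'n \<Rightarrow> real^'n" where
  "radial s \<eta> = (a (s *\<^sub>R \<eta>) *v \<eta> - \<eta>) + s *\<^sub>R grad_x (s *\<^sub>R \<eta>) \<eta>"

text \<open>The correction by which the gradient of \<open>\<Psi>\<close> differs from the free
  motion \<open>t *\<^sub>R \<eta>\<close>; compare \<open>grad_Psi\<close>.\<close>

definition Q :: "real \<Rightarrow> real^'n \<Rightarrow> real^'n" where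
  "Q t \<eta> = integral {0..t} (\<lambda>s. radial s \<eta>)"

lemma Ck_family_time: "open S \<Longrightarrow> Ck_family k \<K> {0..} S (tpow 1) (\<lambda>t z. t)"
  by (rule Ck_family_const_time[where C = 1]) (auto intro!: continuous_intros)

lemma Ck_family_id_MR: "Ck_family k MR {0..} SE (tpow 0) (\<lambda>t \<eta>. \<eta>)"
proof (rule Ck_family_bounded_linear[where c = 1, OF open_SE bounded_linear_ident])
  have "norm \<eta> \<le> R * tpow 0 t" if "(t, \<eta>) \<in> momentum_region R" "t \<in> {0..}" for t R and \<eta> :: "real^'n"
    using that by (simp add: momentum_region_def)
  then show "weight_bounded MR {0..} SE (tpow 0) (\<lambda>t \<eta>. \<eta>)"
    unfolding weight_bounded_def split_beta by (auto intro!: continuous_intros)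
qed auto

lemma Ck_family_ray_MR: "Ck_family k MR {0..} SE (tpow 1) (\<lambda>t \<eta>. t *\<^sub>R \<eta>)"
  by (rule Ck_family_tpow_scaleR[OF open_SE Ck_family_time[OF open_SE] Ck_family_id_MR]) simp

lemma jbracket_ray_MR:
  assumes "K \<in> MR"
  shows "\<exists>c>0. \<exists>C>0. \<forall>t\<ge>0. \<forall>z\<in>SE. (t, z) \<in> K \<longrightarrow> c * (1 + t) \<le> jbracket (t *\<^sub>R z) \<and> jbracket (t *\<^sub>R z) \<le> C * (1 + t)"
proof -
  obtain R where R: "R > 0" "K = momentum_region R" using assms by auto
  have "0 < \<mu>" using mu by simp
  from jbracket_ray_bounds[OF this mu(2) R(1) order_refl] obtain c B where cB: "c > 0" "B > 0"
    "\<forall>t\<ge>0. \<forall>\<eta> d :: real^'n. 1 / R \<le> norm \<eta> \<longrightarrow> norm \<eta> \<le> R \<longrightarrow> norm d \<le> 0 * tpow (1 - \<mu>) t \<longrightarrow>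
     c * (1 + t) \<le> jbracket (t *\<^sub>R \<eta> + d) \<and> jbracket (t *\<^sub>R \<eta> + d) \<le> B * (1 + t)" by blast
  have "\<forall>t\<ge>0. \<forall>z\<in>SE. (t, z) \<in> K \<longrightarrow> c * (1 + t) \<le> jbracket (t *\<^sub>R z) \<and> jbracket (t *\<^sub>R z) \<le> B * (1 + t)"
    using cB(3)[rule_format, of _ _ 0] R(2) by (auto simp: momentum_region_def)
  then show ?thesis using cB by blast
qed

text \<open>The coefficients \<open>D\<close> are arbitrary, so that the lemma covers
  \<open>grad_x\<close> at one position as well as its difference between two positions.\<close>

lemma grad_x_Ck_family:
  assumes "open S"
    and D: "\<And>i m n. Ck_family k \<K> {0..} S (tpow r) (\<lambda>t z. D t z i m n)"
    and \<eta>: "\<And>m. Ck_family k \<K> {0..} S (tpow 0) (\<lambda>t z. \<eta> t z $ m)"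
  shows "Ck_family k \<K> {0..} S (tpow r) (\<lambda>t z. (\<chi> i. \<Sum>m\<in>UNIV. \<Sum>n\<in>UNIV. 1/2 * D t z i m n * \<eta> t z $ m * \<eta> t z $ n) :: real^'n)"
proof -
  have h: "Ck_family k \<K> {0..} S (tpow r) (\<lambda>t z. 1/2 * D t z i m n)" for i m n
    by (rule Ck_family_linear[OF assms(1) bounded_linear_mult_right D])
  have "Ck_family k \<K> {0..} S (tpow r) (\<lambda>t z. 1/2 * D t z i m n * \<eta> t z $ m * \<eta> t z $ n)" for i m n
    by (rule Ck_family_tpow_mult[OF assms(1) Ck_family_tpow_mult[OF assms(1) h \<eta>, of r] \<eta>]) auto
  then show ?thesis by (intro Ck_family_vec Ck_family_sum assms(1))
qed

lemma radial_Ck_family: "Ck_family k MR {0..} SE (tpow (- \<mu>)) radial"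
proof -
  have \<eta>: "Ck_family k MR {0..} SE (tpow 0) (\<lambda>t \<eta>. \<eta> $ m)" for m
    by (rule Ck_family_linear[OF open_SE bounded_linear_vec_nth Ck_family_id_MR])
  have "Ck_family k MR {0..} SE (tpow (- \<mu>)) (\<lambda>t \<eta>. b m n (t *\<^sub>R \<eta>) * \<eta> $ n)" for m n
    by (rule Ck_family_tpow_mult[OF open_SE symbol_compose[OF open_SE b_symbol Ck_family_ray_MR jbracket_ray_MR] \<eta>]) auto
  then have 1: "Ck_family k MR {0..} SE (tpow (- \<mu>)) (\<lambda>t \<eta>. (\<chi> m. \<Sum>n\<in>UNIV. b m n (t *\<^sub>R \<eta>) * \<eta> $ n) :: real^'n)"
    by (intro Ck_family_vec Ck_family_sum open_SE)
  have "Ck_family k MR {0..} SE (tpow (- \<mu> - 1)) (\<lambda>t \<eta>. Db i m n (t *\<^sub>R \<eta>))" for i m n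
    by (rule symbol_compose[OF open_SE Db_symbol Ck_family_ray_MR jbracket_ray_MR])
  then have "Ck_family k MR {0..} SE (tpow (- \<mu> - 1)) (\<lambda>t \<eta>. grad_x (t *\<^sub>R \<eta>) \<eta>)"
    unfolding grad_x_def by (rule grad_x_Ck_family[OF open_SE _ \<eta>])
  then have 2: "Ck_family k MR {0..} SE (tpow (- \<mu>)) (\<lambda>t \<eta>. t *\<^sub>R grad_x (t *\<^sub>R \<eta>) \<eta>)"
    by (rule Ck_family_tpow_scaleR[OF open_SE Ck_family_time[OF open_SE]]) simp
  have "radial = (\<lambda>t \<eta>. (\<chi> m. \<Sum>n\<in>UNIV. b m n (t *\<^sub>R \<eta>) * \<eta> $ n) + t *\<^sub>R grad_x (t *\<^sub>R \<eta>) \<eta>)"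
    by (simp add: radial_def fun_eq_iff vec_eq_iff a_mult_b)
  then show ?thesis using Ck_family_add[OF open_SE 1 2] by simp
qed

lemma Q_Ck_family: "Ck_family k MR {0..} SE (tpow (1 - \<mu>)) Q"
proof -
  have "Ck_family k MR {0..} SE (\<lambda>t. tpow (- \<mu> + 1) t / (- \<mu> + 1)) (\<lambda>t \<eta>. integral {0..t} (\<lambda>s. radial s \<eta>))"
    by (rule Ck_family_integral[OF open_SE radial_Ck_family]) (use mu integral_tpow[of "- \<mu>"] in \<open>auto simp: momentum_region_def\<close>)
  then have "Ck_family k MR {0..} SE (tpow (1 - \<mu>)) (\<lambda>t \<eta>. integral {0..t} (\<lambda>s. radial s \<eta>))"
    by (rule Ck_family_mono_weight[where c = "1 / (1 - \<mu>)"]) (use mu in auto)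
  then show ?thesis unfolding Q_def[abs_def] .
qed

lemma Q_bound: "\<exists>C\<ge>0. \<forall>t\<ge>0. \<forall>\<eta>. 1 / R \<le> norm \<eta> \<and> norm \<eta> \<le> R \<longrightarrow> norm (Q t \<eta>) \<le> C * tpow (1 - \<mu>) t" if "R > 0"
proof -
  have "momentum_region R \<in> MR" using that by auto
  then obtain C where C: "\<forall>t\<in>{0..}. \<forall>\<eta>\<in>SE. (t, \<eta>) \<in> momentum_region R \<longrightarrow> norm (Q t \<eta>) \<le> C * tpow (1 - \<mu>) t"
    using Ck_family_weight_bounded[OF Q_Ck_family[of 0]] unfolding weight_bounded_def by blast
  have "norm (Q t \<eta>) \<le> \<bar>C\<bar> * tpow (1 - \<mu>) t" if "t \<ge> 0" "1 / R \<le> norm \<eta>" "norm \<eta> \<le> R" for t \<eta>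
  proof -
    have "1 / R > 0" using \<open>R > 0\<close> by simp
    then have "norm \<eta> > 0" using that(2) by linarith
    then have "norm (Q t \<eta>) \<le> C * tpow (1 - \<mu>) t" using C that by (auto simp: momentum_region_def)
    also have "\<dots> \<le> \<bar>C\<bar> * tpow (1 - \<mu>) t" by (intro mult_right_mono) auto
    finally show ?thesis .
  qed
  then show ?thesis by (intro exI[of _ "\<bar>C\<bar>"]) auto
qed

text \<open>In the coordinates \<open>y = x - t \<eta> - Q t \<eta>\<close> (that is, \<open>x - \<nabla>\<Psi>(t, \<eta>)\<close>), Hamilton's equations become
  the non-autonomous system with right-hand side \<open>X\<close>.\<close>

definition position :: "real \<Rightarrow> (real^'n) \<times> (real^'n) \<Rightarrow> real^'n" where
  "position t z = t *\<^sub>R snd z + (fst z + Q t (snd z))"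

definition X2 :: "real \<Rightarrow> (real^'n) \<times> (real^'n) \<Rightarrow> real^'n" where
  "X2 t z = - grad_x (position t z) (snd z)"

text \<open>The values subtracted at the ray point \<open>t *\<^sub>R snd z\<close> come from
  \<open>radial\<close>, the time derivative of \<open>Q\<close>. The last term is the change of
  \<open>Q\<close> caused by the varying momentum.\<close>

definition X1 :: "real \<Rightarrow> (real^'n) \<times> (real^'n) \<Rightarrow> real^'n" where
  "X1 t z = (a (position t z) *v snd z - a (t *\<^sub>R snd z) *v snd z)
     + t *\<^sub>R (grad_x (position t z) (snd z) - grad_x (t *\<^sub>R snd z) (snd z))
     - frechet_derivative (Q t) (at (snd z)) (X2 t z)"

definition X :: "real \<Rightarrow> (real^'n) \<times> (real^'n) \<Rightarrow> (real^'n) \<times> (real^'n)" where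
  "X t z = (X1 t z, X2 t z)"

lemma Ck_family_snd_PR:
  assumes "Ck_family k MR {0..} SE w f"
  shows "Ck_family k PR {0..} SP w (\<lambda>t z. f t (snd z))"
proof (rule Ck_family_compose_linear[OF open_SP bounded_linear_snd _ _ assms])
  fix K assume "K \<in> PR"
  then obtain R where "R > 0" "K = phase_region \<mu> R" by auto
  then show "\<exists>K'\<in>MR. \<forall>t\<in>{0..}. \<forall>z\<in>SP. (t, z) \<in> K \<longrightarrow> (t, snd z) \<in> K'"
    by (intro bexI[of _ "momentum_region R"]) (auto simp: phase_region_def momentum_region_def)
qed (auto simp: phase_space_def)

lemma Ck_family_fst_PR: "Ck_family k PR {0..} SP (tpow (1 - \<mu>)) (\<lambda>t. fst)"
proof (rule Ck_family_bounded_linear[where c = 1, OF open_SP bounded_linear_fst])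
  show "weight_bounded PR {0..} SP (tpow (1 - \<mu>)) (\<lambda>t. fst)"
    unfolding weight_bounded_def split_beta
  proof (intro conjI ballI)
    fix K assume "K \<in> PR"
    then obtain R where "K = phase_region \<mu> R" by auto
    then show "\<exists>C. \<forall>t\<in>{0..}. \<forall>z\<in>SP. (t, z) \<in> K \<longrightarrow> norm (fst z) \<le> C * tpow (1 - \<mu>) t"
      by (intro exI[of _ R]) (auto simp: phase_region_def)
  qed (intro continuous_intros)
  show "1 \<le> 1 * tpow (1 - \<mu>) t" if "t \<in> {0..}" for t using that mu by (simp add: ge_one_powr_ge_zero)
qed

lemma shift_Ck_family: "Ck_family k PR {0..} SP (tpow (1 - \<mu>)) (\<lambda>t z. fst z + Q t (snd z))"
  by (rule Ck_family_add[OF open_SP Ck_family_fst_PR Ck_family_snd_PR[OF Q_Ck_family]])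

lemma ray_Ck_family: "Ck_family k PR {0..} SP (tpow 1) (\<lambda>t z. t *\<^sub>R snd z)"
  by (rule Ck_family_snd_PR[OF Ck_family_ray_MR])

lemma position_Ck_family: "Ck_family k PR {0..} SP (tpow 1) position"
  unfolding position_def[abs_def]
  by (rule Ck_family_add[OF open_SP ray_Ck_family Ck_family_tpow_mono[OF shift_Ck_family]]) (use mu in simp)

text \<open>A point of the segment is the ray point plus a fraction of
  \<open>fst z + Q t (snd z)\<close>. This displacement is of order \<open>tpow (1 - \<mu>)\<close>
  on the region, so the ray bounds apply to the whole segment.\<close>

lemma segment_bounds:
  assumes "K \<in> PR"
  shows "\<exists>c>0. \<exists>C>0. \<forall>t\<ge>0. \<forall>z\<in>SP. (t, z) \<in> K \<longrightarrow>
     (\<forall>p\<in>closed_segment (t *\<^sub>R snd z) (position t z). c * (1 + t) \<le> jbracket p \<and> jbracket p \<le> C * (1 + t))"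
proof -
  obtain R where R: "R > 0" "K = phase_region \<mu> R" using assms by auto
  obtain C where C: "C \<ge> 0" "\<forall>t\<ge>0. \<forall>\<eta>. 1 / R \<le> norm \<eta> \<and> norm \<eta> \<le> R \<longrightarrow> norm (Q t \<eta>) \<le> C * tpow (1 - \<mu>) t"
    using Q_bound[OF R(1)] by blast
  have "0 < \<mu>" "R + C \<ge> 0" using mu R C by auto
  from jbracket_ray_bounds[OF this(1) mu(2) R(1) this(2)] obtain c B where cB: "c > 0" "B > 0"
    "\<And>t \<eta> d. t \<ge> 0 \<Longrightarrow> 1 / R \<le> norm (\<eta> :: real^'n) \<Longrightarrow> norm \<eta> \<le> R \<Longrightarrow> norm d \<le> (R + C) * tpow (1 - \<mu>) t \<Longrightarrow>
     c * (1 + t) \<le> jbracket (t *\<^sub>R \<eta> + d) \<and> jbracket (t *\<^sub>R \<eta> + d) \<le> B * (1 + t)" by metis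
  have "c * (1 + t) \<le> jbracket p \<and> jbracket p \<le> B * (1 + t)"
    if t: "t \<ge> 0" and z: "(t, z) \<in> K" and p: "p \<in> closed_segment (t *\<^sub>R snd z) (position t z)" for t z p
  proof -
    let ?d = "fst z + Q t (snd z)"
    have zz: "norm (fst z) \<le> R * tpow (1 - \<mu>) t" "1 / R \<le> norm (snd z)" "norm (snd z) \<le> R"
      using z R(2) by (auto simp: phase_region_def)
    have "norm (Q t (snd z)) \<le> C * tpow (1 - \<mu>) t" using C(2) t zz by blast
    then have d: "norm ?d \<le> (R + C) * tpow (1 - \<mu>) t" using zz(1) by (simp only: distrib_right norm_triangle_mono)
    obtain \<theta> where \<theta>: "0 \<le> \<theta>" "\<theta> \<le> 1" "p = (1 - \<theta>) *\<^sub>R (t *\<^sub>R snd z) + \<theta> *\<^sub>R position t z"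
      using p by (auto simp: closed_segment_def)
    have "p = t *\<^sub>R snd z + \<theta> *\<^sub>R ?d" unfolding \<theta>(3) position_def by (simp add: algebra_simps)
    moreover have "norm (\<theta> *\<^sub>R ?d) \<le> (R + C) * tpow (1 - \<mu>) t"
      using \<theta> mult_left_le_one_le[OF norm_ge_zero \<theta>(1,2), of ?d] d by simp
    ultimately show ?thesis using cB(3)[OF t zz(2,3)] by metis
  qed
  then show ?thesis using cB(1,2) by blast
qed

lemma position_bounds:
  assumes "K \<in> PR"
  shows "\<exists>c>0. \<exists>C>0. \<forall>t\<ge>0. \<forall>z\<in>SP. (t, z) \<in> K \<longrightarrow>
     c * (1 + t) \<le> jbracket (position t z) \<and> jbracket (position t z) \<le> C * (1 + t)"
  using segment_bounds[OF assms] by (meson ends_in_segment)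

lemma momentum_component_Ck_family: "Ck_family k PR {0..} SP (tpow 0) (\<lambda>t z. snd z $ m)"
  by (rule Ck_family_snd_PR[OF Ck_family_linear[OF open_SE bounded_linear_vec_nth Ck_family_id_MR]])

lemma X2_Ck_family: "Ck_family k PR {0..} SP (tpow (- \<mu> - 1)) X2"
proof -
  have "Ck_family k PR {0..} SP (tpow (- \<mu> - 1)) (\<lambda>t z. Db i m n (position t z))" for i m n
    by (rule symbol_compose[OF open_SP Db_symbol position_Ck_family position_bounds])
  then have "Ck_family k PR {0..} SP (tpow (- \<mu> - 1)) (\<lambda>t z. grad_x (position t z) (snd z))"
    unfolding grad_x_def by (rule grad_x_Ck_family[OF open_SP _ momentum_component_Ck_family])
  then show ?thesis unfolding X2_def[abs_def] by (rule Ck_family_minus[OF open_SP])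
qed

text \<open>All three terms have the same order: \<open>- \<mu> - 1 + (1 - \<mu>)\<close> for the
  difference of coefficients, \<open>1 + (- \<mu> - 2) + (1 - \<mu>)\<close> for \<open>t\<close>
  times the difference of gradients, and \<open>(1 - \<mu>) + (- \<mu> - 1)\<close> for the
  derivative of \<open>Q\<close> applied to \<open>X2\<close>.\<close>

lemma X1_Ck_family: "Ck_family k PR {0..} SP (tpow (- 2 * \<mu>)) X1"
proof -
  have shift: "Ck_family k PR {0..} SP (tpow (1 - \<mu>)) (\<lambda>t z. position t z - t *\<^sub>R snd z)"
    using shift_Ck_family[of k] by (simp add: position_def)
  note sd = symbol_difference[OF open_SP _ position_Ck_family ray_Ck_family shift segment_bounds]
  have "Ck_family k PR {0..} SP (tpow (- \<mu> - 1 + (1 - \<mu>))) (\<lambda>t z. b m n (position t z) - b m n (t *\<^sub>R snd z))" for m n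
    by (rule sd[OF b_symbol])
  then have "Ck_family k PR {0..} SP (tpow (- 2 * \<mu>)) (\<lambda>t z. (b m n (position t z) - b m n (t *\<^sub>R snd z)) * snd z $ n)" for m n
    by (rule Ck_family_tpow_mult[OF open_SP _ momentum_component_Ck_family]) simp
  then have "Ck_family k PR {0..} SP (tpow (- 2 * \<mu>)) (\<lambda>t z. (\<chi> m. \<Sum>n\<in>UNIV. (b m n (position t z) - b m n (t *\<^sub>R snd z)) * snd z $ n) :: real^'n)"
    by (intro Ck_family_vec Ck_family_sum open_SP)
  moreover have "a x *v \<xi> - a x' *v \<xi> = (\<chi> m. \<Sum>n\<in>UNIV. (b m n x - b m n x') * \<xi> $ n)" for x x' \<xi>
    by (simp add: vec_eq_iff a_mult_b sum_subtractf left_diff_distrib)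
  ultimately have 1: "Ck_family k PR {0..} SP (tpow (- 2 * \<mu>)) (\<lambda>t z. a (position t z) *v snd z - a (t *\<^sub>R snd z) *v snd z)"
    by simp
  have "Ck_family k PR {0..} SP (tpow (- \<mu> - 1 - 1 + (1 - \<mu>))) (\<lambda>t z. Db i m n (position t z) - Db i m n (t *\<^sub>R snd z))" for i m n
    by (rule sd[OF Db_symbol])
  then have "Ck_family k PR {0..} SP (tpow (- \<mu> - 1 - 1 + (1 - \<mu>))) (\<lambda>t z. (\<chi> i. \<Sum>m\<in>UNIV. \<Sum>n\<in>UNIV.
      1/2 * (Db i m n (position t z) - Db i m n (t *\<^sub>R snd z)) * snd z $ m * snd z $ n) :: real^'n)"
    by (rule grad_x_Ck_family[OF open_SP _ momentum_component_Ck_family])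
  moreover have "(\<chi> i. \<Sum>m\<in>UNIV. \<Sum>n\<in>UNIV. 1/2 * (Db i m n x - Db i m n x') * \<xi> $ m * \<xi> $ n) = grad_x x \<xi> - grad_x x' \<xi>" for x x' \<xi>
    by (simp add: vec_eq_iff grad_x_def sum_subtractf left_diff_distrib right_diff_distrib diff_divide_distrib)
  ultimately have "Ck_family k PR {0..} SP (tpow (- \<mu> - 1 - 1 + (1 - \<mu>))) (\<lambda>t z. grad_x (position t z) (snd z) - grad_x (t *\<^sub>R snd z) (snd z))"
    by (simp only:)
  then have 2: "Ck_family k PR {0..} SP (tpow (- 2 * \<mu>)) (\<lambda>t z. t *\<^sub>R (grad_x (position t z) (snd z) - grad_x (t *\<^sub>R snd z) (snd z)))"
    by (rule Ck_family_tpow_scaleR[OF open_SP Ck_family_time[OF open_SP]]) simp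
  have "Ck_family k PR {0..} SP (tpow (- 2 * \<mu>)) (\<lambda>t z. \<Sum>e\<in>Basis. (X2 t z \<bullet> e) *\<^sub>R frechet_derivative (Q t) (at (snd z)) e)"
  proof (rule Ck_family_sum[OF open_SP])
    fix e :: "real^'n"
    show "Ck_family k PR {0..} SP (tpow (- 2 * \<mu>)) (\<lambda>t z. (X2 t z \<bullet> e) *\<^sub>R frechet_derivative (Q t) (at (snd z)) e)"
      by (rule Ck_family_tpow_scaleR[OF open_SP Ck_family_linear[OF open_SP bounded_linear_inner_left X2_Ck_family]
            Ck_family_snd_PR[OF Ck_family_SucD(2)[OF Q_Ck_family]]]) simp
  qed
  moreover have "(\<Sum>e\<in>Basis. (u \<bullet> e) *\<^sub>R frechet_derivative (Q t) (at (snd z)) e) = frechet_derivative (Q t) (at (snd z)) u"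
    if "t \<in> {0..}" "z \<in> SP" for t z u
    by (rule linear_Basis_sum[symmetric], rule has_derivative_linear[OF Ck_family_SucD(1)[OF Q_Ck_family that(1)]])
      (use that(2) in \<open>auto simp: phase_space_def\<close>)
  ultimately have 3: "Ck_family k PR {0..} SP (tpow (- 2 * \<mu>)) (\<lambda>t z. frechet_derivative (Q t) (at (snd z)) (X2 t z))"
    using Ck_family_cong[OF open_SP, of "{0..}" "\<lambda>t z. \<Sum>e\<in>Basis. (X2 t z \<bullet> e) *\<^sub>R frechet_derivative (Q t) (at (snd z)) e"
      "\<lambda>t z. frechet_derivative (Q t) (at (snd z)) (X2 t z)" k PR "tpow (- 2 * \<mu>)"] by blast
  show ?thesis unfolding X1_def[abs_def]
    by (rule Ck_family_diff[OF open_SP Ck_family_add[OF open_SP 1 2] 3])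
qed

text \<open>The momentum part decays at least as fast as the position part, since
  \<open>- \<mu> - 1 \<le> - 2 * \<mu>\<close> for \<open>\<mu> < 1\<close>.\<close>

lemma X_Ck_family: "Ck_family k PR {0..} SP (tpow (- 2 * \<mu>)) X"
  unfolding X_def[abs_def]
  by (rule Ck_family_Pair[OF open_SP X1_Ck_family Ck_family_tpow_mono[OF X2_Ck_family]]) (use mu in simp)

section \<open>Trajectories in modified coordinates and the gradient of
  \<open>\<Psi>\<close>\<close>

definition modified :: "real \<Rightarrow> (real^'n) \<times> (real^'n) \<Rightarrow> (real^'n) \<times> (real^'n)" where
  "modified t p = (fst p - t *\<^sub>R snd p - Q t (snd p), snd p)"

lemma position_modified: "position t (modified t p) = fst p"
  by (simp add: position_def modified_def)

lemma modified_position: "modified t (position t z, snd z) = z"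
  by (simp add: position_def modified_def prod_eq_iff)

lemma radial_continuous: "\<eta> \<noteq> 0 \<Longrightarrow> continuous_on {0..t} (\<lambda>s. radial s \<eta>)"
  by (rule weight_bounded_slice[OF Ck_family_weight_bounded[OF radial_Ck_family[of 0]]]) auto

lemma Q_time_derivative:
  assumes "\<eta> \<noteq> 0" "t \<ge> 0"
  shows "((\<lambda>s. Q s \<eta>) has_vector_derivative radial t \<eta>) (at t within {0..})"
proof -
  \<comment> \<open>The interval is extended past \<open>t\<close>, so that near \<open>t\<close> it
    coincides with the half line.\<close>
  have "((\<lambda>s. Q s \<eta>) has_vector_derivative radial t \<eta>) (at t within {0..t + 1})"
    unfolding Q_def by (rule integral_has_vector_derivative[OF radial_continuous]) (use assms in auto)
  moreover have "at t within {0..t + 1} = at t within {0..}"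
    by (rule at_within_nhd[of _ "{..<t + 1}"]) auto
  ultimately show ?thesis by simp
qed

lemma modified_trajectory:
  assumes \<gamma>: "\<And>t. (\<gamma> has_vector_derivative H (\<gamma> t)) (at t)" and "snd (\<gamma> 0) \<noteq> 0" and t: "t \<ge> 0"
  shows "((\<lambda>s. modified s (\<gamma> s)) has_vector_derivative X t (modified t (\<gamma> t))) (at t within {0..})"
    "modified t (\<gamma> t) \<in> SP"
proof -
  define x where "x t = fst (\<gamma> t)" for t
  define \<xi> where "\<xi> t = snd (\<gamma> t)" for t
  have dx: "(x has_vector_derivative a (x t) *v \<xi> t) (at t within {0..})" and d\<xi>: "(\<xi> has_vector_derivative - grad_x (x t) (\<xi> t)) (at t within {0..})" for t
    using bounded_linear.has_vector_derivative[OF bounded_linear_fst has_vector_derivative_at_within[OF \<gamma>]]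
      bounded_linear.has_vector_derivative[OF bounded_linear_snd has_vector_derivative_at_within[OF \<gamma>]]
    by (simp_all add: x_def[abs_def] \<xi>_def[abs_def] H_def)
  have \<xi>0: "\<xi> t \<noteq> 0" for t unfolding \<xi>_def by (rule trajectory_phase_space[OF \<gamma> assms(2)])
  then show "modified t (\<gamma> t) \<in> SP" by (simp add: modified_def phase_space_def \<xi>_def)
  have dt\<xi>: "((\<lambda>s. s *\<^sub>R \<xi> s) has_vector_derivative t *\<^sub>R (- grad_x (x t) (\<xi> t)) + 1 *\<^sub>R \<xi> t) (at t within {0..})"
    by (rule has_vector_derivative_scaleR[OF _ d\<xi>]) (auto intro!: derivative_eq_intros)
  have dQ: "((\<lambda>s. Q s (\<xi> s)) has_vector_derivative radial t (\<xi> t) + frechet_derivative (Q t) (at (\<xi> t)) (- grad_x (x t) (\<xi> t))) (at t within {0..})"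
    by (rule Ck_family_along_curve[OF open_SE Ck_family_ignore[OF Q_Ck_family] t Q_time_derivative[OF \<xi>0 t] d\<xi>]) (use \<xi>0 in simp)
  have pos: "position t (modified t (\<gamma> t)) = x t" "snd (modified t (\<gamma> t)) = \<xi> t"
    by (simp add: position_modified x_def) (simp add: modified_def \<xi>_def)
  have X2: "X2 t (modified t (\<gamma> t)) = - grad_x (x t) (\<xi> t)" by (simp add: X2_def pos)
  have "((\<lambda>s. x s - s *\<^sub>R \<xi> s - Q s (\<xi> s)) has_vector_derivative X1 t (modified t (\<gamma> t))) (at t within {0..})"
    by (rule has_vector_derivative_eq_rhs, rule has_vector_derivative_diff[OF has_vector_derivative_diff[OF dx dt\<xi>] dQ])
      (simp add: X1_def X2 pos radial_def algebra_simps)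
  note d = has_vector_derivative_Pair[OF this d\<xi>[of t]]
  have "(\<lambda>s. modified s (\<gamma> s)) = (\<lambda>s. (x s - s *\<^sub>R \<xi> s - Q s (\<xi> s), \<xi> s))" by (simp add: modified_def x_def \<xi>_def)
  moreover have "X t (modified t (\<gamma> t)) = (X1 t (modified t (\<gamma> t)), - grad_x (x t) (\<xi> t))" by (simp only: X_def X2)
  ultimately show "((\<lambda>s. modified s (\<gamma> s)) has_vector_derivative X t (modified t (\<gamma> t))) (at t within {0..})"
    using d by (simp only:)
qed

lemma kinetic_ray_has_derivative:
  "((\<lambda>\<eta>. kinetic a (s *\<^sub>R \<eta>) \<eta>) has_derivative (\<lambda>v. (\<eta> + radial s \<eta>) \<bullet> v)) (at \<eta>)"
proof -
  have "((\<lambda>\<eta>. (s *\<^sub>R \<eta>, \<eta>)) has_derivative (\<lambda>v. (s *\<^sub>R v, v))) (at \<eta>)" by (auto intro!: derivative_eq_intros)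
  from diff_chain_at[OF this kinetic_has_derivative] show ?thesis
    by (simp add: o_def radial_def inner_add_left inner_diff_left add.commute)
qed

lemma kinetic_ray_Ck_family: "Ck_family (Suc 0) {} {0..} SE (\<lambda>_. 0) (\<lambda>s \<eta>. kinetic a (s *\<^sub>R \<eta>) \<eta>)"
proof (rule Ck_family_SucI[OF open_SE _ kinetic_ray_has_derivative])
  have "continuous_on UNIV (\<lambda>z. kinetic a (fst z) (snd z))"
    using has_derivative_continuous[OF kinetic_has_derivative] by (auto simp: continuous_on_eq_continuous_at)
  moreover have "continuous_on ({0..} \<times> SE) (\<lambda>p. (fst p *\<^sub>R snd p, snd p))" by (intro continuous_intros)
  ultimately have "continuous_on ({0..} \<times> SE) (\<lambda>p. kinetic a (fst p *\<^sub>R snd p) (snd p))"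
    using continuous_on_compose2[of UNIV "\<lambda>z. kinetic a (fst z) (snd z)" "{0..} \<times> SE" "\<lambda>p. (fst p *\<^sub>R snd p, snd p)"] by auto
  then show "weight_bounded {} {0..} SE (\<lambda>_. 0) (\<lambda>s \<eta>. kinetic a (s *\<^sub>R \<eta>) \<eta>)"
    by (simp add: weight_bounded_def split_beta)
  fix v :: "real^'n"
  show "Ck_family 0 {} {0..} SE (\<lambda>_. 0) (\<lambda>s \<eta>. (\<eta> + radial s \<eta>) \<bullet> v)"
    by (intro Ck_family_linear[OF open_SE bounded_linear_inner_left] Ck_family_add[OF open_SE]
        Ck_family_ignore[OF Ck_family_id_MR] Ck_family_ignore[OF radial_Ck_family])
qed

lemma Psi_has_derivative:
  assumes "t \<ge> 0" "\<eta> \<noteq> 0"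
  shows "(Psi (kinetic a) t has_derivative (\<lambda>v. (t *\<^sub>R \<eta> + Q t \<eta>) \<bullet> v)) (at \<eta>)"
proof -
  have eq: "Psi (kinetic a) t \<zeta> = integral {0..t} (\<lambda>s. kinetic a (s *\<^sub>R \<zeta>) \<zeta>)" if "\<zeta> \<in> SE" for \<zeta>
  proof -
    have "continuous_on {0..t} (\<lambda>s. kinetic a (s *\<^sub>R \<zeta>) \<zeta>)"
      by (rule weight_bounded_slice[OF Ck_family_weight_bounded[OF kinetic_ray_Ck_family] that])
    then have "set_integrable lborel {0..t} (\<lambda>s. kinetic a (s *\<^sub>R \<zeta>) \<zeta>)" by (intro borel_integrable_atLeastAtMost') auto
    then show ?thesis unfolding Psi_def using assms(1) by (intro interval_integral_eq_integral) auto
  qed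
  have \<eta>: "\<eta> \<in> SE" using assms by simp
  have fd: "frechet_derivative (\<lambda>\<eta>. kinetic a (s *\<^sub>R \<eta>) \<eta>) (at \<eta>) = (\<lambda>v. (\<eta> + radial s \<eta>) \<bullet> v)" for s
    by (rule frechet_derivative_at[OF kinetic_ray_has_derivative, symmetric])
  have "integral {0..t} (\<lambda>s. (\<eta> + radial s \<eta>) \<bullet> v) = (t *\<^sub>R \<eta> + Q t \<eta>) \<bullet> v" for v
  proof -
    have i: "(\<lambda>s. radial s \<eta>) integrable_on {0..t}" by (rule integrable_continuous_interval[OF radial_continuous[OF assms(2)]])
    have i2: "(\<lambda>s. \<eta> + radial s \<eta>) integrable_on {0..t}" by (intro integrable_add i integrable_const_ivl)
    have "integral {0..t} (\<lambda>s. (\<eta> + radial s \<eta>) \<bullet> v) = integral {0..t} (\<lambda>s. \<eta> + radial s \<eta>) \<bullet> v"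
      using integral_linear[OF i2 bounded_linear_inner_left[of v]] by (simp add: o_def)
    also have "integral {0..t} (\<lambda>s. \<eta> + radial s \<eta>) = t *\<^sub>R \<eta> + Q t \<eta>"
      using assms(1) by (simp add: integral_add i integrable_const_ivl Q_def)
    finally show ?thesis .
  qed
  then have "((\<lambda>\<zeta>. integral {0..t} (\<lambda>s. kinetic a (s *\<^sub>R \<zeta>) \<zeta>)) has_derivative (\<lambda>v. (t *\<^sub>R \<eta> + Q t \<eta>) \<bullet> v)) (at \<eta>)"
    using integral_family_has_derivative[OF open_SE kinetic_ray_Ck_family assms(1) \<eta>] by (simp add: fd)
  then show ?thesis
    by (rule has_derivative_transform_within_open[OF _ open_SE \<eta>]) (simp add: eq)
qed

lemma grad_Psi:
  "t \<ge> 0 \<Longrightarrow> \<eta> \<noteq> 0 \<Longrightarrow> grad (Psi (kinetic a) t) \<eta> = t *\<^sub>R \<eta> + Q t \<eta>"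
  by (rule grad_eqI[OF Psi_has_derivative])

end

section \<open>Compactified time and the wave map\<close>

lemma mem_phase_space: "p \<in> phase_space \<longleftrightarrow> snd p \<noteq> 0"
  by (simp add: phase_space_def mem_Times_iff)

text \<open>\<open>f\<close> is the integral of the continuous function \<open>g\<close>, which is
  differentiable up to the end points.\<close>

lemma endpoint_derivative:
  fixes f :: "real \<Rightarrow> 'b::euclidean_space"
  assumes "continuous_on {a..b} f" "continuous_on {a..b} g"
    and "\<And>x. x \<in> {a<..<b} \<Longrightarrow> (f has_vector_derivative g x) (at x)" and x: "x \<in> {a..b}"
  shows "(f has_vector_derivative g x) (at x within {a..b})"
proof -
  have "f y = f a + integral {a..y} g" if "y \<in> {a..b}" for y
  proof -
    have "(g has_integral f y - f a) {a..y}"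
      by (rule fundamental_theorem_of_calculus_interior)
        (use that assms(3) continuous_on_subset[OF assms(1), of "{a..y}"] in auto)
    then show ?thesis by (simp add: integral_unique)
  qed
  moreover have "((\<lambda>y. f a + integral {a..y} g) has_vector_derivative g x) (at x within {a..b})"
    using has_vector_derivative_add[OF has_vector_derivative_const integral_has_vector_derivative[OF assms(2) x]] by simp
  ultimately show ?thesis by (rule has_vector_derivative_transform[OF x])
qed

lemma smooth_on_cong:
  assumes "open S" "smooth_on f S" "\<And>x. x \<in> S \<Longrightarrow> g x = f x"
  shows "smooth_on g S"
  unfolding smooth_on_def
proof
  fix k
  have "Ck_family k {} UNIV S (\<lambda>_. 1) (\<lambda>t. f)" using assms(1,2) by (intro Ck_on_Ck_family) (auto simp: smooth_on_def)
  then have "Ck_family k {} UNIV S (\<lambda>_. 1) (\<lambda>t. g)"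
    using Ck_family_cong[OF assms(1), of UNIV "\<lambda>t. f" "\<lambda>t. g"] assms(3) by simp
  then show "Ck_on k g S" using Ck_family_Ck_on by blast
qed

lemma smooth_on_conjugate:
  assumes "open S" "smooth_on f S" "bounded_linear L" "\<And>x. x \<in> S \<Longrightarrow> L x \<in> S"
  shows "smooth_on (\<lambda>x. L (f (L x))) S"
  unfolding smooth_on_def
proof
  fix k
  have "Ck_family k {} UNIV S (\<lambda>_. 1) (\<lambda>t. f)" using assms(1,2) by (intro Ck_on_Ck_family) (auto simp: smooth_on_def)
  then have "Ck_family k {} UNIV S (\<lambda>_. 1) (\<lambda>t x. f (L x))"
    by (intro Ck_family_compose_linear[OF assms(1,3,4)]) auto
  then have "Ck_family k {} UNIV S (\<lambda>_. 1) (\<lambda>t x. L (f (L x)))" by (rule Ck_family_linear[OF assms(1,3)])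
  then show "Ck_on k (\<lambda>x. L (f (L x))) S" using Ck_family_Ck_on by blast
qed

section \<open>The change of time\<close>

context long_range_metric
begin

text \<open>The time change \<open>1 + t = (1 - \<sigma>) powr (- \<beta>)\<close> maps \<open>[0, \<infinity>)\<close> to \<open>[0, 1)\<close>; since \<open>\<beta> (2 \<mu> - 1) = 2\<close>, a
  family of size \<open>(1 + t) powr (- 2 \<mu>)\<close>, multiplied by \<open>dt/d\<sigma>\<close>, has size \<open>1 - \<sigma>\<close>.\<close>

definition \<beta> :: real where "\<beta> = 2 / (2 * \<mu> - 1)"
definition time :: "real \<Rightarrow> real" where "time \<sigma> = (1 - \<sigma>) powr (- \<beta>) - 1"
definition time_inv :: "real \<Rightarrow> real" where "time_inv t = 1 - (1 + t) powr (- (1 / \<beta>))"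

text \<open>The scalar factor is the derivative of \<open>time\<close>. The value 0 at the end point
  is the limit there for families of weight \<open>tpow (- 2 * \<mu>)\<close>.\<close>

definition compactify :: "(real \<Rightarrow> (real^'n) \<times> (real^'n) \<Rightarrow> 'b::euclidean_space) \<Rightarrow> real \<Rightarrow> (real^'n) \<times> (real^'n) \<Rightarrow> 'b" where
  "compactify f \<sigma> z = (if \<sigma> < 1 then (\<beta> * (1 - \<sigma>) powr (- \<beta> - 1)) *\<^sub>R f (time \<sigma>) z else 0)"

lemma beta: "\<beta> > 0" "\<beta> * (2 * \<mu> - 1) = 2"
  using mu by (simp_all add: \<beta>_def field_simps)

lemma time_nonneg: "0 \<le> \<sigma> \<Longrightarrow> \<sigma> < 1 \<Longrightarrow> 0 \<le> time \<sigma>"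
  using powr_mono2'[of "- \<beta>" "1 - \<sigma>" 1] beta(1) by (simp add: time_def)

lemma time_0: "time 0 = 0" by (simp add: time_def)

lemma time_time_inv: "t \<ge> 0 \<Longrightarrow> time (time_inv t) = t"
  using beta(1) by (simp add: time_def time_inv_def powr_powr)

lemma time_inv_range: "t \<ge> 0 \<Longrightarrow> time_inv t \<in> {0..<1}"
  using powr_mono[of "- (1 / \<beta>)" 0 "1 + t"] beta(1) by (simp add: time_inv_def)

lemma time_inv_tendsto: "filterlim time_inv (at 1 within {0..1}) at_top"
  unfolding filterlim_at
proof
  show "\<forall>\<^sub>F x in at_top. time_inv x \<in> {0..1} \<and> time_inv x \<noteq> 1"
    using eventually_ge_at_top[of 0] by eventually_elim (use time_inv_range in fastforce)
  have "((\<lambda>t::real. 1 - (1 + t) powr (- (1 / \<beta>))) \<longlongrightarrow> 1 - 0) at_top"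
    using beta(1) by (intro tendsto_diff tendsto_const tendsto_neg_powr filterlim_tendsto_add_at_top[OF tendsto_const filterlim_ident]) auto
  then show "(time_inv \<longlongrightarrow> 1) at_top" by (simp add: time_inv_def[abs_def])
qed

lemma time_derivative: "\<sigma> < 1 \<Longrightarrow> (time has_real_derivative \<beta> * (1 - \<sigma>) powr (- \<beta> - 1)) (at \<sigma>)"
  unfolding time_def by (auto intro!: derivative_eq_intros)

lemma compactify_bound:
  assumes "norm (f (time \<sigma>) z) \<le> C * tpow (- 2 * \<mu>) (time \<sigma>)" "0 \<le> \<sigma>" "\<sigma> < 1"
  shows "norm (compactify f \<sigma> z) \<le> C * \<beta> * (1 - \<sigma>)"
proof -
  have "norm (compactify f \<sigma> z) = \<beta> * (1 - \<sigma>) powr (- \<beta> - 1) * norm (f (time \<sigma>) z)"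
    using assms(3) beta(1) by (simp add: compactify_def)
  also have "\<dots> \<le> \<beta> * (1 - \<sigma>) powr (- \<beta> - 1) * (C * tpow (- 2 * \<mu>) (time \<sigma>))"
    using beta(1) by (intro mult_left_mono assms(1)) auto
  also have "tpow (- 2 * \<mu>) (time \<sigma>) = (1 - \<sigma>) powr (2 * \<mu> * \<beta>)"
    by (simp add: time_def powr_powr mult.commute)
  also have "\<beta> * (1 - \<sigma>) powr (- \<beta> - 1) * (C * (1 - \<sigma>) powr (2 * \<mu> * \<beta>)) =
      C * \<beta> * ((1 - \<sigma>) powr (- \<beta> - 1) * (1 - \<sigma>) powr (2 * \<mu> * \<beta>))" by simp
  also have "(1 - \<sigma>) powr (- \<beta> - 1) * (1 - \<sigma>) powr (2 * \<mu> * \<beta>) = (1 - \<sigma>) powr (- \<beta> - 1 + 2 * \<mu> * \<beta>)"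
    by (rule powr_add[symmetric])
  also have "- \<beta> - 1 + 2 * \<mu> * \<beta> = 1" using beta(2) by (simp add: algebra_simps)
  finally show ?thesis using assms(3) by simp
qed

text \<open>Only \<open>\<sigma> = 1\<close> needs an argument: a neighbourhood of \<open>z0\<close>
  lies in a single region for all times, and there the weight forces a bound of order
  \<open>1 - \<sigma>\<close>.\<close>

lemma compactify_continuous:
  fixes f :: "real \<Rightarrow> (real^'n) \<times> (real^'n) \<Rightarrow> 'b::euclidean_space"
  assumes "weight_bounded PR {0..} SP (tpow (- 2 * \<mu>)) f"
  shows "continuous_on ({0..1} \<times> SP) (\<lambda>(\<sigma>, z). compactify f \<sigma> z)"
  unfolding continuous_on_def
proof
  fix p :: "real \<times> (real^'n) \<times> (real^'n)" assume p: "p \<in> {0..1} \<times> SP"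
  obtain \<sigma>0 z0 where p0: "p = (\<sigma>0, z0)" by (cases p)
  show "((\<lambda>(\<sigma>, z). compactify f \<sigma> z) \<longlongrightarrow> (case p of (\<sigma>, z) \<Rightarrow> compactify f \<sigma> z)) (at p within {0..1} \<times> SP)"
  proof (cases "\<sigma>0 < 1")
    case True
    have "continuous_on ({0..<1} \<times> SP) (\<lambda>p. (time (fst p), snd p))"
      unfolding time_def by (intro continuous_intros) auto
    from continuous_on_compose2[OF assms[unfolded weight_bounded_def, THEN conjunct1] this]
    have c: "continuous_on ({0..<1} \<times> SP) (\<lambda>p. f (time (fst p)) (snd p))" using time_nonneg by (auto simp: image_subset_iff split_beta)
    have "continuous_on ({0..<1} \<times> SP) (\<lambda>p. (\<beta> * (1 - fst p) powr (- \<beta> - 1)) *\<^sub>R f (time (fst p)) (snd p))"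
      by (intro continuous_intros c) auto
    then have "continuous_on ({0..<1} \<times> SP) (\<lambda>(\<sigma>, z). compactify f \<sigma> z)"
      by (rule continuous_on_eq) (auto simp: compactify_def)
    moreover have "p \<in> {0..<1} \<times> SP" using p p0 True by auto
    moreover have "at p within {0..<1} \<times> SP = at p within {0..1} \<times> SP"
      by (rule at_within_nhd[of _ "{..<1} \<times> UNIV"]) (use p0 True in \<open>auto intro: open_Times\<close>)
    ultimately show ?thesis unfolding continuous_on_def by metis
  next
    case False
    then have \<sigma>0: "\<sigma>0 = 1" and z0: "z0 \<in> SP" using p p0 by auto
    define e where "e = norm (snd z0)"
    have e: "e > 0" using z0 by (simp add: e_def mem_phase_space)
    \<comment> \<open>Chosen so that the region contains \<open>(t, z)\<close> for all
      \<open>t \<ge> 0\<close> and all \<open>z\<close> within \<open>e / 2\<close> of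
      \<open>z0\<close>, whose momenta have norm at least \<open>e / 2\<close>.\<close>
    define R where "R = max (norm z0 + e / 2) (2 / e)"
    have R: "R > 0" using e by (simp add: R_def add_nonneg_pos less_max_iff_disj)
    have inR: "(t, z) \<in> phase_region \<mu> R" if "t \<ge> 0" "z \<in> ball z0 (e / 2)" for t z
    proof -
      have d: "norm (z - z0) < e / 2" using that(2) by (simp add: dist_norm norm_minus_commute)
      have pr: "norm (fst u) \<le> norm u" "norm (snd u) \<le> norm u" for u :: "(real^'n) \<times> (real^'n)"
        by (metis norm_fst_le prod.collapse, metis norm_snd_le prod.collapse)
      have "norm z \<le> R" using norm_triangle_sub[of z z0] d by (simp add: R_def)
      then have 1: "norm (fst z) \<le> R" "norm (snd z) \<le> R"
        using pr[of z] by auto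
      have "norm (snd z0) - norm (snd z) \<le> norm (snd z0 - snd z)" by (rule norm_triangle_ineq2)
      also have "\<dots> \<le> norm (z - z0)" using pr(2)[of "z - z0"] by (simp add: norm_minus_commute)
      finally have "e / 2 \<le> norm (snd z)" using d by (simp add: e_def)
      moreover have "1 / R \<le> e / 2"
      proof -
        have "1 / R \<le> 1 / (2 / e)" using e R by (intro divide_left_mono) (auto simp: R_def)
        then show ?thesis by simp
      qed
      moreover have "R \<le> R * tpow (1 - \<mu>) t" using R that(1) mu by (simp add: ge_one_powr_ge_zero)
      ultimately show ?thesis using 1 by (simp add: phase_region_def case_prod_beta)
    qed
    obtain C where C: "\<forall>t\<in>{0..}. \<forall>z\<in>SP. (t, z) \<in> phase_region \<mu> R \<longrightarrow> norm (f t z) \<le> C * tpow (- 2 * \<mu>) t"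
      using assms R unfolding weight_bounded_def by blast
    have ev: "\<forall>\<^sub>F q in at p within {0..1} \<times> SP. norm (case q of (\<sigma>, z) \<Rightarrow> compactify f \<sigma> z) \<le> C * \<beta> * (1 - fst q)"
    proof -
      have "\<forall>\<^sub>F q in at p within {0..1} \<times> SP. q \<in> UNIV \<times> ball z0 (e / 2)"
        by (rule topological_tendstoD[OF tendsto_ident_at]) (use e p0 in \<open>auto intro: open_Times\<close>)
      moreover have "\<forall>\<^sub>F q in at p within {0..1} \<times> SP. q \<in> {0..1} \<times> SP" by (simp add: eventually_at_filter)
      ultimately show ?thesis
      proof eventually_elim
        case (elim q)
        obtain \<sigma> z where q: "q = (\<sigma>, z)" by (cases q)
        show ?case
        proof (cases "\<sigma> < 1")
          case True
          then have "norm (f (time \<sigma>) z) \<le> C * tpow (- 2 * \<mu>) (time \<sigma>)"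
            using C inR[OF time_nonneg, of \<sigma> z] time_nonneg[of \<sigma>] elim q by auto
          then show ?thesis using compactify_bound[of f \<sigma> z C] True elim q by auto
        next
          case False
          then show ?thesis using elim q by (simp add: compactify_def)
        qed
      qed
    qed
    have "((\<lambda>q. C * \<beta> * (1 - fst q)) \<longlongrightarrow> C * \<beta> * (1 - fst p)) (at p within {0..1} \<times> SP)"
      by (intro tendsto_intros tendsto_fst[OF tendsto_ident_at])
    then have "((\<lambda>q. C * \<beta> * (1 - fst q)) \<longlongrightarrow> 0) (at p within {0..1} \<times> SP)" by (simp add: p0 \<sigma>0)
    from Lim_null_comparison[OF ev this] show ?thesis by (simp add: p0 \<sigma>0 compactify_def)
  qed
qed

text \<open>Changing time and multiplying by a function of \<open>\<sigma>\<close> commute with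
  derivatives in \<open>z\<close>. Each derivative is therefore the compactification of a family of
  the same weight.\<close>

lemma compactify_Ck_family:
  fixes f :: "real \<Rightarrow> (real^'n) \<times> (real^'n) \<Rightarrow> 'b::euclidean_space"
  assumes "Ck_family k PR {0..} SP (tpow (- 2 * \<mu>)) f"
  shows "Ck_family k {} {0..1} SP w (compactify f)"
  using assms
proof (induction k arbitrary: f)
  case 0
  then show ?case using compactify_continuous[of f] by (simp add: weight_bounded_def)
next
  case (Suc k)
  note fD = Ck_family_SucD[OF Suc.prems]
  have "(compactify f \<sigma> has_derivative (\<lambda>v. compactify (\<lambda>t z. frechet_derivative (f t) (at z) v) \<sigma> z)) (at z)"
    if "\<sigma> \<in> {0..1}" "z \<in> SP" for \<sigma> z
  proof (cases "\<sigma> < 1")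
    case True
    have "time \<sigma> \<in> {0..}" using time_nonneg that True by simp
    from has_derivative_scaleR_right[OF fD(1)[OF this that(2)]] True show ?thesis
      by (simp add: compactify_def[abs_def])
  qed (simp add: compactify_def[abs_def])
  moreover have "weight_bounded {} {0..1} SP w (compactify f)"
    using compactify_continuous[OF Ck_family_weight_bounded[OF Suc.prems]] by (simp add: weight_bounded_def)
  ultimately show ?case by (intro Ck_family_SucI[OF open_SP _ _ Suc.IH[OF fD(2)]])
qed

section \<open>Solutions up to infinite time\<close>

definition Y :: "real \<Rightarrow> (real^'n) \<times> (real^'n) \<Rightarrow> (real^'n) \<times> (real^'n)" where
  "Y = compactify X"

lemma Y_Ck_family: "Ck_family k {} {0..1} SP w Y"
  unfolding Y_def by (rule compactify_Ck_family[OF X_Ck_family])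

lemma compactified_trajectory_derivative:
  assumes \<gamma>: "\<And>t. (\<gamma> has_vector_derivative H (\<gamma> t)) (at t)" and "snd (\<gamma> 0) \<noteq> 0" and \<sigma>: "0 < \<sigma>" "\<sigma> < 1"
  shows "((\<lambda>\<sigma>. modified (time \<sigma>) (\<gamma> (time \<sigma>))) has_vector_derivative Y \<sigma> (modified (time \<sigma>) (\<gamma> (time \<sigma>)))) (at \<sigma>)"
proof -
  have t: "time \<sigma> \<ge> 0" using time_nonneg \<sigma> by simp
  have "(time has_vector_derivative \<beta> * (1 - \<sigma>) powr (- \<beta> - 1)) (at \<sigma> within {0<..<1})"
    using time_derivative[OF \<sigma>(2)] by (simp add: has_real_derivative_iff_has_vector_derivative has_vector_derivative_at_within)
  moreover have "((\<lambda>s. modified s (\<gamma> s)) has_vector_derivative X (time \<sigma>) (modified (time \<sigma>) (\<gamma> (time \<sigma>)))) (at (time \<sigma>) within time ` {0<..<1})"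
    by (rule has_vector_derivative_within_subset[OF modified_trajectory(1)[OF \<gamma> assms(2) t]]) (auto intro: time_nonneg)
  ultimately have "((\<lambda>\<sigma>. modified (time \<sigma>) (\<gamma> (time \<sigma>))) has_vector_derivative Y \<sigma> (modified (time \<sigma>) (\<gamma> (time \<sigma>)))) (at \<sigma> within {0<..<1})"
    using vector_diff_chain_within[of time _ \<sigma> "{0<..<1}" "\<lambda>s. modified s (\<gamma> s)"] \<sigma> by (simp add: o_def Y_def compactify_def)
  moreover have "at \<sigma> within {0<..<1} = at \<sigma>" using \<sigma> by (intro at_within_open) auto
  ultimately show ?thesis by simp
qed

text \<open>The growth estimate keeps the trajectory in one region. There \<open>Y\<close> is
  bounded, so the curve is Lipschitz before \<open>\<sigma> = 1\<close> and extends continuously;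
  continuity of \<open>Y\<close> then gives the equation at the end point.\<close>

lemma compactified_solution:
  assumes \<gamma>: "\<And>t. (\<gamma> has_vector_derivative H (\<gamma> t)) (at t)" and \<xi>0: "snd (\<gamma> 0) \<noteq> 0"
    and esc: "filterlim (\<lambda>t. norm (fst (\<gamma> t))) at_top at_top"
  shows "\<exists>\<zeta>. (\<forall>\<sigma>\<in>{0..<1}. \<zeta> \<sigma> = modified (time \<sigma>) (\<gamma> (time \<sigma>))) \<and>
    (\<forall>\<sigma>\<in>{0..1}. \<zeta> \<sigma> \<in> SP \<and> (\<zeta> has_vector_derivative Y \<sigma> (\<zeta> \<sigma>)) (at \<sigma> within {0..1}))"
proof -
  define z where "z \<sigma> = modified (time \<sigma>) (\<gamma> (time \<sigma>))" for \<sigma>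
  obtain R where R: "R > 0" "\<And>t. t \<ge> 0 \<Longrightarrow> norm (fst (\<gamma> t) - t *\<^sub>R snd (\<gamma> t)) \<le> R * tpow (1 - \<mu>) t \<and>
    1 / R \<le> norm (snd (\<gamma> t)) \<and> norm (snd (\<gamma> t)) \<le> R" using trajectory_growth[OF assms] by blast
  obtain C where C: "C \<ge> 0" "\<And>t \<eta>. t \<ge> 0 \<Longrightarrow> 1 / R \<le> norm \<eta> \<Longrightarrow> norm \<eta> \<le> R \<Longrightarrow> norm (Q t \<eta>) \<le> C * tpow (1 - \<mu>) t"
    using Q_bound[OF R(1)] by blast
  \<comment> \<open>\<open>R\<close> bounds the growth of \<open>x - t \<xi>\<close> and
    \<open>C\<close> that of \<open>Q\<close>; together they bound the modified position.\<close>
  define R' where "R' = R + C"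
  have R': "R' > 0" "R \<le> R'" using R C by (auto simp: R'_def)
  have "1 / R' \<le> 1 / R" using R' R(1) by (intro divide_left_mono) auto
  have reg: "(t, modified t (\<gamma> t)) \<in> phase_region \<mu> R'" if "t \<ge> 0" for t
  proof -
    have "norm (fst (\<gamma> t) - t *\<^sub>R snd (\<gamma> t) - Q t (snd (\<gamma> t))) \<le> R * tpow (1 - \<mu>) t + C * tpow (1 - \<mu>) t"
      using R(2)[OF that] C(2)[OF that, of "snd (\<gamma> t)"]
        norm_triangle_ineq4[of "fst (\<gamma> t) - t *\<^sub>R snd (\<gamma> t)" "Q t (snd (\<gamma> t))"] by linarith
    then show ?thesis using R(2)[OF that] R' \<open>1 / R' \<le> 1 / R\<close>
      by (auto simp: phase_region_def modified_def R'_def distrib_right)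
  qed
  obtain B where B: "\<forall>t\<in>{0..}. \<forall>z\<in>SP. (t, z) \<in> phase_region \<mu> R' \<longrightarrow> norm (X t z) \<le> B * tpow (- 2 * \<mu>) t"
    using Ck_family_weight_bounded[OF X_Ck_family[of 0]] R'(1) unfolding weight_bounded_def by blast
  have zSP: "z \<sigma> \<in> SP" if "\<sigma> \<in> {0..<1}" for \<sigma>
    unfolding z_def using that time_nonneg by (intro modified_trajectory(2)[OF \<gamma> \<xi>0]) auto
  have dz: "(z has_vector_derivative Y \<sigma> (z \<sigma>)) (at \<sigma>)" if "\<sigma> \<in> {0<..<1}" for \<sigma>
    unfolding z_def using compactified_trajectory_derivative[OF \<gamma> \<xi>0, of \<sigma>] that by auto
  have cz: "continuous_on {0..<1} z"
  proof -
    have "continuous_on {0..} (\<lambda>s. modified s (\<gamma> s))"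
      by (rule continuous_on_vector_derivative[OF modified_trajectory(1)[OF \<gamma> \<xi>0]]) simp
    moreover have "continuous_on {0..<1} time" unfolding time_def by (intro continuous_intros) auto
    ultimately show ?thesis unfolding z_def
      by (rule continuous_on_compose2) (use time_nonneg in auto)
  qed
  define M where "M = \<bar>B\<bar> * \<beta>"
  have nz: "norm (Y \<sigma> (z \<sigma>)) \<le> M" if "\<sigma> \<in> {0<..<1}" for \<sigma>
  proof -
    have "norm (X (time \<sigma>) (z \<sigma>)) \<le> B * tpow (- 2 * \<mu>) (time \<sigma>)"
      using B zSP[of \<sigma>] reg[of "time \<sigma>"] time_nonneg[of \<sigma>] that by (auto simp: z_def)
    then have "norm (Y \<sigma> (z \<sigma>)) \<le> B * \<beta> * (1 - \<sigma>)" unfolding Y_def using that by (intro compactify_bound) auto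
    also have "\<dots> \<le> M * 1" unfolding M_def using that beta(1) by (intro mult_mono mult_right_mono) auto
    finally show ?thesis by simp
  qed
  have M: "M \<ge> 0" unfolding M_def using beta(1) by simp
  have lip: "norm (z s - z r) \<le> M * (s - r)" if "0 \<le> r" "r < s" "s < 1" for r s
  proof -
    have "continuous_on {r..s} z" by (rule continuous_on_subset[OF cz]) (use that in auto)
    then have "norm (z s - z r) \<le> M * s - M * r"
      using that nz dz
      by (intro differentiable_bound_general[where a = r and b = s and f = z and \<phi> = "\<lambda>x. M * x" and f' = "\<lambda>x. Y x (z x)" and \<phi>' = "\<lambda>_. M"])
        (auto intro!: continuous_intros derivative_eq_intros simp: has_real_derivative_iff_has_vector_derivative[symmetric])
    then show ?thesis by (simp add: right_diff_distrib)
  qed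
  have "M-lipschitz_on {0..<1} z"
  proof (rule lipschitz_onI[OF _ M])
    fix r s :: real assume rs: "r \<in> {0..<1}" "s \<in> {0..<1}"
    show "dist (z r) (z s) \<le> M * dist r s"
      using lip[of r s] lip[of s r] rs
      by (cases r s rule: linorder_cases) (auto simp: dist_norm norm_minus_commute)
  qed
  then have "uniformly_continuous_on {0..<1} z" by (rule lipschitz_on_uniformly_continuous)
  from uniformly_continuous_on_extension_on_closure[OF this]
  obtain \<zeta> where \<zeta>: "uniformly_continuous_on (closure {0..<1}) \<zeta>" "\<And>\<sigma>. \<sigma> \<in> {0..<1} \<Longrightarrow> z \<sigma> = \<zeta> \<sigma>" by metis
  have c\<zeta>: "continuous_on {0..1} \<zeta>" using uniformly_continuous_imp_continuous[OF \<zeta>(1)] by simp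
  \<comment> \<open>The phase space is not closed; the lower bound on the momentum keeps the limit
    momentum away from 0.\<close>
  have "\<zeta> 1 \<in> SP"
  proof -
    have "(\<zeta> \<longlongrightarrow> \<zeta> 1) (at 1 within {0..1})" using c\<zeta> by (simp add: continuous_on_def)
    then have "(\<zeta> \<longlongrightarrow> \<zeta> 1) (at 1 within {0..<1})" by (rule tendsto_within_subset) auto
    then have "((\<lambda>\<sigma>. norm (snd (\<zeta> \<sigma>))) \<longlongrightarrow> norm (snd (\<zeta> 1))) (at 1 within {0..<1})"
      by (rule tendsto_norm[OF tendsto_snd])
    moreover have "1 / R \<le> norm (snd (\<zeta> \<sigma>))" if "\<sigma> \<in> {0..<1}" for \<sigma>
    proof -
      have "snd (\<zeta> \<sigma>) = snd (\<gamma> (time \<sigma>))" unfolding \<zeta>(2)[OF that, symmetric] by (simp add: z_def modified_def)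
      then show ?thesis using R(2)[OF time_nonneg, of \<sigma>] that by simp
    qed
    then have "\<forall>\<^sub>F \<sigma> in at 1 within {0..<1}. 1 / R \<le> norm (snd (\<zeta> \<sigma>))"
      by (auto simp: eventually_at_filter)
    moreover have "at 1 within {0..<1::real} \<noteq> bot" by (simp add: at_within_eq_bot_iff)
    ultimately have "1 / R \<le> norm (snd (\<zeta> 1))" by (intro tendsto_lowerbound)
    moreover have "1 / R > 0" using R(1) by simp
    ultimately have "norm (snd (\<zeta> 1)) > 0" by linarith
    then show ?thesis by (simp add: mem_phase_space)
  qed
  then have \<zeta>SP: "\<zeta> \<sigma> \<in> SP" if "\<sigma> \<in> {0..1}" for \<sigma>
    using zSP[of \<sigma>] \<zeta>(2)[of \<sigma>] that by (cases "\<sigma> = 1") auto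
  have "(\<zeta> has_vector_derivative Y \<sigma> (\<zeta> \<sigma>)) (at \<sigma> within {0..1})" if "\<sigma> \<in> {0..1}" for \<sigma>
  proof (rule endpoint_derivative[OF c\<zeta> _ _ that])
    have "continuous_on {0..1} (\<lambda>\<sigma>. (\<sigma>, \<zeta> \<sigma>))" by (intro continuous_intros c\<zeta>)
    from continuous_on_compose2[OF Ck_family_cont[OF Y_Ck_family] this] show "continuous_on {0..1} (\<lambda>\<sigma>. Y \<sigma> (\<zeta> \<sigma>))"
      using \<zeta>SP by (auto simp: image_subset_iff)
    fix s assume s: "s \<in> {0<..<1::real}"
    have "(z has_vector_derivative Y s (\<zeta> s)) (at s)" using dz[OF s] \<zeta>(2)[of s] s by simp
    then show "(\<zeta> has_vector_derivative Y s (\<zeta> s)) (at s)"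
      by (rule has_vector_derivative_transform_within_open[of _ _ _ "{0<..<1}"]) (use s \<zeta>(2) in auto)
  qed
  then show ?thesis using \<zeta>(2) \<zeta>SP unfolding z_def by (intro exI[of _ \<zeta>]) auto
qed

text \<open>The initial-value problem posed at infinity. A solution close to
  \<open>\<sigma> = 1\<close> is enough, because at finite times the Hamilton flow takes
  over.\<close>

lemma solution_at_infinity:
  assumes z1: "z1 \<in> SP"
  shows "\<exists>s \<rho>. 0 \<le> s \<and> s < 1 \<and> \<rho> 1 = z1 \<and> (\<forall>\<sigma>\<in>{s..1}. \<rho> \<sigma> \<in> SP \<and> (\<rho> has_vector_derivative Y \<sigma> (\<rho> \<sigma>)) (at \<sigma> within {s..1}))"
proof -
  obtain r L where r: "r > 0" "L > 0" "\<And>t. t \<in> {0..1::real} \<Longrightarrow> cball z1 r \<subseteq> SP"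
    "\<And>t z z'. t \<in> {0..1} \<Longrightarrow> z \<in> cball z1 r \<Longrightarrow> z' \<in> cball z1 r \<Longrightarrow> norm (Y t z - Y t z') \<le> L * norm (z - z')"
    using tube_Lipschitz[OF open_SP Y_Ck_family, of "\<lambda>_. z1"] z1 by (metis continuous_on_const)
  have rS: "cball z1 r \<subseteq> SP" using r(3)[of 0] by simp
  \<comment> \<open>Projection onto the ball gives a globally Lipschitz field; by continuity the
    solution stays in the ball for \<open>\<sigma>\<close> near 1, where nothing has been
    changed.\<close>
  define \<pi> where "\<pi> = closest_point (cball z1 r)"
  have ne: "cball z1 r \<noteq> {}" using r(1) by simp
  have \<pi>in: "\<pi> z \<in> cball z1 r" for z unfolding \<pi>_def by (rule closest_point_in_set[OF closed_cball ne])
  have \<pi>lip: "norm (\<pi> z - \<pi> z') \<le> norm (z - z')" for z z'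
    using closest_point_lipschitz[OF convex_cball closed_cball ne, of z z'] by (simp add: \<pi>_def dist_norm)
  have c\<pi>: "continuous_on UNIV \<pi>" unfolding \<pi>_def by (rule continuous_on_closest_point[OF convex_cball closed_cball ne])
  have "continuous_on ({0..1} \<times> UNIV) (\<lambda>p. (fst p, \<pi> (snd p)))"
    by (intro continuous_intros continuous_on_compose2[OF c\<pi>]) auto
  from continuous_on_compose2[OF Ck_family_cont[OF Y_Ck_family] this]
  have "continuous_on ({0..1} \<times> UNIV) (\<lambda>(t, z). Y t (\<pi> z))" using subsetD[OF rS \<pi>in] by (auto simp: image_subset_iff split_beta)
  moreover have "norm (Y t (\<pi> z) - Y t (\<pi> z')) \<le> L * norm (z - z')" if "t \<in> {0..1}" for t z z'
    using order_trans[OF r(4)[OF that \<pi>in \<pi>in] mult_left_mono[OF \<pi>lip]] r(2) by simp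
  ultimately obtain \<rho> where \<rho>: "\<rho> 1 = z1" "\<And>t. t\<in>{0..1} \<Longrightarrow> (\<rho> has_vector_derivative Y t (\<pi> (\<rho> t))) (at t)"
    using picard_interval[OF _ _ r(2), of 0 1 "\<lambda>t z. Y t (\<pi> z)" 1 z1] by auto
  have "isCont \<rho> 1" using \<rho>(2)[of 1] has_vector_derivative_continuous by auto
  then obtain d where d: "d > 0" "\<And>t. dist t 1 < d \<Longrightarrow> dist (\<rho> t) z1 < r"
    using r(1) \<rho>(1) unfolding continuous_at_eps_delta by (metis)
  define s where "s = max 0 (1 - d / 2)"
  have s: "0 \<le> s" "s < 1" using d(1) by (auto simp: s_def)
  have in_ball: "\<rho> \<sigma> \<in> cball z1 r" if "\<sigma> \<in> {s..1}" for \<sigma>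
    using d(2)[of \<sigma>] that d(1) by (auto simp: s_def dist_real_def dist_commute)
  have "(\<rho> has_vector_derivative Y \<sigma> (\<rho> \<sigma>)) (at \<sigma> within {s..1})" if "\<sigma> \<in> {s..1}" for \<sigma>
  proof -
    have "\<pi> (\<rho> \<sigma>) = \<rho> \<sigma>" unfolding \<pi>_def by (rule closest_point_self[OF in_ball[OF that]])
    then show ?thesis using has_vector_derivative_at_within[OF \<rho>(2)[of \<sigma>], of "{s..1}"] that s by simp
  qed
  then show ?thesis using s \<rho>(1) in_ball rS by (intro exI[of _ s] exI[of _ \<rho>]) auto
qed

end

section \<open>The asymptotic map as a flow over compactified time\<close>

locale nontrapping_metric = long_range_metric a \<mu> for a :: "real^'n \<Rightarrow> real^'n^'n" and \<mu> :: real +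
  assumes nontrapping: "\<And>p. snd p \<noteq> 0 \<Longrightarrow>
    filterlim (\<lambda>t. norm (fst (hamilton_flow (kinetic a) t p))) at_top at_top"
begin

abbreviation flow :: "real \<Rightarrow> (real^'n) \<times> (real^'n) \<Rightarrow> (real^'n) \<times> (real^'n)" where
  "flow \<equiv> hamilton_flow (kinetic a)"

text \<open>Before \<open>\<sigma> = 1\<close> this is the Hamilton flow in modified coordinates.
  The choice serves to name the value at \<open>\<sigma> = 1\<close>, the limit, for which there is
  no formula.\<close>

definition \<phi> :: "real \<Rightarrow> (real^'n) \<times> (real^'n) \<Rightarrow> (real^'n) \<times> (real^'n)" where
  "\<phi> \<sigma> p = (SOME \<zeta>. (\<forall>\<sigma>\<in>{0..<1}. \<zeta> \<sigma> = modified (time \<sigma>) (flow (time \<sigma>) p)) \<and>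
    (\<forall>\<sigma>\<in>{0..1}. \<zeta> \<sigma> \<in> SP \<and> (\<zeta> has_vector_derivative Y \<sigma> (\<zeta> \<sigma>)) (at \<sigma> within {0..1}))) \<sigma>"

lemma phase_spaceD: "p \<in> SP \<Longrightarrow> snd p \<noteq> 0"
  by (simp add: mem_phase_space)

lemma \<phi>_props:
  assumes "p \<in> SP"
  shows "\<And>\<sigma>. \<sigma> \<in> {0..<1} \<Longrightarrow> \<phi> \<sigma> p = modified (time \<sigma>) (flow (time \<sigma>) p)"
    "\<And>\<sigma>. \<sigma> \<in> {0..1} \<Longrightarrow> \<phi> \<sigma> p \<in> SP"
    "\<And>\<sigma>. \<sigma> \<in> {0..1} \<Longrightarrow> ((\<lambda>\<sigma>. \<phi> \<sigma> p) has_vector_derivative Y \<sigma> (\<phi> \<sigma> p)) (at \<sigma> within {0..1})"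
proof -
  let ?P = "\<lambda>\<zeta>. (\<forall>\<sigma>\<in>{0..<1}. \<zeta> \<sigma> = modified (time \<sigma>) (flow (time \<sigma>) p)) \<and>
    (\<forall>\<sigma>\<in>{0..1}. \<zeta> \<sigma> \<in> SP \<and> (\<zeta> has_vector_derivative Y \<sigma> (\<zeta> \<sigma>)) (at \<sigma> within {0..1}))"
  have "\<exists>\<zeta>. ?P \<zeta>"
    by (rule compactified_solution[OF hamilton_flow_derivative _ nontrapping[OF phase_spaceD[OF assms]]])
      (simp add: hamilton_flow_0 phase_spaceD[OF assms])
  then have "?P (SOME \<zeta>. ?P \<zeta>)" by (rule someI_ex)
  then have "?P (\<lambda>\<sigma>. \<phi> \<sigma> p)" unfolding \<phi>_def .
  then show "\<And>\<sigma>. \<sigma> \<in> {0..<1} \<Longrightarrow> \<phi> \<sigma> p = modified (time \<sigma>) (flow (time \<sigma>) p)"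
    "\<And>\<sigma>. \<sigma> \<in> {0..1} \<Longrightarrow> \<phi> \<sigma> p \<in> SP"
    "\<And>\<sigma>. \<sigma> \<in> {0..1} \<Longrightarrow> ((\<lambda>\<sigma>. \<phi> \<sigma> p) has_vector_derivative Y \<sigma> (\<phi> \<sigma> p)) (at \<sigma> within {0..1})" by auto
qed

lemma \<phi>_0: "p \<in> SP \<Longrightarrow> \<phi> 0 p = p"
  by (subst \<phi>_props(1)) (auto simp: time_0 hamilton_flow_0 modified_def Q_def)

lemma \<phi>_smooth: "Ck_family k {} {0..1} SP w \<phi>"
  by (rule solution_family_Ck[OF open_SP open_SP, of 0 _ _ _ Y])
    (use Y_Ck_family \<phi>_props \<phi>_0 in auto)

text \<open>Uniqueness is applied backwards from \<open>\<sigma> = 1\<close>, that is from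
  infinity.\<close>

lemma \<phi>_inj:
  assumes "p \<in> SP" "q \<in> SP" "\<phi> 1 p = \<phi> 1 q"
  shows "p = q"
proof -
  have "\<phi> 0 p = \<phi> 0 q"
    by (rule solution_unique[OF open_SP Y_Ck_family, where \<tau> = 1 and \<psi> = "\<lambda>\<sigma>. \<phi> \<sigma> q" and \<rho> = "\<lambda>\<sigma>. \<phi> \<sigma> p"])
      (use \<phi>_props[OF assms(1)] \<phi>_props[OF assms(2)] assms(3) in auto)
  then show ?thesis using \<phi>_0 assms by simp
qed

text \<open>The solution with data \<open>z1\<close> at infinity is followed back to the time
  \<open>s\<close>. The complete Hamilton trajectory through that point supplies the datum at time
  0, and uniqueness from \<open>s\<close> to 1 identifies the two solutions.\<close>

lemma \<phi>_surj:
  assumes "z1 \<in> SP"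
  shows "\<exists>p\<in>SP. \<phi> 1 p = z1"
proof -
  obtain s \<rho> where s: "0 \<le> s" "s < 1" and \<rho>: "\<rho> 1 = z1" "\<And>\<sigma>. \<sigma> \<in> {s..1} \<Longrightarrow> \<rho> \<sigma> \<in> SP"
    "\<And>\<sigma>. \<sigma> \<in> {s..1} \<Longrightarrow> (\<rho> has_vector_derivative Y \<sigma> (\<rho> \<sigma>)) (at \<sigma> within {s..1})"
    using solution_at_infinity[OF assms] by blast
  obtain \<gamma> where \<gamma>: "\<gamma> (time s) = (position (time s) (\<rho> s), snd (\<rho> s))" "\<And>t. (\<gamma> has_vector_derivative H (\<gamma> t)) (at t)"
    using trajectory_exists by blast
  have "snd (\<gamma> (time s)) \<noteq> 0" using \<rho>(2)[of s] s \<gamma>(1) by (simp add: mem_phase_space)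
  then have "snd (\<gamma> 0) \<noteq> 0" by (rule trajectory_phase_space[OF \<gamma>(2)])
  then have p: "\<gamma> 0 \<in> SP" by (simp add: mem_phase_space)
  have "\<phi> s (\<gamma> 0) = \<rho> s"
    using \<phi>_props(1)[OF p, of s] s hamilton_flow_eq[OF refl \<gamma>(2)] \<gamma>(1) by (simp add: modified_position)
  have "\<phi> 1 (\<gamma> 0) = \<rho> 1"
  proof (rule solution_unique[OF open_SP, of s 1 "\<lambda>_. 1" Y s \<rho> "\<lambda>\<sigma>. \<phi> \<sigma> (\<gamma> 0)"])
    show "Ck_family (Suc 0) {} {s..1} SP (\<lambda>_. 1) Y" by (rule Ck_family_subset[OF Y_Ck_family]) (use s in auto)
    show "((\<lambda>\<sigma>. \<phi> \<sigma> (\<gamma> 0)) has_vector_derivative Y t (\<phi> t (\<gamma> 0))) (at t within {s..1})" if "t \<in> {s..1}" for t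
      by (rule has_vector_derivative_within_subset[OF \<phi>_props(3)[OF p]]) (use that s in auto)
  qed (use s \<rho> \<open>\<phi> s (\<gamma> 0) = \<rho> s\<close> in auto)
  then show ?thesis using p \<rho>(1) by auto
qed

lemma \<phi>_bij: "bij_betw (\<phi> 1) SP SP"
  unfolding bij_betw_def
proof
  show "inj_on (\<phi> 1) SP" by (rule inj_onI) (rule \<phi>_inj)
  show "\<phi> 1 ` SP = SP" using \<phi>_props(2)[of _ 1] \<phi>_surj by (auto simp: image_iff) metis
qed

lemma \<phi>_1_smooth: "smooth_on (\<phi> 1) SP"
  unfolding smooth_on_def using Ck_family_Ck_on[OF \<phi>_smooth, of 1] by auto

text \<open>The curves \<open>\<sigma> \<mapsto> \<phi> \<sigma> (?G q)\<close> are the solutions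
  with value \<open>q\<close> at \<open>\<sigma> = 1\<close>. Smooth dependence on that datum, read
  off at \<open>\<sigma> = 0\<close>, gives the claim without an inverse function theorem.\<close>

lemma \<phi>_1_inverse_smooth: "smooth_on (inv_into SP (\<phi> 1)) SP"
proof -
  let ?G = "inv_into SP (\<phi> 1)"
  have G: "?G q \<in> SP" "\<phi> 1 (?G q) = q" if "q \<in> SP" for q
    using that \<phi>_bij inv_into_into[of q "\<phi> 1" SP] f_inv_into_f[of q "\<phi> 1" SP] by (auto simp: bij_betw_def)
  have "Ck_family k {} {0..1} SP (\<lambda>_. 1) (\<lambda>\<sigma> q. \<phi> \<sigma> (?G q))" for k
    by (rule solution_family_Ck[OF open_SP open_SP, of 1 _ _ _ Y])
      (use Y_Ck_family \<phi>_props[OF G(1)] G(2) in auto)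
  then have "smooth_on (\<lambda>q. \<phi> 0 (?G q)) SP" unfolding smooth_on_def using Ck_family_Ck_on[of _ "{}" "{0..1}" SP _ _ 0] by fastforce
  then show ?thesis by (rule smooth_on_cong[OF open_SP]) (simp add: \<phi>_0 G(1))
qed

lemma flow_phase_space: "p \<in> SP \<Longrightarrow> snd (flow t p) \<noteq> 0"
  by (rule trajectory_phase_space[OF hamilton_flow_derivative, where \<tau> = 0]) (simp add: hamilton_flow_0 phase_spaceD)

lemma modified_position_eq:
  assumes "p \<in> SP" "t \<ge> 0"
  shows "(modified_position (kinetic a) p t, momentum (kinetic a) p t) = \<phi> (time_inv t) p"
  using \<phi>_props(1)[OF assms(1) time_inv_range[OF assms(2)]] grad_Psi[OF assms(2) flow_phase_space[OF assms(1), of t]]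
  by (simp add: time_time_inv[OF assms(2)] modified_def modified_position_def momentum_def algebra_simps)

lemma asymptotics_at_top:
  assumes "p \<in> SP"
  shows "(modified_position (kinetic a) p \<longlongrightarrow> fst (\<phi> 1 p)) at_top" "(momentum (kinetic a) p \<longlongrightarrow> snd (\<phi> 1 p)) at_top"
proof -
  have "continuous_on {0..1} (\<lambda>\<sigma>. \<phi> \<sigma> p)" by (rule continuous_on_vector_derivative[OF \<phi>_props(3)[OF assms]])
  then have "((\<lambda>\<sigma>. \<phi> \<sigma> p) \<longlongrightarrow> \<phi> 1 p) (at 1 within {0..1})" by (simp add: continuous_on_def)
  from filterlim_compose[OF this time_inv_tendsto]
  have "((\<lambda>t. \<phi> (time_inv t) p) \<longlongrightarrow> \<phi> 1 p) at_top" .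
  moreover have "\<forall>\<^sub>F t in at_top. \<phi> (time_inv t) p = (modified_position (kinetic a) p t, momentum (kinetic a) p t)"
    using eventually_ge_at_top[of 0] by eventually_elim (simp add: modified_position_eq[OF assms])
  ultimately have lim: "((\<lambda>t. (modified_position (kinetic a) p t, momentum (kinetic a) p t)) \<longlongrightarrow> \<phi> 1 p) at_top"
    by (rule Lim_transform_eventually)
  show "(modified_position (kinetic a) p \<longlongrightarrow> fst (\<phi> 1 p)) at_top" using tendsto_fst[OF lim] by simp
  show "(momentum (kinetic a) p \<longlongrightarrow> snd (\<phi> 1 p)) at_top" using tendsto_snd[OF lim] by simp
qed

text \<open>Time reversal \<open>(t, x, \<xi>) \<mapsto> (- t, x, - \<xi>)\<close> is a symmetry, which reduces the limit at \<open>-\<infinity>\<close> to the one at \<open>\<infinity>\<close>.\<close>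

definition reversal :: "(real^'n) \<times> (real^'n) \<Rightarrow> (real^'n) \<times> (real^'n)" where
  "reversal p = (fst p, - snd p)"

lemma reversal: "bounded_linear reversal" "reversal (reversal p) = p" "p \<in> SP \<Longrightarrow> reversal p \<in> SP"
  unfolding reversal_def[abs_def]
  by (intro bounded_linear_Pair bounded_linear_fst bounded_linear_minus bounded_linear_snd) (auto simp: mem_phase_space)

text \<open>The energy is even in the momentum, so \<open>reversal\<close> carries \<open>H\<close>
  to its negative, which amounts to running time backwards.\<close>

lemma flow_reversal: "flow (- t) p = reversal (flow t (reversal p))"
proof -
  have HR: "H (reversal z) = - reversal (H z)" for z
    by (simp add: H_def reversal_def grad_x_def vec_eq_iff matrix_vector_mult_def sum_negf)
  have "((\<lambda>s. reversal (flow (- s) (reversal p))) has_vector_derivative H (reversal (flow (- s) (reversal p)))) (at s)" for s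
  proof -
    have "((\<lambda>s. flow (- s) (reversal p)) has_vector_derivative - H (flow (- s) (reversal p))) (at s)"
      by (rule has_vector_derivative_reflect, rule has_vector_derivative_at_within, rule hamilton_flow_derivative)
    from bounded_linear.has_vector_derivative[OF reversal(1) this] show ?thesis
      by (simp add: HR linear_neg[OF bounded_linear.linear[OF reversal(1)]])
  qed
  from hamilton_flow_eq[OF _ this, of p "- t"] show ?thesis by (simp add: hamilton_flow_0 reversal(2))
qed

text \<open>The orientation of the integral gives \<open>Psi (kinetic a) (- t) \<zeta> = - Psi
  (kinetic a) t (- \<zeta>)\<close>. In the gradient the two signs cancel.\<close>

lemma grad_Psi_reversal:
  assumes "t \<ge> 0" "\<eta> \<noteq> 0"
  shows "grad (Psi (kinetic a) (- t)) (- \<eta>) = grad (Psi (kinetic a) t) \<eta>"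
proof -
  have k: "kinetic a x (- \<xi>) = kinetic a x \<xi>" for x \<xi> by (simp add: kinetic_def)
  have eq: "Psi (kinetic a) (- t) \<zeta> = - Psi (kinetic a) t (- \<zeta>)" for \<zeta>
  proof -
    have "Psi (kinetic a) (- t) \<zeta> = (LBINT s=ereal t..ereal 0. kinetic a (- s *\<^sub>R \<zeta>) \<zeta>)"
      unfolding Psi_def by (subst interval_integral_reflect) simp
    also have "\<dots> = - Psi (kinetic a) t (- \<zeta>)"
      unfolding Psi_def by (subst interval_integral_endpoints_reverse) (simp add: k)
    finally show ?thesis .
  qed
  have "(uminus has_derivative uminus) (at (- \<eta>))" by (auto intro!: derivative_eq_intros)
  moreover have "(Psi (kinetic a) t has_derivative (\<lambda>v. (t *\<^sub>R \<eta> + Q t \<eta>) \<bullet> v)) (at (- (- \<eta>)))"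
    using Psi_has_derivative[OF assms] by simp
  ultimately have "((\<lambda>\<zeta>. Psi (kinetic a) t (- \<zeta>)) has_derivative (\<lambda>v. (t *\<^sub>R \<eta> + Q t \<eta>) \<bullet> (- v))) (at (- \<eta>))"
    using diff_chain_at[of uminus uminus "- \<eta>" "Psi (kinetic a) t" "\<lambda>v. (t *\<^sub>R \<eta> + Q t \<eta>) \<bullet> v"] by (simp only: o_def)
  from has_derivative_minus[OF this]
  have "(Psi (kinetic a) (- t) has_derivative (\<lambda>v. (t *\<^sub>R \<eta> + Q t \<eta>) \<bullet> v)) (at (- \<eta>))" by (simp add: eq[abs_def])
  from grad_eqI[OF this] show ?thesis using grad_Psi[OF assms] by simp
qed

lemma asymptotics_at_bot:
  assumes "p \<in> SP"
  shows "(modified_position (kinetic a) p \<longlongrightarrow> fst (reversal (\<phi> 1 (reversal p)))) at_bot"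
    "(momentum (kinetic a) p \<longlongrightarrow> snd (reversal (\<phi> 1 (reversal p)))) at_bot"
proof -
  note q = reversal(3)[OF assms]
  have x: "modified_position (kinetic a) p (- t) = modified_position (kinetic a) (reversal p) t"
    and \<xi>: "momentum (kinetic a) p (- t) = - momentum (kinetic a) (reversal p) t" if "t \<ge> 0" for t
    using grad_Psi_reversal[OF that flow_phase_space[OF q, of t]]
    by (simp_all add: modified_position_def momentum_def flow_reversal reversal_def)
  have "((\<lambda>t. modified_position (kinetic a) p (- t)) \<longlongrightarrow> fst (reversal (\<phi> 1 (reversal p)))) at_top"
  proof (rule Lim_transform_eventually)
    show "(modified_position (kinetic a) (reversal p) \<longlongrightarrow> fst (reversal (\<phi> 1 (reversal p)))) at_top"
      using asymptotics_at_top(1)[OF q] by (simp add: reversal_def)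
    show "\<forall>\<^sub>F t in at_top. modified_position (kinetic a) (reversal p) t = modified_position (kinetic a) p (- t)"
      using eventually_ge_at_top[of 0] by eventually_elim (simp add: x)
  qed
  then show "(modified_position (kinetic a) p \<longlongrightarrow> fst (reversal (\<phi> 1 (reversal p)))) at_bot"
    by (simp add: filterlim_at_bot_mirror)
  have "((\<lambda>t. momentum (kinetic a) p (- t)) \<longlongrightarrow> snd (reversal (\<phi> 1 (reversal p)))) at_top"
  proof (rule Lim_transform_eventually)
    show "((\<lambda>t. - momentum (kinetic a) (reversal p) t) \<longlongrightarrow> snd (reversal (\<phi> 1 (reversal p)))) at_top"
      using tendsto_minus[OF asymptotics_at_top(2)[OF q]] by (simp add: reversal_def)
    show "\<forall>\<^sub>F t in at_top. - momentum (kinetic a) (reversal p) t = momentum (kinetic a) p (- t)"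
      using eventually_ge_at_top[of 0] by eventually_elim (simp add: \<xi>)
  qed
  then show "(momentum (kinetic a) p \<longlongrightarrow> snd (reversal (\<phi> 1 (reversal p)))) at_bot"
    by (simp add: filterlim_at_bot_mirror)
qed

section \<open>Bijectivity and smoothness of the wave maps\<close>

text \<open>The asymptotic map is known only on the phase space, where it agrees with a smooth
  bijection \<open>W\<close>. All comparisons of inverses are therefore made on that set;
  \<open>G\<close> is a more explicit form of the inverse of \<open>W\<close>.\<close>

lemma diffeomorphism_inverse:
  assumes W: "bij_betw W SP SP" "smooth_on W SP" "smooth_on G SP" "\<And>q. q \<in> SP \<Longrightarrow> G q = inv_into SP W q"
    and A: "\<And>p. p \<in> SP \<Longrightarrow> A p = W p"
  shows "bij_betw A SP SP \<and> diffeomorphism_on (inv_into SP A) SP SP"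
proof -
  have bij: "bij_betw A SP SP" using W(1) A by (simp cong: bij_betw_cong)
  have "inv_into SP A q = G q" if "q \<in> SP" for q
  proof -
    have "A (inv_into SP W q) = q" "inv_into SP W q \<in> SP"
      using that W(1) A inv_into_into[of q W SP] f_inv_into_f[of q W SP] by (auto simp: bij_betw_def)
    then have "inv_into SP A q = inv_into SP W q" using bij_betw_inv_into_left[OF bij] by metis
    then show ?thesis using W(4)[OF that] by simp
  qed
  then have "smooth_on (inv_into SP A) SP" by (rule smooth_on_cong[OF open_SP W(3)])
  moreover have "smooth_on (inv_into SP (inv_into SP A)) SP"
    by (rule smooth_on_cong[OF open_SP W(2)]) (use A inv_into_inv_into_eq[OF bij] in simp)
  ultimately show ?thesis using bij bij_betw_inv_into[OF bij] by (simp add: diffeomorphism_on_def)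
qed

lemma wave_map_at_top:
  "bij_betw (asymptotic_data (kinetic a) at_top) SP SP \<and>
   diffeomorphism_on (classical_wave_map (kinetic a) at_top) SP SP"
  unfolding classical_wave_map_def
proof (rule diffeomorphism_inverse[OF \<phi>_bij \<phi>_1_smooth \<phi>_1_inverse_smooth refl])
  fix p :: "(real^'n) \<times> (real^'n)" assume p: "p \<in> SP"
  show "asymptotic_data (kinetic a) at_top p = \<phi> 1 p"
    unfolding asymptotic_data_def using tendsto_Lim[OF trivial_limit_at_top_linorder asymptotics_at_top(1)[OF p]]
      tendsto_Lim[OF trivial_limit_at_top_linorder asymptotics_at_top(2)[OF p]] by simp
qed

lemma wave_map_at_bot:
  "bij_betw (asymptotic_data (kinetic a) at_bot) SP SP \<and>
   diffeomorphism_on (classical_wave_map (kinetic a) at_bot) SP SP"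
  unfolding classical_wave_map_def
proof (rule diffeomorphism_inverse)
  let ?W = "\<lambda>p. reversal (\<phi> 1 (reversal p))"
  have R: "bij_betw reversal SP SP" by (rule bij_betw_byWitness[of _ reversal]) (auto simp: reversal)
  show bij: "bij_betw ?W SP SP"
    using bij_betw_trans[OF bij_betw_trans[OF R \<phi>_bij] R] by (simp add: o_def)
  show "smooth_on ?W SP" by (rule smooth_on_conjugate[OF open_SP \<phi>_1_smooth reversal(1,3)])
  show "smooth_on (\<lambda>q. reversal (inv_into SP (\<phi> 1) (reversal q))) SP"
    by (rule smooth_on_conjugate[OF open_SP \<phi>_1_inverse_smooth reversal(1,3)])
  show "reversal (inv_into SP (\<phi> 1) (reversal q)) = inv_into SP ?W q" if "q \<in> SP" for q
  proof (rule sym, rule inv_into_f_eq)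
    have "\<phi> 1 ` SP = SP" using \<phi>_bij by (simp add: bij_betw_def)
    then have "inv_into SP (\<phi> 1) (reversal q) \<in> SP" "\<phi> 1 (inv_into SP (\<phi> 1) (reversal q)) = reversal q"
      using inv_into_into[of "reversal q" "\<phi> 1" SP] f_inv_into_f[of "reversal q" "\<phi> 1" SP] reversal(3)[OF that] by auto
    then show "reversal (inv_into SP (\<phi> 1) (reversal q)) \<in> SP" "?W (reversal (inv_into SP (\<phi> 1) (reversal q))) = q"
      by (simp_all add: reversal)
    show "inj_on ?W SP" using bij by (simp add: bij_betw_def)
  qed
  fix p :: "(real^'n) \<times> (real^'n)" assume p: "p \<in> SP"
  show "asymptotic_data (kinetic a) at_bot p = ?W p"
    unfolding asymptotic_data_def using tendsto_Lim[OF trivial_limit_at_bot_linorder asymptotics_at_bot(1)[OF p]]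
      tendsto_Lim[OF trivial_limit_at_bot_linorder asymptotics_at_bot(2)[OF p]] by simp
qed

end

theorem proposition1:
  fixes a :: "real^'n \<Rightarrow> real^'n^'n"
    and V VL VS :: "real^'n \<Rightarrow> real"
    and \<mu> \<nu> :: real
  assumes a_smooth: "\<And>m n. smooth_on (\<lambda>x. a x $ m $ n) UNIV"
    and V_smooth: "smooth_on V UNIV"
    and a_sym: "\<And>x m n. a x $ m $ n = a x $ n $ m"
    and a_pos: "\<And>x v. v \<noteq> 0 \<Longrightarrow> v \<bullet> (a x *v v) > 0"
    and mu: "\<mu> > 1/2"
    and a_V_bound: "\<And>\<alpha>. \<exists>C>0. \<forall>x.
          (\<forall>m n. \<bar>multi_deriv \<alpha> (\<lambda>y. a y $ m $ n - (if m = n then 1 else 0)) x\<bar>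
                   \<le> C * jbracket x powr (- \<mu> - real (mi_order \<alpha>))) \<and>
          \<bar>multi_deriv \<alpha> V x\<bar> \<le> C * jbracket x powr (2 - \<mu> - real (mi_order \<alpha>))"
    and V_split: "\<And>x. V x = VL x + VS x"
    and VL_smooth: "smooth_on VL UNIV"
    and VS_smooth: "smooth_on VS UNIV"
    and nu: "\<nu> > 1"
    and VL_VS_bound: "\<And>\<alpha>. \<exists>C>0. \<forall>x.
          \<bar>multi_deriv \<alpha> VL x\<bar> \<le> C * jbracket x powr (2 - \<mu> - real (mi_order \<alpha>)) \<and>
          \<bar>multi_deriv \<alpha> VS x\<bar> \<le> C * jbracket x powr (2 - \<nu> - real (mi_order \<alpha>))"
    and nontrapping: "\<And>x0 \<xi>0. \<xi>0 \<noteq> 0 \<Longrightarrow>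
          filterlim (\<lambda>t. norm (fst (hamilton_flow (kinetic a) t (x0, \<xi>0)))) at_top at_top \<and>
          filterlim (\<lambda>t. norm (fst (hamilton_flow (kinetic a) t (x0, \<xi>0)))) at_top at_bot"
  shows "\<forall>F\<in>{at_top, at_bot}.
          (\<forall>x0 \<xi>0. \<xi>0 \<noteq> 0 \<longrightarrow>
             (\<exists>xl. (modified_position (kinetic a) (x0, \<xi>0) \<longlongrightarrow> xl) F) \<and>
             (\<exists>\<xi>l. (momentum (kinetic a) (x0, \<xi>0) \<longlongrightarrow> \<xi>l) F)) \<and>
          bij_betw (asymptotic_data (kinetic a) F) phase_space phase_space \<and>
          diffeomorphism_on (classical_wave_map (kinetic a) F) phase_space phase_space"
proof -
  \<comment> \<open>Lowering \<open>\<mu>\<close> weakens the decay bounds, so they persist; any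
    number strictly between 1/2 and 1 would serve in place of 3/4.\<close>
  define \<mu>' where "\<mu>' = min \<mu> (3/4)"
  interpret nontrapping_metric a \<mu>'
  proof
    fix m n and k :: nat
    show "symbol k (- \<mu>') (\<lambda>x. a x $ m $ n - (if m = n then 1 else 0))"
    proof (rule symbol_multi_deriv)
      show "smooth_on (\<lambda>x. a x $ m $ n - (if m = n then 1 else 0)) UNIV"
        unfolding smooth_on_def
      proof
        fix k
        have "Ck_family k {} UNIV UNIV (\<lambda>_. 1) (\<lambda>t x. a x $ m $ n)"
          using a_smooth by (intro Ck_on_Ck_family) (auto simp: smooth_on_def)
        moreover have "Ck_family k {} UNIV UNIV (\<lambda>_. 1) (\<lambda>t x. if m = n then 1 else (0::real))"
          by (rule Ck_family_const_time[where C = 1]) auto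
        ultimately have "Ck_family k {} UNIV UNIV (\<lambda>_. 1) (\<lambda>t x. a x $ m $ n - (if m = n then 1 else 0))"
          by (intro Ck_family_diff open_UNIV)
        then show "Ck_on k (\<lambda>x. a x $ m $ n - (if m = n then 1 else 0)) UNIV" using Ck_family_Ck_on by blast
      qed
      fix \<alpha> :: "'n \<Rightarrow> nat"
      obtain C where C: "C > 0" "\<And>x. \<bar>multi_deriv \<alpha> (\<lambda>y. a y $ m $ n - (if m = n then 1 else 0)) x\<bar>
                   \<le> C * jbracket x powr (- \<mu> - real (mi_order \<alpha>))" using a_V_bound by blast
      have "C * jbracket x powr (- \<mu> - real (mi_order \<alpha>)) \<le> C * jbracket x powr (- \<mu>' - real (mi_order \<alpha>))" for x
        using C(1) jbracket_ge_1[of x] by (intro mult_left_mono powr_mono) (auto simp: \<mu>'_def)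
      then show "\<exists>C. \<forall>x. \<bar>multi_deriv \<alpha> (\<lambda>y. a y $ m $ n - (if m = n then 1 else 0)) x\<bar>
           \<le> C * jbracket x powr (- \<mu>' - real (mi_order \<alpha>))" using C(2) order_trans by blast
    qed
  next
    fix p :: "(real^'n) \<times> (real^'n)" assume "snd p \<noteq> 0"
    then show "filterlim (\<lambda>t. norm (fst (hamilton_flow (kinetic a) t p))) at_top at_top"
      using nontrapping[of "snd p" "fst p"] by simp
  qed (use a_sym a_pos mu in \<open>auto simp: \<mu>'_def\<close>)
  have "(x0, \<xi>0) \<in> SP" if "\<xi>0 \<noteq> 0" for x0 \<xi>0 :: "real^'n" using that by (simp add: mem_phase_space)
  then show ?thesis using asymptotics_at_top asymptotics_at_bot wave_map_at_top wave_map_at_bot by blast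
qed

end
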